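(* Let $T$ be a finite tree. The natural spectral sequence $(E_r,d_r)_{r\ge 1}$ over $\mathbb{F}_2$ associated with the filtered complex $(SC^{\bullet}(T),D+d)$ starts from the Seifert cohomology, i.e. $E_1\cong SH^{\bullet}(T)=\bigoplus_n SH^{\bullet}(T,n)$, and converges to an $E_\infty$ term whose total dimension over $\mathbb{F}_2$ is $0$ or $1$. Its differential $d_1$ is the map on $SH^{\bullet}(T)$ induced by $d$, and for every $n\geq 2$ the higher differential $d_n$ increases the $E$-grading by $n$ and the $Q$-grading by $1$.
   Context: Let $T$ be a finite tree. A configuration $C$ on $T$ is a way of marking some vertices of $T$ by pluses and minuses and making some edges of $T$ red such that every vertex of $T$ is either marked by exactly one of the signs $+,-$ (and is then not an end of any red edge), or is unmarked and is the end of exactly one red edge. Let $Q(C)$ be the number of minuses of $C$, and let $E(C)$ be the sum of the number of minuses and the number of red edges. $SC(T)$ is the $\mathbb{F}_2$-vector space with basis the set of all configurations on $T$; $SC^{k}(T,n)$ is the subspace spanned by configurations with $Q(C)=k$, $E(C)=n$, and $SC^k(T)=\bigoplus_n SC^k(T,n)$. Define linear maps $D,d:SC(T)\to SC(T)$ on basis elements as follows. $D(C)$ is the sum, over all red edges $e$ of $C$, of the two configurations obtained from $C$ by making $e$ non-red and marking one of its ends by $+$ and the other by $-$ (in the two possible ways). $d(C)$ is the sum, over all vertices of $C$ marked by $+$, of the configuration obtained from $C$ by changing that $+$ to $-$. Then $D^2=d^2=0$, $Dd=dD$, so $(D+d)^2=0$; $D$ changes the bigrading $(Q,E)$ by $(1,0)$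 and $d$ changes it by $(1,1)$. The Seifert cohomology $SH^{\bullet}(T)$ is the cohomology of $(SC^{\bullet}(T),D)$; since $D$ preserves $E$, $SH^{\bullet}(T)=\bigoplus_n SH^{\bullet}(T,n)$, where $SH^{\bullet}(T,n)$ is the cohomology of the subcomplex $(SC^{\bullet}(T,n),D)$. The total complex $(SC^{\bullet}(T),D+d)$, graded by $Q$, is filtered by the subcomplexes $F^p=\bigoplus_{n\ge p}SC^{\bullet}(T,n)$; the associated spectral sequence is the one of the bicomplex $SC(T)$ with gradings $E$ and $E-Q$ whose $E_1$ term is the cohomology with respect to $D$. *)

theory Defs
  imports "Jordan_Normal_Form.VS_Connect" "HOL-Algebra.AbelCoset" "HOL-Library.Z2" "HOL-Library.Poly_Mapping"
begin

section \<open>Vector spaces\<close>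

text \<open>
  Vector spaces are \<open>module\<close> records satisfying the locale \<^locale>\<open>vectorspace\<close>; the
  multiplicative fields \<open>mult\<close> and \<open>one\<close> of such a record are irrelevant.
\<close>

definition lin_iso ::
  "('k, 'm) ring_scheme \<Rightarrow> ('k, 'v) module \<Rightarrow> ('k, 'w) module \<Rightarrow> ('v \<Rightarrow> 'w) \<Rightarrow> bool" where
  "lin_iso K V W f \<longleftrightarrow> linear_map K V W f \<and> bij_betw f (carrier V) (carrier W)"

text \<open>The subquotient \<open>Z / B\<close> of \<open>M\<close>, for subspaces \<open>B \<subseteq> Z\<close>; its elements are cosets.\<close>

definition subquot ::
  "('k, 'v) module \<Rightarrow> 'v set \<Rightarrow> 'v set \<Rightarrow> ('k, 'v set) module" where
  "subquot M Z B =
    \<lparr>carrier = (\<lambda>z. B +>\<^bsub>M\<^esub> z) ` Z, mult = undefined, one = undefined,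
     zero = B, add = (\<lambda>X Y. X <+>\<^bsub>M\<^esub> Y),
     smult = (\<lambda>a X. \<Union>x\<in>X. B +>\<^bsub>M\<^esub> (a \<odot>\<^bsub>M\<^esub> x))\<rparr>"

text \<open>
  The map of subquotients induced by \<open>f\<close>: it sends the coset of \<open>z\<close> to the coset of \<open>f z\<close>
  modulo \<open>B\<close>. The union is a single coset of \<open>B\<close> exactly when this is independent of the
  representative, so well-definedness is part of any assertion that the values lie in a quotient
  by \<open>B\<close>.
\<close>

definition induced_map ::
  "('k, 'w) module \<Rightarrow> 'w set \<Rightarrow> ('v \<Rightarrow> 'w) \<Rightarrow> 'v set \<Rightarrow> 'w set" where
  "induced_map N B f X = (\<Union>x\<in>X. B +>\<^bsub>N\<^esub> f x)"

definition dsum :: "('i \<Rightarrow> ('k, 'v) module) \<Rightarrow> ('k, 'i \<Rightarrow> 'v) module" where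
  "dsum M =
    \<lparr>carrier = {f. (\<forall>i. f i \<in> carrier (M i)) \<and> finite {i. f i \<noteq> \<zero>\<^bsub>M i\<^esub>}},
     mult = undefined, one = undefined,
     zero = (\<lambda>i. \<zero>\<^bsub>M i\<^esub>), add = (\<lambda>f g i. f i \<oplus>\<^bsub>M i\<^esub> g i),
     smult = (\<lambda>a f i. a \<odot>\<^bsub>M i\<^esub> f i)\<rparr>"


section \<open>Spectral sequences\<close>

text \<open>
  Indices \<open>r p k\<close> denote the page, the filtration degree and the total (cohomological) degree,
  so the \<open>r\<close>-th differential has bidegree \<open>(r, 1)\<close> in \<open>(p, k)\<close>.
\<close>

definition page_cohomology ::
  "(nat \<Rightarrow> int \<Rightarrow> int \<Rightarrow> ('k, 'v) module) \<Rightarrow> (nat \<Rightarrow> int \<Rightarrow> int \<Rightarrow> 'v \<Rightarrow> 'v) \<Rightarrow>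
   nat \<Rightarrow> int \<Rightarrow> int \<Rightarrow> ('k, 'v set) module" where
  "page_cohomology E dr r p k =
    subquot (E r p k)
      {X \<in> carrier (E r p k). dr r p k X = \<zero>\<^bsub>E r (p + int r) (k + 1)\<^esub>}
      (dr r (p - int r) (k - 1) ` carrier (E r (p - int r) (k - 1)))"

definition spectral_sequence ::
  "('k, 'm) ring_scheme \<Rightarrow> (nat \<Rightarrow> int \<Rightarrow> int \<Rightarrow> ('k, 'v) module) \<Rightarrow>
   (nat \<Rightarrow> int \<Rightarrow> int \<Rightarrow> 'v \<Rightarrow> 'v) \<Rightarrow> (nat \<Rightarrow> int \<Rightarrow> int \<Rightarrow> 'v \<Rightarrow> 'v set) \<Rightarrow> bool" where
  "spectral_sequence K E dr \<phi> \<longleftrightarrow>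
    (\<forall>r\<ge>1. \<forall>p k.
      linear_map K (E r p k) (E r (p + int r) (k + 1)) (dr r p k) \<and>
      (\<forall>X\<in>carrier (E r p k).
         dr r (p + int r) (k + 1) (dr r p k X) = \<zero>\<^bsub>E r (p + 2 * int r) (k + 2)\<^esub>) \<and>
      lin_iso K (E (r + 1) p k) (page_cohomology E dr r p k) (\<phi> r p k))"

text \<open>
  In the following, \<open>M\<close> is an ambient vector space, \<open>F p k \<subseteq> carrier M\<close> is the filtration step
  \<open>F\<^sup>p\<close> in cohomological degree \<open>k\<close> (decreasing in \<open>p\<close>), and \<open>\<delta>\<close> is the differential, of degree 1.
  We use the standard construction
  \<open>E\<^sub>r\<^sup>p = Z\<^sub>r\<^sup>p / (\<delta> Z\<^sub>r\<^sub>-\<^sub>1\<^sup>p\<^sup>-\<^sup>r\<^sup>+\<^sup>1 + Z\<^sub>r\<^sub>-\<^sub>1\<^sup>p\<^sup>+\<^sup>1)\<close> with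
  \<open>Z\<^sub>r\<^sup>p = {x \<in> F\<^sup>p. \<delta> x \<in> F\<^sup>p\<^sup>+\<^sup>r}\<close>, for \<open>r \<ge> 1\<close>.
\<close>

definition ss_Z ::
  "(int \<Rightarrow> int \<Rightarrow> 'v set) \<Rightarrow> ('v \<Rightarrow> 'v) \<Rightarrow> nat \<Rightarrow> int \<Rightarrow> int \<Rightarrow> 'v set" where
  "ss_Z F \<delta> r p k = {x \<in> F p k. \<delta> x \<in> F (p + int r) (k + 1)}"

definition ss_B ::
  "('k, 'v) module \<Rightarrow> (int \<Rightarrow> int \<Rightarrow> 'v set) \<Rightarrow> ('v \<Rightarrow> 'v) \<Rightarrow> nat \<Rightarrow> int \<Rightarrow> int \<Rightarrow> 'v set" where
  "ss_B M F \<delta> r p k =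
    \<delta> ` ss_Z F \<delta> (r - 1) (p - int r + 1) (k - 1) <+>\<^bsub>M\<^esub> ss_Z F \<delta> (r - 1) (p + 1) k"

definition ss_E ::
  "('k, 'v) module \<Rightarrow> (int \<Rightarrow> int \<Rightarrow> 'v set) \<Rightarrow> ('v \<Rightarrow> 'v) \<Rightarrow>
   nat \<Rightarrow> int \<Rightarrow> int \<Rightarrow> ('k, 'v set) module" where
  "ss_E M F \<delta> r p k = subquot M (ss_Z F \<delta> r p k) (ss_B M F \<delta> r p k)"

definition ss_d ::
  "('k, 'v) module \<Rightarrow> (int \<Rightarrow> int \<Rightarrow> 'v set) \<Rightarrow> ('v \<Rightarrow> 'v) \<Rightarrow>
   nat \<Rightarrow> int \<Rightarrow> int \<Rightarrow> 'v set \<Rightarrow> 'v set" where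
  "ss_d M F \<delta> r p k = induced_map M (ss_B M F \<delta> r (p + int r) (k + 1)) \<delta>"

text \<open>
  The canonical map from the page \<open>r + 1\<close> to the cohomology of the page \<open>r\<close>, sending the class
  of \<open>x\<close> to the class of the class of \<open>x\<close>.
\<close>

definition ss_next ::
  "('k, 'v) module \<Rightarrow> (int \<Rightarrow> int \<Rightarrow> 'v set) \<Rightarrow> ('v \<Rightarrow> 'v) \<Rightarrow>
   nat \<Rightarrow> int \<Rightarrow> int \<Rightarrow> 'v set \<Rightarrow> 'v set set" where
  "ss_next M F \<delta> r p k =
    induced_map (ss_E M F \<delta> r p k)
      (ss_d M F \<delta> r (p - int r) (k - 1) ` carrier (ss_E M F \<delta> r (p - int r) (k - 1)))
      (\<lambda>x. ss_B M F \<delta> r p k +>\<^bsub>M\<^esub> x)"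

definition cochains :: "(int \<Rightarrow> int \<Rightarrow> 'v set) \<Rightarrow> int \<Rightarrow> 'v set" where
  "cochains F k = (\<Union>p. F p k)"

definition cohomology ::
  "('k, 'v) module \<Rightarrow> (int \<Rightarrow> 'v set) \<Rightarrow> ('v \<Rightarrow> 'v) \<Rightarrow> int \<Rightarrow> ('k, 'v set) module" where
  "cohomology M C \<delta> k = subquot M {x \<in> C k. \<delta> x = \<zero>\<^bsub>M\<^esub>} (\<delta> ` C (k - 1))"

definition ss_Einf ::
  "('k, 'v) module \<Rightarrow> (int \<Rightarrow> int \<Rightarrow> 'v set) \<Rightarrow> ('v \<Rightarrow> 'v) \<Rightarrow>
   int \<Rightarrow> int \<Rightarrow> ('k, 'v set) module" where
  "ss_Einf M F \<delta> p k =
    subquot M {x \<in> F p k. \<delta> x = \<zero>\<^bsub>M\<^esub>}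
      ((\<delta> ` cochains F (k - 1) \<inter> F p k) <+>\<^bsub>M\<^esub> {x \<in> F (p + 1) k. \<delta> x = \<zero>\<^bsub>M\<^esub>})"

definition coh_filt ::
  "('k, 'v) module \<Rightarrow> (int \<Rightarrow> int \<Rightarrow> 'v set) \<Rightarrow> ('v \<Rightarrow> 'v) \<Rightarrow> int \<Rightarrow> int \<Rightarrow> 'v set set" where
  "coh_filt M F \<delta> p k =
    (\<lambda>x. \<delta> ` cochains F (k - 1) +>\<^bsub>M\<^esub> x) ` {x \<in> F p k. \<delta> x = \<zero>\<^bsub>M\<^esub>}"

definition gr_cohomology ::
  "('k, 'v) module \<Rightarrow> (int \<Rightarrow> int \<Rightarrow> 'v set) \<Rightarrow> ('v \<Rightarrow> 'v) \<Rightarrow>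
   int \<Rightarrow> int \<Rightarrow> ('k, 'v set set) module" where
  "gr_cohomology M F \<delta> p k =
    subquot (cohomology M (cochains F) \<delta> k) (coh_filt M F \<delta> p k) (coh_filt M F \<delta> (p + 1) k)"

text \<open>
  Convergence: the canonical maps identify \<open>E\<^sub>\<infinity>\<close> with \<open>E\<^sub>r\<close> for all large \<open>r\<close>, and with the
  associated graded of the cohomology of the complex.
\<close>

definition ss_converges ::
  "('k, 'm) ring_scheme \<Rightarrow> ('k, 'v) module \<Rightarrow> (int \<Rightarrow> int \<Rightarrow> 'v set) \<Rightarrow> ('v \<Rightarrow> 'v) \<Rightarrow> bool" where
  "ss_converges K M F \<delta> \<longleftrightarrow>
    (\<exists>R\<ge>1. \<forall>r\<ge>R. \<forall>p k.
       lin_iso K (ss_Einf M F \<delta> p k) (ss_E M F \<delta> r p k)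
         (induced_map M (ss_B M F \<delta> r p k) (\<lambda>x. x))) \<and>
    (\<forall>p k.
       lin_iso K (ss_Einf M F \<delta> p k) (gr_cohomology M F \<delta> p k)
         (induced_map (cohomology M (cochains F) \<delta> k) (coh_filt M F \<delta> (p + 1) k)
            (\<lambda>x. \<delta> ` cochains F (k - 1) +>\<^bsub>M\<^esub> x)))"


section \<open>Trees\<close>

record 'a ugraph =
  verts :: "'a set"
  edges :: "'a set set"

definition finite_tree :: "'a ugraph \<Rightarrow> bool" where
  "finite_tree T \<longleftrightarrow>
    finite (verts T) \<and> verts T \<noteq> {} \<and>
    (\<forall>e\<in>edges T. e \<subseteq> verts T \<and> card e = 2) \<and>
    (\<forall>u\<in>verts T. \<forall>v\<in>verts T. (u, v) \<in> {(a, b). {a, b} \<in> edges T}\<^sup>*) \<and>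
    \<not> (\<exists>vs. 3 \<le> length vs \<and> distinct vs \<and>
         successively (\<lambda>u v. {u, v} \<in> edges T) vs \<and> {last vs, hd vs} \<in> edges T)"


section \<open>The Seifert bicomplex of a tree\<close>

record 'a config =
  pluses :: "'a set"
  minuses :: "'a set"
  reds :: "'a set set"

definition configs :: "'a ugraph \<Rightarrow> 'a config set" where
  "configs T =
    {C. pluses C \<subseteq> verts T \<and> minuses C \<subseteq> verts T \<and> reds C \<subseteq> edges T \<and>
        (\<forall>v\<in>verts T.
           (v \<in> pluses C \<longleftrightarrow> v \<notin> minuses C) \<and> (\<forall>e\<in>reds C. v \<notin> e) \<or>
           v \<notin> pluses C \<and> v \<notin> minuses C \<and> (\<exists>!e. e \<in> reds C \<and> v \<in> e))}"

definition Q_deg :: "'a config \<Rightarrow> int" where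
  "Q_deg C = int (card (minuses C))"

definition E_deg :: "'a config \<Rightarrow> int" where
  "E_deg C = int (card (minuses C) + card (reds C))"

abbreviation F2 :: "bit ring" where
  "F2 \<equiv> class_ring"

definition scale_F2 :: "bit \<Rightarrow> ('b \<Rightarrow>\<^sub>0 bit) \<Rightarrow> ('b \<Rightarrow>\<^sub>0 bit)" where
  "scale_F2 a x = Poly_Mapping.map ((*) a) x"

definition lin_ext :: "('b \<Rightarrow> ('c \<Rightarrow>\<^sub>0 bit)) \<Rightarrow> ('b \<Rightarrow>\<^sub>0 bit) \<Rightarrow> ('c \<Rightarrow>\<^sub>0 bit)" where
  "lin_ext f x = (\<Sum>b\<in>Poly_Mapping.keys x. scale_F2 (Poly_Mapping.lookup x b) (f b))"

definition span_of :: "'b set \<Rightarrow> ('b \<Rightarrow>\<^sub>0 bit) set" where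
  "span_of S = {x. Poly_Mapping.keys x \<subseteq> S}"

definition SC :: "'a ugraph \<Rightarrow> (bit, 'a config \<Rightarrow>\<^sub>0 bit) module" where
  "SC T =
    \<lparr>carrier = span_of (configs T), mult = undefined, one = undefined,
     zero = 0, add = (+), smult = scale_F2\<rparr>"

definition SC_deg :: "'a ugraph \<Rightarrow> int \<Rightarrow> ('a config \<Rightarrow>\<^sub>0 bit) set" where
  "SC_deg T k = span_of {C \<in> configs T. Q_deg C = k}"

definition SC_bideg :: "'a ugraph \<Rightarrow> int \<Rightarrow> int \<Rightarrow> ('a config \<Rightarrow>\<^sub>0 bit) set" where
  "SC_bideg T n k = span_of {C \<in> configs T. Q_deg C = k \<and> E_deg C = n}"

definition SC_filt :: "'a ugraph \<Rightarrow> int \<Rightarrow> int \<Rightarrow> ('a config \<Rightarrow>\<^sub>0 bit) set" where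
  "SC_filt T p k = span_of {C \<in> configs T. Q_deg C = k \<and> p \<le> E_deg C}"

definition D_map :: "('a config \<Rightarrow>\<^sub>0 bit) \<Rightarrow> ('a config \<Rightarrow>\<^sub>0 bit)" where
  "D_map = lin_ext (\<lambda>C. \<Sum>e\<in>reds C. \<Sum>u\<in>e.
     Poly_Mapping.single
       \<lparr>pluses = insert u (pluses C), minuses = minuses C \<union> (e - {u}), reds = reds C - {e}\<rparr> 1)"

definition d_map :: "('a config \<Rightarrow>\<^sub>0 bit) \<Rightarrow> ('a config \<Rightarrow>\<^sub>0 bit)" where
  "d_map = lin_ext (\<lambda>C. \<Sum>v\<in>pluses C.
     Poly_Mapping.single
       \<lparr>pluses = pluses C - {v}, minuses = insert v (minuses C), reds = reds C\<rparr> 1)"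

definition total_diff :: "('a config \<Rightarrow>\<^sub>0 bit) \<Rightarrow> ('a config \<Rightarrow>\<^sub>0 bit)" where
  "total_diff x = D_map x + d_map x"

text \<open>
  The \<open>E\<close>-grading precedes the \<open>Q\<close>-grading in the arguments: \<open>SC_bideg T n k\<close> is
  \<open>SC\<^sup>k(T, n)\<close>, and \<open>SH_bideg T n k\<close> is \<open>SH\<^sup>k(T, n)\<close>.
\<close>

definition SH :: "'a ugraph \<Rightarrow> int \<Rightarrow> (bit, ('a config \<Rightarrow>\<^sub>0 bit) set) module" where
  "SH T k = cohomology (SC T) (SC_deg T) D_map k"

definition SH_bideg :: "'a ugraph \<Rightarrow> int \<Rightarrow> int \<Rightarrow> (bit, ('a config \<Rightarrow>\<^sub>0 bit) set) module" where
  "SH_bideg T n k = cohomology (SC T) (SC_bideg T n) D_map k"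

text \<open>The map \<open>SH\<^sup>k(T, n) \<rightarrow> SH\<^sup>k(T)\<close> induced by the inclusion of the subcomplex.\<close>

definition SH_incl ::
  "'a ugraph \<Rightarrow> int \<Rightarrow> ('a config \<Rightarrow>\<^sub>0 bit) set \<Rightarrow> ('a config \<Rightarrow>\<^sub>0 bit) set" where
  "SH_incl T k = induced_map (SC T) (D_map ` SC_deg T (k - 1)) (\<lambda>x. x)"

text \<open>The map \<open>SH\<^sup>k(T, n) \<rightarrow> SH\<^sup>k\<^sup>+\<^sup>1(T, n + 1)\<close> induced by \<open>d\<close>.\<close>

definition SH_d ::
  "'a ugraph \<Rightarrow> int \<Rightarrow> int \<Rightarrow> ('a config \<Rightarrow>\<^sub>0 bit) set \<Rightarrow> ('a config \<Rightarrow>\<^sub>0 bit) set" where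
  "SH_d T n k = induced_map (SC T) (D_map ` SC_bideg T (n + 1) k) d_map"

definition Seifert_E ::
  "'a ugraph \<Rightarrow> nat \<Rightarrow> int \<Rightarrow> int \<Rightarrow> (bit, ('a config \<Rightarrow>\<^sub>0 bit) set) module" where
  "Seifert_E T = ss_E (SC T) (SC_filt T) total_diff"

definition Seifert_d ::
  "'a ugraph \<Rightarrow> nat \<Rightarrow> int \<Rightarrow> int \<Rightarrow> ('a config \<Rightarrow>\<^sub>0 bit) set \<Rightarrow> ('a config \<Rightarrow>\<^sub>0 bit) set" where
  "Seifert_d T = ss_d (SC T) (SC_filt T) total_diff"

text \<open>
  The canonical map from \<open>SH\<^sup>k(T, n)\<close> to the first page: a \<open>D\<close>-cocycle in \<open>SC\<^sup>k(T, n)\<close> is sent to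
  its own class.
\<close>

definition SH_to_E1 ::
  "'a ugraph \<Rightarrow> int \<Rightarrow> int \<Rightarrow> ('a config \<Rightarrow>\<^sub>0 bit) set \<Rightarrow> ('a config \<Rightarrow>\<^sub>0 bit) set" where
  "SH_to_E1 T n k = induced_map (SC T) (ss_B (SC T) (SC_filt T) total_diff 1 n k) (\<lambda>x. x)"

definition Seifert_Einf_total ::
  "'a ugraph \<Rightarrow> (bit, int \<times> int \<Rightarrow> ('a config \<Rightarrow>\<^sub>0 bit) set) module" where
  "Seifert_Einf_total T = dsum (\<lambda>(p, k). ss_Einf (SC T) (SC_filt T) total_diff p k)"

end

theory Submission
  imports Defs
begin

text \<open>
  Everything except the bound on \<open>E\<^sub>\<infinity>\<close> is the general theory of the spectral sequence of a bounded
  filtered complex. For the bound, let \<open>h\<^sub>v\<close> change the sign at a vertex \<open>v\<close> from minus to plus. Then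
  \<open>\<delta> h\<^sub>v + h\<^sub>v \<delta>\<close>, with \<open>\<delta> = D + d\<close>, is the identity on the configurations in which \<open>v\<close> is marked. Killing
  one vertex after the other, every cocycle whose configurations all have a mark is a coboundary.
  Configurations without marks are perfect matchings; they have degree 0, and a tree has at
  most one of them. So the cohomology vanishes outside degree 0, where there are no coboundaries
  and at most one nonzero cocycle. This cocycle contributes to exactly one term of \<open>E\<^sub>\<infinity>\<close>.
\<close>

section \<open>Subquotients\<close>

text \<open>The obstacle is that \<open>plus_homotopy v\<close> lowers the E-grading by one. It does
  not respect the filtration, so it says nothing about a single page; it only computes the
  cohomology of the total complex, and the limit term is read off from cocycles of that complex. The
  homotopy formula holds because a marked vertex \<open>v\<close> lies on no red edge:
  \<open>plus_homotopy v\<close> commutes with D and with the terms of d at the other vertices, and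
  only the term of d at \<open>v\<close> contributes, as the identity. When \<open>v\<close> is
  unmarked the anticommutator need not vanish, since D may split the red edge at \<open>v\<close>
  and put a minus there. Vertices can still be treated one at a time because D, d and the homotopies
  never remove a mark: a configuration marked somewhere in a given set of vertices stays so. At most
  one perfect matching exists because, in the symmetric difference of two of them, every edge can be
  continued at both ends by another edge; unless it is empty it contains a cycle.\<close>

locale subquotient = vectorspace K M
  for K :: "('k, 'm) ring_scheme" and M :: "('k, 'v) module" +
  fixes Z B :: "'v set"
  assumes Z_submodule: "submodule K Z M"
    and B_submodule: "submodule K B M"
    and B_subset_Z: "B \<subseteq> Z"
begin

lemma Z_carrier: "x \<in> Z \<Longrightarrow> x \<in> carrier M"
  using submodule.subset[OF Z_submodule] by auto

lemma B_carrier: "x \<in> B \<Longrightarrow> x \<in> carrier M"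
  using submodule.subset[OF B_submodule] by auto

lemma Z_closed [simp]:
  "x \<in> Z \<Longrightarrow> y \<in> Z \<Longrightarrow> x \<oplus>\<^bsub>M\<^esub> y \<in> Z"
  "\<zero>\<^bsub>M\<^esub> \<in> Z"
  "a \<in> carrier K \<Longrightarrow> x \<in> Z \<Longrightarrow> a \<odot>\<^bsub>M\<^esub> x \<in> Z"
  using Z_submodule by (auto simp: submodule_def)

lemma B_closed [simp]:
  "x \<in> B \<Longrightarrow> y \<in> B \<Longrightarrow> x \<oplus>\<^bsub>M\<^esub> y \<in> B"
  "\<zero>\<^bsub>M\<^esub> \<in> B"
  "a \<in> carrier K \<Longrightarrow> x \<in> B \<Longrightarrow> a \<odot>\<^bsub>M\<^esub> x \<in> B"
  using B_submodule by (auto simp: submodule_def)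

lemma neg_closed [simp]:
  "x \<in> Z \<Longrightarrow> \<ominus>\<^bsub>M\<^esub> x \<in> Z"
  "x \<in> B \<Longrightarrow> \<ominus>\<^bsub>M\<^esub> x \<in> B"
  using Z_closed(3)[of "\<ominus>\<^bsub>K\<^esub> \<one>\<^bsub>K\<^esub>" x] B_closed(3)[of "\<ominus>\<^bsub>K\<^esub> \<one>\<^bsub>K\<^esub>" x]
  by (simp_all add: smult_minus_1 Z_carrier B_carrier)

lemma coset_mem_iff:
  assumes "x \<in> carrier M"
  shows "y \<in> B +>\<^bsub>M\<^esub> x \<longleftrightarrow> y \<in> carrier M \<and> y \<ominus>\<^bsub>M\<^esub> x \<in> B"
proof
  assume "y \<in> B +>\<^bsub>M\<^esub> x"
  then obtain b where b: "b \<in> B" "y = b \<oplus>\<^bsub>M\<^esub> x" by (auto simp: a_r_coset_def')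
  have "y \<ominus>\<^bsub>M\<^esub> x = b"
    using b assms B_carrier[OF b(1)] by (simp add: a_minus_def M.a_assoc M.r_neg)
  then show "y \<in> carrier M \<and> y \<ominus>\<^bsub>M\<^esub> x \<in> B" using b B_carrier[OF b(1)] assms by simp
next
  assume y: "y \<in> carrier M \<and> y \<ominus>\<^bsub>M\<^esub> x \<in> B"
  have "y = (y \<ominus>\<^bsub>M\<^esub> x) \<oplus>\<^bsub>M\<^esub> x"
    using y assms by (simp add: a_minus_def M.a_assoc M.l_neg)
  then show "y \<in> B +>\<^bsub>M\<^esub> x" using y by (auto simp: a_r_coset_def')
qed

lemma coset_mem_self: "x \<in> carrier M \<Longrightarrow> x \<in> B +>\<^bsub>M\<^esub> x"
  by (auto simp: a_r_coset_def' intro!: bexI[of _ "\<zero>\<^bsub>M\<^esub>"])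

lemma coset_add_left:
  assumes "x \<in> carrier M" "b \<in> B"
  shows "B +>\<^bsub>M\<^esub> (b \<oplus>\<^bsub>M\<^esub> x) = B +>\<^bsub>M\<^esub> x"
proof -
  have "y \<ominus>\<^bsub>M\<^esub> (b \<oplus>\<^bsub>M\<^esub> x) \<in> B \<longleftrightarrow> y \<ominus>\<^bsub>M\<^esub> x \<in> B" if "y \<in> carrier M" for y
  proof -
    have b: "b \<in> carrier M" "\<ominus>\<^bsub>M\<^esub> b \<in> B" using assms B_carrier by auto
    have 1: "y \<ominus>\<^bsub>M\<^esub> (b \<oplus>\<^bsub>M\<^esub> x) = (y \<ominus>\<^bsub>M\<^esub> x) \<oplus>\<^bsub>M\<^esub> (\<ominus>\<^bsub>M\<^esub> b)"
      using assms b that by (simp add: a_minus_def M.minus_add M.a_ac)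
    have 2: "y \<ominus>\<^bsub>M\<^esub> x = (y \<ominus>\<^bsub>M\<^esub> (b \<oplus>\<^bsub>M\<^esub> x)) \<oplus>\<^bsub>M\<^esub> b"
      unfolding 1 using assms b that by (simp add: a_minus_def M.a_assoc M.l_neg)
    show ?thesis using 1 2 b assms(2) by (metis B_closed(1))
  qed
  then show ?thesis using coset_mem_iff assms B_carrier[OF assms(2)] by auto
qed

lemma coset_eq_iff:
  assumes "x \<in> carrier M" "y \<in> carrier M"
  shows "B +>\<^bsub>M\<^esub> x = B +>\<^bsub>M\<^esub> y \<longleftrightarrow> x \<ominus>\<^bsub>M\<^esub> y \<in> B"
proof
  assume "B +>\<^bsub>M\<^esub> x = B +>\<^bsub>M\<^esub> y"
  then have "x \<in> B +>\<^bsub>M\<^esub> y" using coset_mem_self[OF assms(1)] by auto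
  then show "x \<ominus>\<^bsub>M\<^esub> y \<in> B" using coset_mem_iff assms by auto
next
  assume "x \<ominus>\<^bsub>M\<^esub> y \<in> B"
  moreover have "x = (x \<ominus>\<^bsub>M\<^esub> y) \<oplus>\<^bsub>M\<^esub> y"
    using assms by (simp add: a_minus_def M.a_assoc M.l_neg)
  ultimately show "B +>\<^bsub>M\<^esub> x = B +>\<^bsub>M\<^esub> y" using coset_add_left assms by metis
qed

lemma coset_eq_B_iff:
  assumes "x \<in> carrier M"
  shows "B +>\<^bsub>M\<^esub> x = B \<longleftrightarrow> x \<in> B"
proof -
  have "\<ominus>\<^bsub>M\<^esub> \<zero>\<^bsub>M\<^esub> = \<zero>\<^bsub>M\<^esub>" using M.r_neg[of "\<zero>\<^bsub>M\<^esub>"] by simp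
  then have "x \<ominus>\<^bsub>M\<^esub> \<zero>\<^bsub>M\<^esub> = x" using assms by (simp add: a_minus_def)
  moreover have "B +>\<^bsub>M\<^esub> \<zero>\<^bsub>M\<^esub> = B" using B_carrier by (intro M.a_coset_add_zero) auto
  ultimately show ?thesis using coset_eq_iff[OF assms, of "\<zero>\<^bsub>M\<^esub>"] by simp
qed

lemma coset_add:
  assumes x: "x \<in> carrier M" and y: "y \<in> carrier M"
  shows "(B +>\<^bsub>M\<^esub> x) <+>\<^bsub>M\<^esub> (B +>\<^bsub>M\<^esub> y) = B +>\<^bsub>M\<^esub> (x \<oplus>\<^bsub>M\<^esub> y)"
proof (intro equalityI subsetI)
  fix u assume "u \<in> (B +>\<^bsub>M\<^esub> x) <+>\<^bsub>M\<^esub> (B +>\<^bsub>M\<^esub> y)"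
  then obtain b c where b: "b \<in> B" "c \<in> B" "u = (b \<oplus>\<^bsub>M\<^esub> x) \<oplus>\<^bsub>M\<^esub> (c \<oplus>\<^bsub>M\<^esub> y)"
    by (auto simp: set_add_def' a_r_coset_def')
  have "u = (b \<oplus>\<^bsub>M\<^esub> c) \<oplus>\<^bsub>M\<^esub> (x \<oplus>\<^bsub>M\<^esub> y)"
    using b B_carrier x y by (simp add: M.a_ac)
  then show "u \<in> B +>\<^bsub>M\<^esub> (x \<oplus>\<^bsub>M\<^esub> y)" using b by (auto simp: a_r_coset_def')
next
  fix u assume "u \<in> B +>\<^bsub>M\<^esub> (x \<oplus>\<^bsub>M\<^esub> y)"
  then obtain b where b: "b \<in> B" "u = b \<oplus>\<^bsub>M\<^esub> (x \<oplus>\<^bsub>M\<^esub> y)"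
    by (auto simp: a_r_coset_def')
  have "u = (b \<oplus>\<^bsub>M\<^esub> x) \<oplus>\<^bsub>M\<^esub> y" using b B_carrier x y by (simp add: M.a_ac)
  moreover have "b \<oplus>\<^bsub>M\<^esub> x \<in> B +>\<^bsub>M\<^esub> x" using b by (auto simp: a_r_coset_def')
  ultimately show "u \<in> (B +>\<^bsub>M\<^esub> x) <+>\<^bsub>M\<^esub> (B +>\<^bsub>M\<^esub> y)"
    using coset_mem_self[OF y] by (auto simp: set_add_def')
qed

lemma subquot_carrier: "carrier (subquot M Z B) = (\<lambda>z. B +>\<^bsub>M\<^esub> z) ` Z"
  and subquot_zero: "\<zero>\<^bsub>subquot M Z B\<^esub> = B"
  by (simp_all add: subquot_def)

lemma subquot_zero_coset: "\<zero>\<^bsub>subquot M Z B\<^esub> = B +>\<^bsub>M\<^esub> \<zero>\<^bsub>M\<^esub>"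
  using coset_eq_B_iff[of "\<zero>\<^bsub>M\<^esub>"] by (simp add: subquot_zero)

lemma subquot_add:
  "x \<in> Z \<Longrightarrow> y \<in> Z \<Longrightarrow>
   (B +>\<^bsub>M\<^esub> x) \<oplus>\<^bsub>subquot M Z B\<^esub> (B +>\<^bsub>M\<^esub> y) = B +>\<^bsub>M\<^esub> (x \<oplus>\<^bsub>M\<^esub> y)"
  by (simp add: subquot_def coset_add Z_carrier)

text \<open>The definition takes a union over all representatives because scaling a coset setwise by
  0 would leave only the zero vector instead of \<open>B\<close>. The union is a single coset since
  multiples of elements of \<open>B\<close> stay in \<open>B\<close>.\<close>

lemma subquot_smult:
  assumes "a \<in> carrier K" "x \<in> Z"
  shows "a \<odot>\<^bsub>subquot M Z B\<^esub> (B +>\<^bsub>M\<^esub> x) = B +>\<^bsub>M\<^esub> (a \<odot>\<^bsub>M\<^esub> x)"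
proof -
  have "B +>\<^bsub>M\<^esub> (a \<odot>\<^bsub>M\<^esub> y) = B +>\<^bsub>M\<^esub> (a \<odot>\<^bsub>M\<^esub> x)" if y: "y \<in> B +>\<^bsub>M\<^esub> x" for y
  proof -
    obtain b where b: "b \<in> B" "y = b \<oplus>\<^bsub>M\<^esub> x" using y by (auto simp: a_r_coset_def')
    then show ?thesis
      using assms B_carrier[OF b(1)] Z_carrier[OF assms(2)]
      by (simp add: smult_r_distr coset_add_left)
  qed
  then have "(\<Union>y\<in>B +>\<^bsub>M\<^esub> x. B +>\<^bsub>M\<^esub> (a \<odot>\<^bsub>M\<^esub> y)) = B +>\<^bsub>M\<^esub> (a \<odot>\<^bsub>M\<^esub> x)"
    using coset_mem_self[OF Z_carrier[OF assms(2)]] by (intro UN_constant_eq[of x]) blast+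
  then show ?thesis by (simp add: subquot_def)
qed

text \<open>Subquotients get nested: the cohomology of a page and the graded pieces of the
  cohomology are subquotients of subquotients, and this result supplies their ambient vector
  space.\<close>

lemma subquot_vectorspace: "vectorspace K (subquot M Z B)"
proof (rule vs_criteria)
  let ?Q = "subquot M Z B"
  show "field K" by unfold_locales
  show "\<zero>\<^bsub>?Q\<^esub> \<in> carrier ?Q"
    unfolding subquot_zero_coset subquot_carrier by simp
  show "\<forall>v w. v \<in> carrier ?Q \<and> w \<in> carrier ?Q \<longrightarrow> v \<oplus>\<^bsub>?Q\<^esub> w \<in> carrier ?Q"
    by (auto simp: subquot_carrier subquot_add)
  show "\<forall>v\<in>carrier ?Q. \<exists>w\<in>carrier ?Q. v \<oplus>\<^bsub>?Q\<^esub> w = \<zero>\<^bsub>?Q\<^esub>"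
  proof
    fix v assume "v \<in> carrier ?Q"
    then obtain x where x: "x \<in> Z" "v = B +>\<^bsub>M\<^esub> x" by (auto simp: subquot_carrier)
    then have "v \<oplus>\<^bsub>?Q\<^esub> (B +>\<^bsub>M\<^esub> (\<ominus>\<^bsub>M\<^esub> x)) = \<zero>\<^bsub>?Q\<^esub>"
      by (simp add: subquot_add subquot_zero_coset M.r_neg Z_carrier)
    moreover have "B +>\<^bsub>M\<^esub> (\<ominus>\<^bsub>M\<^esub> x) \<in> carrier ?Q"
      using x by (auto simp: subquot_carrier)
    ultimately show "\<exists>w\<in>carrier ?Q. v \<oplus>\<^bsub>?Q\<^esub> w = \<zero>\<^bsub>?Q\<^esub>" by blast
  qed
  show "\<forall>c v. c \<in> carrier K \<and> v \<in> carrier ?Q \<longrightarrow> c \<odot>\<^bsub>?Q\<^esub> v \<in> carrier ?Q"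
    by (auto simp: subquot_carrier subquot_smult)
  show "\<forall>v w. v \<in> carrier ?Q \<and> w \<in> carrier ?Q \<longrightarrow> v \<oplus>\<^bsub>?Q\<^esub> w = w \<oplus>\<^bsub>?Q\<^esub> v"
    using M.a_comm by (auto simp: subquot_carrier subquot_add Z_carrier)
  show "\<forall>u v w. u \<in> carrier ?Q \<and> v \<in> carrier ?Q \<and> w \<in> carrier ?Q \<longrightarrow>
    (u \<oplus>\<^bsub>?Q\<^esub> v) \<oplus>\<^bsub>?Q\<^esub> w = u \<oplus>\<^bsub>?Q\<^esub> (v \<oplus>\<^bsub>?Q\<^esub> w)"
    by (auto simp: subquot_carrier subquot_add Z_carrier M.a_assoc)
  show "\<forall>v\<in>carrier ?Q. v \<oplus>\<^bsub>?Q\<^esub> \<zero>\<^bsub>?Q\<^esub> = v"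
    unfolding subquot_zero_coset by (auto simp: subquot_carrier subquot_add Z_carrier)
  show "\<forall>a b v. a \<in> carrier K \<and> b \<in> carrier K \<and> v \<in> carrier ?Q \<longrightarrow>
    (a \<otimes>\<^bsub>K\<^esub> b) \<odot>\<^bsub>?Q\<^esub> v = a \<odot>\<^bsub>?Q\<^esub> (b \<odot>\<^bsub>?Q\<^esub> v)"
    by (auto simp: subquot_carrier subquot_smult Z_carrier smult_assoc1)
  show "\<forall>v\<in>carrier ?Q. \<one>\<^bsub>K\<^esub> \<odot>\<^bsub>?Q\<^esub> v = v"
    by (auto simp: subquot_carrier subquot_smult Z_carrier)
  show "\<forall>a b v. a \<in> carrier K \<and> b \<in> carrier K \<and> v \<in> carrier ?Q \<longrightarrow>
    (a \<oplus>\<^bsub>K\<^esub> b) \<odot>\<^bsub>?Q\<^esub> v = a \<odot>\<^bsub>?Q\<^esub> v \<oplus>\<^bsub>?Q\<^esub> b \<odot>\<^bsub>?Q\<^esub> v"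
    by (auto simp: subquot_carrier subquot_smult subquot_add Z_carrier smult_l_distr)
  show "\<forall>a v w. a \<in> carrier K \<and> v \<in> carrier ?Q \<and> w \<in> carrier ?Q \<longrightarrow>
    a \<odot>\<^bsub>?Q\<^esub> (v \<oplus>\<^bsub>?Q\<^esub> w) = a \<odot>\<^bsub>?Q\<^esub> v \<oplus>\<^bsub>?Q\<^esub> a \<odot>\<^bsub>?Q\<^esub> w"
    by (auto simp: subquot_carrier subquot_smult subquot_add Z_carrier smult_r_distr)
qed

text \<open>Meant for \<open>coh_filt\<close>, whose steps are the images in cohomology of the
  cocycles of \<open>F p k\<close>.\<close>

lemma submodule_subquot:
  assumes "submodule K Y M" "Y \<subseteq> Z"
  shows "submodule K ((\<lambda>z. B +>\<^bsub>M\<^esub> z) ` Y) (subquot M Z B)"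
proof -
  interpret Q: vectorspace K "subquot M Z B" by (rule subquot_vectorspace)
  interpret Y: submodule K Y M by fact
  show ?thesis
  proof
    show "(\<lambda>z. B +>\<^bsub>M\<^esub> z) ` Y \<subseteq> carrier (subquot M Z B)"
      using assms(2) by (auto simp: subquot_carrier)
    fix v w assume "v \<in> (\<lambda>z. B +>\<^bsub>M\<^esub> z) ` Y" "w \<in> (\<lambda>z. B +>\<^bsub>M\<^esub> z) ` Y"
    then show "v \<oplus>\<^bsub>subquot M Z B\<^esub> w \<in> (\<lambda>z. B +>\<^bsub>M\<^esub> z) ` Y"
      using assms(2) by (auto simp: subquot_add subset_iff)
  next
    show "\<zero>\<^bsub>subquot M Z B\<^esub> \<in> (\<lambda>z. B +>\<^bsub>M\<^esub> z) ` Y"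
      by (auto simp: subquot_zero_coset)
    fix c v assume "c \<in> carrier K" "v \<in> (\<lambda>z. B +>\<^bsub>M\<^esub> z) ` Y"
    then show "c \<odot>\<^bsub>subquot M Z B\<^esub> v \<in> (\<lambda>z. B +>\<^bsub>M\<^esub> z) ` Y"
      using assms(2) by (auto simp: subquot_smult subset_iff)
  qed
qed

end

text \<open>Linearity is asked for on \<open>Z\<close> only. One use has \<open>f\<close> sending
  \<open>x\<close> to its coset in a page, and there the rules for the operations of the target are
  available only for representatives in the numerator.\<close>

locale subquotient_map = src: subquotient K M Z B + tgt: subquotient K N Z' B'
  for K :: "('k, 'm) ring_scheme"
    and M :: "('k, 'v) module" and Z B
    and N :: "('k, 'w) module" and Z' B' +
  fixes f :: "'v \<Rightarrow> 'w"
  assumes f_add: "x \<in> Z \<Longrightarrow> y \<in> Z \<Longrightarrow> f (x \<oplus>\<^bsub>M\<^esub> y) = f x \<oplus>\<^bsub>N\<^esub> f y"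
    and f_smult: "a \<in> carrier K \<Longrightarrow> x \<in> Z \<Longrightarrow> f (a \<odot>\<^bsub>M\<^esub> x) = a \<odot>\<^bsub>N\<^esub> f x"
    and f_Z: "x \<in> Z \<Longrightarrow> f x \<in> Z'"
    and f_B: "x \<in> B \<Longrightarrow> f x \<in> B'"
begin

lemma induced_map_coset:
  assumes "x \<in> Z"
  shows "induced_map N B' f (B +>\<^bsub>M\<^esub> x) = B' +>\<^bsub>N\<^esub> f x"
proof -
  have "B' +>\<^bsub>N\<^esub> f y = B' +>\<^bsub>N\<^esub> f x" if y: "y \<in> B +>\<^bsub>M\<^esub> x" for y
  proof -
    obtain b where b: "b \<in> B" "y = b \<oplus>\<^bsub>M\<^esub> x" using y by (auto simp: a_r_coset_def')
    then have "f y = f b \<oplus>\<^bsub>N\<^esub> f x" using assms src.B_subset_Z by (simp add: f_add subsetD)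
    then show ?thesis
      using tgt.coset_add_left[OF tgt.Z_carrier[OF f_Z[OF assms]] f_B[OF b(1)]] by simp
  qed
  then show ?thesis
    unfolding induced_map_def
    using src.coset_mem_self[OF src.Z_carrier[OF assms]] by (intro UN_constant_eq[of x]) blast+
qed

lemma f_minus: "x \<in> Z \<Longrightarrow> y \<in> Z \<Longrightarrow> f (x \<ominus>\<^bsub>M\<^esub> y) = f x \<ominus>\<^bsub>N\<^esub> f y"
proof -
  assume "x \<in> Z" "y \<in> Z"
  moreover have "f (\<ominus>\<^bsub>M\<^esub> y) = \<ominus>\<^bsub>N\<^esub> f y"
    using f_smult[of "\<ominus>\<^bsub>K\<^esub> \<one>\<^bsub>K\<^esub>" y] \<open>y \<in> Z\<close>
    by (simp add: src.smult_minus_1 tgt.smult_minus_1 src.Z_carrier tgt.Z_carrier f_Z)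
  ultimately show ?thesis by (simp add: a_minus_def f_add)
qed

lemma induced_linear_map:
  "linear_map K (subquot M Z B) (subquot N Z' B') (induced_map N B' f)"
proof -
  interpret V: vectorspace K "subquot M Z B" by (rule src.subquot_vectorspace)
  interpret W: vectorspace K "subquot N Z' B'" by (rule tgt.subquot_vectorspace)
  have "induced_map N B' f \<in> LinearCombinations.module_hom K (subquot M Z B) (subquot N Z' B')"
    by (auto simp: LinearCombinations.module_hom_def src.subquot_carrier tgt.subquot_carrier
        induced_map_coset src.subquot_add tgt.subquot_add src.subquot_smult
        tgt.subquot_smult f_add f_smult f_Z)
  then show ?thesis by unfold_locales
qed

text \<open>Both hypotheses are about representatives, because equality of cosets is membership of a
  difference in the denominator. The comparison maps between pages, limit term, graded cohomology
  and Seifert cohomology can thus be checked on elements of the complex.\<close>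

lemma induced_lin_iso:
  assumes inj: "\<And>x. x \<in> Z \<Longrightarrow> f x \<in> B' \<Longrightarrow> x \<in> B"
    and surj: "\<And>y. y \<in> Z' \<Longrightarrow> \<exists>x\<in>Z. y \<ominus>\<^bsub>N\<^esub> f x \<in> B'"
  shows "lin_iso K (subquot M Z B) (subquot N Z' B') (induced_map N B' f)"
  unfolding lin_iso_def bij_betw_def
proof (intro conjI induced_linear_map)
  show "inj_on (induced_map N B' f) (carrier (subquot M Z B))"
  proof (rule inj_onI)
    fix X Y assume "X \<in> carrier (subquot M Z B)" "Y \<in> carrier (subquot M Z B)"
      and eq: "induced_map N B' f X = induced_map N B' f Y"
    then obtain x y where x: "x \<in> Z" "X = B +>\<^bsub>M\<^esub> x" and y: "y \<in> Z" "Y = B +>\<^bsub>M\<^esub> y"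
      by (auto simp: src.subquot_carrier)
    have "f x \<ominus>\<^bsub>N\<^esub> f y \<in> B'"
      using eq x y by (simp add: induced_map_coset tgt.coset_eq_iff tgt.Z_carrier f_Z)
    then have "x \<ominus>\<^bsub>M\<^esub> y \<in> B"
      using x y inj[of "x \<ominus>\<^bsub>M\<^esub> y"] by (simp add: f_minus[symmetric]) (simp add: a_minus_def)
    then show "X = Y" using x y by (simp add: src.coset_eq_iff src.Z_carrier)
  qed
  show "induced_map N B' f ` carrier (subquot M Z B) = carrier (subquot N Z' B')"
  proof
    show "induced_map N B' f ` carrier (subquot M Z B) \<subseteq> carrier (subquot N Z' B')"
      by (auto simp: src.subquot_carrier tgt.subquot_carrier induced_map_coset f_Z)
    show "carrier (subquot N Z' B') \<subseteq> induced_map N B' f ` carrier (subquot M Z B)"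
    proof
      fix Y assume "Y \<in> carrier (subquot N Z' B')"
      then obtain y where y: "y \<in> Z'" "Y = B' +>\<^bsub>N\<^esub> y" by (auto simp: tgt.subquot_carrier)
      obtain x where x: "x \<in> Z" "y \<ominus>\<^bsub>N\<^esub> f x \<in> B'" using surj[OF y(1)] by blast
      have "Y = induced_map N B' f (B +>\<^bsub>M\<^esub> x)"
        using x y by (simp add: induced_map_coset tgt.coset_eq_iff tgt.Z_carrier f_Z)
      then show "Y \<in> induced_map N B' f ` carrier (subquot M Z B)"
        using x by (auto simp: src.subquot_carrier)
    qed
  qed
qed

end

section \<open>The spectral sequence of a filtered complex\<close>

lemma (in vectorspace) minus_eq_iff:
  assumes "x \<in> carrier V" "y \<in> carrier V" "z \<in> carrier V"
  shows "x \<ominus>\<^bsub>V\<^esub> y = z \<longleftrightarrow> x = y \<oplus>\<^bsub>V\<^esub> z"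
proof
  show "x = y \<oplus>\<^bsub>V\<^esub> z" if "x \<ominus>\<^bsub>V\<^esub> y = z"
    using assms that[symmetric] by (simp add: a_minus_def M.a_lcomm M.r_neg)
  show "x \<ominus>\<^bsub>V\<^esub> y = z" if "x = y \<oplus>\<^bsub>V\<^esub> z"
    using assms that M.a_comm[of y z] by (simp add: a_minus_def M.a_assoc M.r_neg)
qed

lemma (in vectorspace) submodule_minus:
  assumes "submodule K N V" "x \<in> N" "y \<in> N"
  shows "x \<ominus>\<^bsub>V\<^esub> y \<in> N"
proof -
  interpret N: submodule K N V by fact
  have "\<ominus>\<^bsub>V\<^esub> y = (\<ominus>\<^bsub>K\<^esub> \<one>\<^bsub>K\<^esub>) \<odot>\<^bsub>V\<^esub> y"
    using assms N.subset by (simp add: smult_minus_1 subset_iff)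
  then show ?thesis using assms by (simp add: a_minus_def)
qed

lemma (in vectorspace) submodule_set_add:
  assumes "submodule K N V" "submodule K N' V"
  shows "submodule K (N <+>\<^bsub>V\<^esub> N') V"
proof -
  interpret N: submodule K N V by fact
  interpret N': submodule K N' V by fact
  have c: "x \<in> N \<Longrightarrow> x \<in> carrier V" "x \<in> N' \<Longrightarrow> x \<in> carrier V" for x
    using N.subset N'.subset by auto
  show ?thesis
  proof
    show "N <+>\<^bsub>V\<^esub> N' \<subseteq> carrier V" using c by (auto simp: set_add_def')
    show "\<zero>\<^bsub>V\<^esub> \<in> N <+>\<^bsub>V\<^esub> N'"
      unfolding set_add_def'
      by (intro UN_I[OF N.zero_closed] UN_I[OF N'.zero_closed]) simp
  next
    fix v w assume "v \<in> N <+>\<^bsub>V\<^esub> N'" "w \<in> N <+>\<^bsub>V\<^esub> N'"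
    then obtain a b a' b' where *: "a \<in> N" "b \<in> N'" "v = a \<oplus>\<^bsub>V\<^esub> b"
      "a' \<in> N" "b' \<in> N'" "w = a' \<oplus>\<^bsub>V\<^esub> b'" by (auto simp: set_add_def')
    then have "v \<oplus>\<^bsub>V\<^esub> w = (a \<oplus>\<^bsub>V\<^esub> a') \<oplus>\<^bsub>V\<^esub> (b \<oplus>\<^bsub>V\<^esub> b')" by (simp add: c M.a_ac)
    then show "v \<oplus>\<^bsub>V\<^esub> w \<in> N <+>\<^bsub>V\<^esub> N'"
      using * N.m_closed N'.m_closed unfolding set_add_def' by blast
  next
    fix r v assume r: "r \<in> carrier K" "v \<in> N <+>\<^bsub>V\<^esub> N'"
    then obtain a b where *: "a \<in> N" "b \<in> N'" "v = a \<oplus>\<^bsub>V\<^esub> b" by (auto simp: set_add_def')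
    then have "r \<odot>\<^bsub>V\<^esub> v = r \<odot>\<^bsub>V\<^esub> a \<oplus>\<^bsub>V\<^esub> r \<odot>\<^bsub>V\<^esub> b" by (simp add: c r smult_r_distr)
    then show "r \<odot>\<^bsub>V\<^esub> v \<in> N <+>\<^bsub>V\<^esub> N'"
      using * r N.smult_closed N'.smult_closed unfolding set_add_def' by blast
  qed
qed

locale filtered_complex = vectorspace K M
  for K :: "('k, 'm) ring_scheme" and M :: "('k, 'v) module" +
  fixes F :: "int \<Rightarrow> int \<Rightarrow> 'v set" and \<delta> :: "'v \<Rightarrow> 'v"
  assumes F_submodule: "submodule K (F p k) M"
    and F_step: "F (p + 1) k \<subseteq> F p k"
    and \<delta>_F: "x \<in> F p k \<Longrightarrow> \<delta> x \<in> F p (k + 1)"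
    and \<delta>_add: "x \<in> carrier M \<Longrightarrow> y \<in> carrier M \<Longrightarrow> \<delta> (x \<oplus>\<^bsub>M\<^esub> y) = \<delta> x \<oplus>\<^bsub>M\<^esub> \<delta> y"
    and \<delta>_smult: "a \<in> carrier K \<Longrightarrow> x \<in> carrier M \<Longrightarrow> \<delta> (a \<odot>\<^bsub>M\<^esub> x) = a \<odot>\<^bsub>M\<^esub> \<delta> x"
    and \<delta>_\<delta>: "x \<in> F p k \<Longrightarrow> \<delta> (\<delta> x) = \<zero>\<^bsub>M\<^esub>"
begin

abbreviation "Z \<equiv> ss_Z F \<delta>"
abbreviation "B \<equiv> ss_B M F \<delta>"
abbreviation "E \<equiv> ss_E M F \<delta>"
abbreviation "dif \<equiv> ss_d M F \<delta>"

lemma F_carrier: "x \<in> F p k \<Longrightarrow> x \<in> carrier M"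
  using submodule.subset[OF F_submodule] by blast

lemma F_closed [simp]:
  "x \<in> F p k \<Longrightarrow> y \<in> F p k \<Longrightarrow> x \<oplus>\<^bsub>M\<^esub> y \<in> F p k"
  "\<zero>\<^bsub>M\<^esub> \<in> F p k"
  "a \<in> carrier K \<Longrightarrow> x \<in> F p k \<Longrightarrow> a \<odot>\<^bsub>M\<^esub> x \<in> F p k"
  "x \<in> F p k \<Longrightarrow> y \<in> F p k \<Longrightarrow> x \<ominus>\<^bsub>M\<^esub> y \<in> F p k"
  using F_submodule[of p k] submodule_minus[OF F_submodule] by (auto simp: submodule_def)

lemma F_antimono:
  assumes "p \<le> q" "x \<in> F q k"
  shows "x \<in> F p k"
proof -
  have "F (p + int n) k \<subseteq> F p k" for n
  proof (induction n)
    case (Suc n)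
    then show ?case using F_step[of "p + int n" k] by (simp add: algebra_simps subset_iff)
  qed simp
  from this[of "nat (q - p)"] show ?thesis using assms by auto
qed

lemma \<delta>_zero [simp]: "\<delta> \<zero>\<^bsub>M\<^esub> = \<zero>\<^bsub>M\<^esub>"
  using \<delta>_smult[of "\<zero>\<^bsub>K\<^esub>" "\<zero>\<^bsub>M\<^esub>"] F_carrier[OF \<delta>_F[OF F_closed(2)]] by simp

lemma \<delta>_minus:
  assumes "x \<in> F p k" "y \<in> F p k"
  shows "\<delta> (x \<ominus>\<^bsub>M\<^esub> y) = \<delta> x \<ominus>\<^bsub>M\<^esub> \<delta> y"
proof -
  have "\<delta> (\<ominus>\<^bsub>M\<^esub> y) = \<ominus>\<^bsub>M\<^esub> \<delta> y"
    using \<delta>_smult[of "\<ominus>\<^bsub>K\<^esub> \<one>\<^bsub>K\<^esub>" y] F_carrier[OF assms(2)] F_carrier[OF \<delta>_F[OF assms(2)]]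
    by (simp add: smult_minus_1)
  then show ?thesis using assms by (simp add: a_minus_def \<delta>_add F_carrier)
qed

lemma Z_iff: "x \<in> Z r p k \<longleftrightarrow> x \<in> F p k \<and> \<delta> x \<in> F (p + int r) (k + 1)"
  by (simp add: ss_Z_def)

lemma Z_submodule: "submodule K (Z r p k) M"
  by unfold_locales (auto simp: Z_iff \<delta>_add \<delta>_smult F_carrier)

lemma Z_carrier: "x \<in> Z r p k \<Longrightarrow> x \<in> carrier M"
  by (auto simp: Z_iff F_carrier)

lemma image_submodule:
  assumes "submodule K N M" "N \<subseteq> F p k"
  shows "submodule K (\<delta> ` N) M"
proof -
  interpret N: submodule K N M by fact
  have c: "x \<in> N \<Longrightarrow> x \<in> carrier M" for x using N.subset by auto
  show ?thesis
  proof
    show "\<delta> ` N \<subseteq> carrier M" using assms(2) F_carrier[OF \<delta>_F] by blast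
    show "\<zero>\<^bsub>M\<^esub> \<in> \<delta> ` N" using N.zero_closed by (metis \<delta>_zero imageI)
    fix v w assume "v \<in> \<delta> ` N" "w \<in> \<delta> ` N"
    then show "v \<oplus>\<^bsub>M\<^esub> w \<in> \<delta> ` N"
      using c by (auto simp: \<delta>_add[symmetric])
  next
    fix r v assume "r \<in> carrier K" "v \<in> \<delta> ` N"
    then show "r \<odot>\<^bsub>M\<^esub> v \<in> \<delta> ` N"
      using c by (auto simp: \<delta>_smult[symmetric])
  qed
qed

lemma B_iff:
  assumes "r \<ge> 1"
  shows "x \<in> B r p k \<longleftrightarrow>
    (\<exists>y z. y \<in> F (p - int r + 1) (k - 1) \<and> \<delta> y \<in> F p k \<and>
           z \<in> F (p + 1) k \<and> \<delta> z \<in> F (p + int r) (k + 1) \<and> x = \<delta> y \<oplus>\<^bsub>M\<^esub> z)"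
proof -
  \<comment> \<open>In \<open>ss_B\<close> the page index \<open>r - 1\<close> is a truncated
    subtraction of naturals; \<open>r \<ge> 1\<close> turns it into a true shift.\<close>
  have "p - int r + 1 + int (r - 1) = p" "p + 1 + int (r - 1) = p + int r"
    using assms by auto
  then show ?thesis by (auto simp: ss_B_def set_add_def' ss_Z_def)
qed

lemma B_submodule: "submodule K (B r p k) M"
  unfolding ss_B_def
  by (intro submodule_set_add Z_submodule image_submodule[of _ "p - int r + 1" "k - 1"])
    (auto simp: Z_iff)

lemma B_Z: "r \<ge> 1 \<Longrightarrow> x \<in> B r p k \<Longrightarrow> x \<in> Z r p k"
  using F_antimono[of p "p + 1"]
  by (auto simp: B_iff Z_iff \<delta>_add F_carrier \<delta>_\<delta>)

lemma E_subquotient: "r \<ge> 1 \<Longrightarrow> subquotient K M (Z r p k) (B r p k)"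
  by (intro subquotient.intro subquotient_axioms.intro vectorspace_axioms Z_submodule
      B_submodule subsetI B_Z)

lemma B_right: "r \<ge> 1 \<Longrightarrow> z \<in> F (p + 1) k \<Longrightarrow> \<delta> z \<in> F (p + int r) (k + 1) \<Longrightarrow> z \<in> B r p k"
  unfolding B_iff by (rule exI[of _ "\<zero>\<^bsub>M\<^esub>"]) (auto simp: F_carrier)

lemma B_left: "r \<ge> 1 \<Longrightarrow> y \<in> F (p - int r + 1) (k - 1) \<Longrightarrow> \<delta> y \<in> F p k \<Longrightarrow> \<delta> y \<in> B r p k"
  unfolding B_iff by (rule exI[of _ y], rule exI[of _ "\<zero>\<^bsub>M\<^esub>"]) (auto simp: F_carrier)

text \<open>This is the well-definedness of the page differential: \<delta> kills the summand
  \<open>\<delta> y\<close> of a boundary, and what remains is \<delta> of an element one filtration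
  step up, which is a boundary of the target term.\<close>

lemma d_subquotient_map:
  assumes "r \<ge> 1"
  shows "subquotient_map K M (Z r p k) (B r p k)
    M (Z r (p + int r) (k + 1)) (B r (p + int r) (k + 1)) \<delta>"
proof -
  interpret src: subquotient K M "Z r p k" "B r p k"
    by (rule E_subquotient[OF assms])
  interpret tgt: subquotient K M "Z r (p + int r) (k + 1)" "B r (p + int r) (k + 1)"
    by (rule E_subquotient[OF assms])
  show ?thesis
  proof
    fix x assume "x \<in> Z r p k"
    then show "\<delta> x \<in> Z r (p + int r) (k + 1)" by (auto simp: Z_iff \<delta>_\<delta>)
  next
    fix x assume "x \<in> B r p k"
    then obtain y z where yz: "y \<in> F (p - int r + 1) (k - 1)" "\<delta> y \<in> F p k"
      "z \<in> F (p + 1) k" "\<delta> z \<in> F (p + int r) (k + 1)" "x = \<delta> y \<oplus>\<^bsub>M\<^esub> z"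
      using assms by (auto simp: B_iff)
    have "\<delta> x = \<delta> z" using yz by (simp add: \<delta>_add F_carrier \<delta>_\<delta>)
    \<comment> \<open>At filtration degree \<open>p + int r\<close> the primitives of boundaries
      live in degree \<open>(p + int r) - int r + 1 = p + 1\<close>, which is where \<open>z\<close>
      lies.\<close>
    then show "\<delta> x \<in> B r (p + int r) (k + 1)"
      using yz assms B_left[of r z "p + int r" "k + 1"] by simp
  qed (auto simp: \<delta>_add \<delta>_smult Z_carrier)
qed

lemma d_coset:
  assumes "r \<ge> 1" "x \<in> Z r p k"
  shows "dif r p k (B r p k +>\<^bsub>M\<^esub> x) = B r (p + int r) (k + 1) +>\<^bsub>M\<^esub> \<delta> x"
  unfolding ss_d_def
  by (rule subquotient_map.induced_map_coset[OF d_subquotient_map[OF assms(1)] assms(2)])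

lemma d_linear_map:
  "r \<ge> 1 \<Longrightarrow> linear_map K (E r p k) (E r (p + int r) (k + 1)) (dif r p k)"
  unfolding ss_E_def ss_d_def
  by (rule subquotient_map.induced_linear_map[OF d_subquotient_map])

lemma E_carrier: "r \<ge> 1 \<Longrightarrow> carrier (E r p k) = (\<lambda>x. B r p k +>\<^bsub>M\<^esub> x) ` Z r p k"
  unfolding ss_E_def by (rule subquotient.subquot_carrier[OF E_subquotient])

lemma d_d:
  assumes r: "r \<ge> 1" and X: "X \<in> carrier (E r p k)"
  shows "dif r (p + int r) (k + 1) (dif r p k X) = \<zero>\<^bsub>E r (p + 2 * int r) (k + 2)\<^esub>"
proof -
  obtain x where x: "x \<in> Z r p k" "X = B r p k +>\<^bsub>M\<^esub> x" using X r by (auto simp: E_carrier)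
  have "\<delta> x \<in> Z r (p + int r) (k + 1)"
    using d_subquotient_map[OF r] x by (auto simp: subquotient_map_def subquotient_map_axioms_def)
  then have "dif r (p + int r) (k + 1) (dif r p k X) =
      B r (p + int r + int r) (k + 1 + 1) +>\<^bsub>M\<^esub> \<zero>\<^bsub>M\<^esub>"
    using x by (simp add: d_coset[OF r] Z_iff \<delta>_\<delta>)
  also have "\<dots> = \<zero>\<^bsub>E r (p + int r + int r) (k + 1 + 1)\<^esub>"
    unfolding ss_E_def using subquotient.subquot_zero_coset[OF E_subquotient[OF r]] by simp
  finally show ?thesis by (simp add: algebra_simps)
qed

lemma page_subquotient:
  assumes r: "r \<ge> 1"
  shows "subquotient K (E r p k)
    {X \<in> carrier (E r p k). dif r p k X = \<zero>\<^bsub>E r (p + int r) (k + 1)\<^esub>}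
    (dif r (p - int r) (k - 1) ` carrier (E r (p - int r) (k - 1)))"
proof -
  interpret out: linear_map K "E r p k" "E r (p + int r) (k + 1)" "dif r p k"
    by (rule d_linear_map[OF r])
  have inc: "linear_map K (E r (p - int r) (k - 1)) (E r p k) (dif r (p - int r) (k - 1))"
    using d_linear_map[OF r, of "p - int r" "k - 1"] by simp
  interpret inc: linear_map K "E r (p - int r) (k - 1)" "E r p k" "dif r (p - int r) (k - 1)"
    by (rule inc)
  show ?thesis
  proof (intro subquotient.intro subquotient_axioms.intro out.V.vectorspace_axioms)
    show "submodule K {X \<in> carrier (E r p k). dif r p k X = \<zero>\<^bsub>E r (p + int r) (k + 1)\<^esub>} (E r p k)"
      using out.ker_is_submodule by (simp add: out.ker_def)
    show "submodule K (dif r (p - int r) (k - 1) ` carrier (E r (p - int r) (k - 1))) (E r p k)"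
      using inc.im_is_submodule by (simp add: inc.im_def)
    show "dif r (p - int r) (k - 1) ` carrier (E r (p - int r) (k - 1)) \<subseteq>
      {X \<in> carrier (E r p k). dif r p k X = \<zero>\<^bsub>E r (p + int r) (k + 1)\<^esub>}"
    \<comment> \<open>\<open>d_d\<close> starts from the source of two consecutive differentials; it
      is re-indexed here so that the incoming differential ends at \<open>(p, k)\<close>.\<close>
    proof -
      have "p - int r + int r = p" "k - 1 + 1 = k" "p - int r + 2 * int r = p + int r" "k - 1 + 2 = k + 1"
        by auto
      note d_d[OF r, of _ "p - int r" "k - 1", unfolded this]
      then show ?thesis using inc.f_im by auto
    qed
  qed
qed

text \<open>A class of page \<open>r\<close> is killed by the differential iff
  \<open>\<delta> x = \<delta> y \<oplus> z\<close> with \<open>y\<close> one step up and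
  \<open>z\<close> in filtration \<open>p + r + 1\<close>. Then \<open>x \<ominus> y\<close>
  represents the same class and survives to \<open>Z (r + 1) p k\<close>, which gives surjectivity.
  Injectivity merges the primitive from the image of the differential with the primitive inside
  \<open>B r p k\<close>.\<close>

lemma next_lin_iso:
  assumes r: "r \<ge> 1"
  shows "lin_iso K (E (r + 1) p k) (page_cohomology E dif r p k) (ss_next M F \<delta> r p k)"
proof -
  let ?Ker = "{X \<in> carrier (E r p k). dif r p k X = \<zero>\<^bsub>E r (p + int r) (k + 1)\<^esub>}"
  let ?Im = "dif r (p - int r) (k - 1) ` carrier (E r (p - int r) (k - 1))"
  let ?f = "\<lambda>x. B r p k +>\<^bsub>M\<^esub> x"
  interpret src: subquotient K M "Z (r + 1) p k" "B (r + 1) p k"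
    by (rule E_subquotient) simp
  interpret E: subquotient K M "Z r p k" "B r p k"
    by (rule E_subquotient[OF r])
  interpret E': subquotient K M "Z r (p + int r) (k + 1)" "B r (p + int r) (k + 1)"
    by (rule E_subquotient[OF r])
  interpret tgt: subquotient K "E r p k" ?Ker ?Im
    by (rule page_subquotient[OF r])
  have Zr: "x \<in> Z r p k" if "x \<in> Z (r + 1) p k" for x
    using that F_antimono[of "p + int r" "p + int r + 1"] by (auto simp: Z_iff algebra_simps)
  have zero: "\<zero>\<^bsub>E r (p + int r) (k + 1)\<^esub> = B r (p + int r) (k + 1)"
    unfolding ss_E_def by (rule E'.subquot_zero)
  have ker_iff: "?f x \<in> ?Ker \<longleftrightarrow> \<delta> x \<in> B r (p + int r) (k + 1)" if "x \<in> Z r p k" for x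
  proof -
    have "\<delta> x \<in> carrier M" using that F_carrier by (auto simp: Z_iff)
    then show ?thesis
      using that r by (simp add: E_carrier d_coset E'.coset_eq_B_iff zero)
  qed
  have im_iff: "X \<in> ?Im \<longleftrightarrow> (\<exists>y \<in> Z r (p - int r) (k - 1). X = ?f (\<delta> y))" for X
    using d_coset[OF r, of _ "p - int r" "k - 1"] r by (auto simp: E_carrier image_iff)
  interpret subquotient_map K M "Z (r + 1) p k" "B (r + 1) p k" "E r p k" ?Ker ?Im ?f
  proof
    fix x y assume "x \<in> Z (r + 1) p k" "y \<in> Z (r + 1) p k"
    then show "?f (x \<oplus>\<^bsub>M\<^esub> y) = ?f x \<oplus>\<^bsub>E r p k\<^esub> ?f y"
      by (simp add: ss_E_def E.subquot_add Zr)
  next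
    fix a x assume "a \<in> carrier K" "x \<in> Z (r + 1) p k"
    then show "?f (a \<odot>\<^bsub>M\<^esub> x) = a \<odot>\<^bsub>E r p k\<^esub> ?f x"
      by (simp add: ss_E_def E.subquot_smult Zr)
  next
    fix x assume x: "x \<in> Z (r + 1) p k"
    have "\<delta> x \<in> B r (p + int r) (k + 1)"
      using x r by (intro B_right) (auto simp: Z_iff \<delta>_\<delta> algebra_simps)
    then show "?f x \<in> ?Ker" using ker_iff[OF Zr[OF x]] by simp
  next
    fix x assume "x \<in> B (r + 1) p k"
    then obtain y z where yz: "y \<in> F (p - int r) (k - 1)" "\<delta> y \<in> F p k"
      "z \<in> F (p + 1) k" "\<delta> z \<in> F (p + int r + 1) (k + 1)" "x = \<delta> y \<oplus>\<^bsub>M\<^esub> z"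
      by (auto simp: B_iff algebra_simps)
    have z: "z \<in> B r p k"
      using yz r F_antimono[of "p + int r" "p + int r + 1"] by (intro B_right) auto
    \<comment> \<open>\<open>z\<close> is already in the denominator of page \<open>r\<close>, so
      the class of \<open>x\<close> is the differential of the class of \<open>y\<close>.\<close>
    have "?f x = ?f (\<delta> y)"
      using E.coset_add_left[OF F_carrier[OF yz(2)] z] yz by (simp add: F_carrier M.a_comm)
    moreover have "y \<in> Z r (p - int r) (k - 1)" using yz by (simp add: Z_iff)
    ultimately show "?f x \<in> ?Im" by (intro im_iff[THEN iffD2] bexI[of _ y])
  qed
  have "lin_iso K (subquot M (Z (r + 1) p k) (B (r + 1) p k)) (subquot (E r p k) ?Ker ?Im)
      (induced_map (E r p k) ?Im ?f)"
  proof (rule induced_lin_iso)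
    fix x assume x: "x \<in> Z (r + 1) p k" and "?f x \<in> ?Im"
    then obtain y where y: "y \<in> Z r (p - int r) (k - 1)" "?f x = ?f (\<delta> y)"
      using im_iff[of "?f x"] by (elim iffD1[THEN bexE])
    have y': "y \<in> F (p - int r) (k - 1)" "\<delta> y \<in> F p k" using y(1) by (auto simp: Z_iff)
    have "x \<ominus>\<^bsub>M\<^esub> \<delta> y \<in> B r p k"
      using y(2) E.coset_eq_iff Z_carrier[OF x] F_carrier[OF y'(2)] by simp
    then obtain w z where wz: "w \<in> F (p - int r + 1) (k - 1)" "\<delta> w \<in> F p k"
      "z \<in> F (p + 1) k" "\<delta> z \<in> F (p + int r) (k + 1)" "x \<ominus>\<^bsub>M\<^esub> \<delta> y = \<delta> w \<oplus>\<^bsub>M\<^esub> z"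
      using r by (auto simp: B_iff)
    have w: "w \<in> F (p - int r) (k - 1)" using F_antimono[of "p - int r" "p - int r + 1"] wz by simp
    have "x = \<delta> y \<oplus>\<^bsub>M\<^esub> (\<delta> w \<oplus>\<^bsub>M\<^esub> z)"
      using wz y' Z_carrier[OF x] by (simp add: minus_eq_iff F_carrier)
    then have eq: "x = \<delta> (y \<oplus>\<^bsub>M\<^esub> w) \<oplus>\<^bsub>M\<^esub> z"
      using y' w wz by (simp add: \<delta>_add F_carrier M.a_assoc)
    have yw: "y \<oplus>\<^bsub>M\<^esub> w \<in> F (p - int r) (k - 1)" using y' w by simp
    have "\<delta> x = \<delta> z"
      using yw wz(3) y' wz(2) w unfolding eq
      by (simp add: \<delta>_add F_carrier \<delta>_\<delta>[OF y'(1)] \<delta>_\<delta>[OF w]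
          F_carrier[OF \<delta>_F[OF wz(3)]])
    \<comment> \<open>The gain of one step comes from \<open>x\<close> being in
      \<open>Z (r + 1) p k\<close>; membership in \<open>B r p k\<close> alone gives only filtration
      \<open>p + r\<close>.\<close>
    then have "\<delta> z \<in> F (p + int r + 1) (k + 1)" using x by (simp add: Z_iff algebra_simps)
    moreover have "\<delta> (y \<oplus>\<^bsub>M\<^esub> w) \<in> F p k"
      using y' w wz by (simp add: \<delta>_add F_carrier)
    ultimately show "x \<in> B (r + 1) p k"
      using eq yw wz(3) by (auto simp: B_iff algebra_simps)
  next
    fix Y assume Y: "Y \<in> ?Ker"
    then obtain x where x: "x \<in> Z r p k" "Y = ?f x" using r by (auto simp: E_carrier)
    then have "\<delta> x \<in> B r (p + int r) (k + 1)" using ker_iff Y by simp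
    then obtain y z where yz: "y \<in> F (p + 1) k" "\<delta> y \<in> F (p + int r) (k + 1)"
      "z \<in> F (p + int r + 1) (k + 1)" "\<delta> x = \<delta> y \<oplus>\<^bsub>M\<^esub> z"
      using r by (auto simp: B_iff)
    have y: "y \<in> F p k" using F_antimono[of p "p + 1"] yz by simp
    have x': "x \<in> F p k" "\<delta> x \<in> F (p + int r) (k + 1)" using x by (auto simp: Z_iff)
    have "\<delta> (x \<ominus>\<^bsub>M\<^esub> y) = z"
      using x' y yz by (simp add: \<delta>_minus minus_eq_iff F_carrier)
    then have "x \<ominus>\<^bsub>M\<^esub> y \<in> Z (r + 1) p k"
      using x' y yz by (simp add: Z_iff algebra_simps)
    moreover have "Y = ?f (x \<ominus>\<^bsub>M\<^esub> y)"
    proof -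
      have "y \<in> B r p k" using B_right[OF r] yz by simp
      moreover have "x = y \<oplus>\<^bsub>M\<^esub> (x \<ominus>\<^bsub>M\<^esub> y)"
        using minus_eq_iff[of x y "x \<ominus>\<^bsub>M\<^esub> y"] x' y by (simp add: F_carrier)
      ultimately show ?thesis
        using E.coset_add_left[of "x \<ominus>\<^bsub>M\<^esub> y" y] x x' y F_carrier F_closed(4) by metis
    qed
    \<comment> \<open>The criterion asks for a preimage modulo \<open>?Im\<close> only; here it is
      exact, so the difference is zero.\<close>
    moreover have "Y \<ominus>\<^bsub>E r p k\<^esub> Y \<in> ?Im"
      using Y tgt.M.r_neg[of Y] tgt.B_closed(2) by (simp add: a_minus_def)
    ultimately show "\<exists>x\<in>Z (r + 1) p k. Y \<ominus>\<^bsub>E r p k\<^esub> ?f x \<in> ?Im" by metis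
  qed
  then show ?thesis by (simp add: ss_E_def ss_next_def page_cohomology_def)
qed

theorem filtered_complex_spectral_sequence:
  "spectral_sequence K E dif (ss_next M F \<delta>)"
  unfolding spectral_sequence_def using d_linear_map d_d next_lin_iso by blast

end

section \<open>Convergence for a filtration that is constant below \<open>a\<close> and zero from
  \<open>b\<close> on\<close>

locale bounded_filtered_complex = filtered_complex +
  fixes a b :: int
  assumes F_low: "p \<le> a \<Longrightarrow> F p k = F a k"
    and F_high: "b \<le> p \<Longrightarrow> F p k = {\<zero>\<^bsub>M\<^esub>}"
begin

abbreviation "C \<equiv> cochains F"
abbreviation "H \<equiv> cohomology M C \<delta>"

lemma F_subset_low: "x \<in> F p k \<Longrightarrow> x \<in> F a k"
  by (metis F_low F_antimono linear)

lemma cochains_eq: "C k = F a k"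
  using F_subset_low by (auto simp: cochains_def)

lemma cocycles_submodule: "submodule K {x \<in> F p k. \<delta> x = \<zero>\<^bsub>M\<^esub>} M"
  by unfold_locales (auto simp: \<delta>_add \<delta>_smult F_carrier)

lemma coboundaries_submodule: "submodule K (\<delta> ` C k) M"
  by (rule image_submodule[of _ a k]) (auto simp: cochains_eq F_submodule)

lemma H_subquotient: "subquotient K M {x \<in> C k. \<delta> x = \<zero>\<^bsub>M\<^esub>} (\<delta> ` C (k - 1))"
proof (intro subquotient.intro subquotient_axioms.intro vectorspace_axioms coboundaries_submodule)
  show "submodule K {x \<in> C k. \<delta> x = \<zero>\<^bsub>M\<^esub>} M"
    unfolding cochains_eq by (rule cocycles_submodule)
  show "\<delta> ` C (k - 1) \<subseteq> {x \<in> C k. \<delta> x = \<zero>\<^bsub>M\<^esub>}"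
    using \<delta>_F[of _ a "k - 1"] \<delta>_\<delta> by (auto simp: cochains_eq)
qed

lemma Einf_B_iff:
  "x \<in> (\<delta> ` C (k - 1) \<inter> F p k) <+>\<^bsub>M\<^esub> {x \<in> F (p + 1) k. \<delta> x = \<zero>\<^bsub>M\<^esub>} \<longleftrightarrow>
   (\<exists>y z. y \<in> F a (k - 1) \<and> \<delta> y \<in> F p k \<and> z \<in> F (p + 1) k \<and> \<delta> z = \<zero>\<^bsub>M\<^esub> \<and> x = \<delta> y \<oplus>\<^bsub>M\<^esub> z)"
  by (auto simp: set_add_def' cochains_eq)

lemma Einf_subquotient:
  "subquotient K M {x \<in> F p k. \<delta> x = \<zero>\<^bsub>M\<^esub>}
    ((\<delta> ` C (k - 1) \<inter> F p k) <+>\<^bsub>M\<^esub> {x \<in> F (p + 1) k. \<delta> x = \<zero>\<^bsub>M\<^esub>})"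
proof (intro subquotient.intro subquotient_axioms.intro vectorspace_axioms cocycles_submodule
    submodule_set_add)
  interpret F: submodule K "F p k" M by (rule F_submodule)
  interpret im: submodule K "\<delta> ` C (k - 1)" M by (rule coboundaries_submodule)
  show "submodule K (\<delta> ` C (k - 1) \<inter> F p k) M"
    by unfold_locales (use F.subset in auto)
  show "(\<delta> ` C (k - 1) \<inter> F p k) <+>\<^bsub>M\<^esub> {x \<in> F (p + 1) k. \<delta> x = \<zero>\<^bsub>M\<^esub>}
      \<subseteq> {x \<in> F p k. \<delta> x = \<zero>\<^bsub>M\<^esub>}"
  proof
    fix x assume "x \<in> (\<delta> ` C (k - 1) \<inter> F p k) <+>\<^bsub>M\<^esub> {x \<in> F (p + 1) k. \<delta> x = \<zero>\<^bsub>M\<^esub>}"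
    then obtain y z where yz: "y \<in> F a (k - 1)" "\<delta> y \<in> F p k" "z \<in> F (p + 1) k"
      "\<delta> z = \<zero>\<^bsub>M\<^esub>" "x = \<delta> y \<oplus>\<^bsub>M\<^esub> z" unfolding Einf_B_iff by blast
    then show "x \<in> {x \<in> F p k. \<delta> x = \<zero>\<^bsub>M\<^esub>}"
      using F_antimono[of p "p + 1" z k] by (simp add: \<delta>_add F_carrier \<delta>_\<delta>[OF yz(1)])
  qed
qed

text \<open>When \<open>r\<close> exceeds the length \<open>b - a\<close>, a shift by
  \<open>r\<close> leaves the interesting range of filtration degrees: for each \<open>p\<close>,
  the groups reached by the shift are either zero or no longer grow. The bound on \<open>r\<close>
  serves well-definedness and surjectivity; for injectivity, a cocycle
  \<open>\<delta> y \<oplus> z\<close> has \<open>\<delta> z = \<zero>\<close> on every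
  page.\<close>

lemma Einf_lin_iso_E:
  assumes r: "r \<ge> 1" "int r > b - a"
  shows "lin_iso K (ss_Einf M F \<delta> p k) (E r p k) (induced_map M (B r p k) (\<lambda>x. x))"
proof -
  let ?Z = "{x \<in> F p k. \<delta> x = \<zero>\<^bsub>M\<^esub>}"
  let ?B = "(\<delta> ` C (k - 1) \<inter> F p k) <+>\<^bsub>M\<^esub> {x \<in> F (p + 1) k. \<delta> x = \<zero>\<^bsub>M\<^esub>}"
  interpret src: subquotient K M ?Z ?B by (rule Einf_subquotient)
  interpret tgt: subquotient K M "Z r p k" "B r p k" by (rule E_subquotient[OF r(1)])
  interpret subquotient_map K M ?Z ?B M "Z r p k" "B r p k" "\<lambda>x. x"
  proof
    fix x assume "x \<in> ?B"
    then obtain y z where yz: "y \<in> F a (k - 1)" "\<delta> y \<in> F p k" "z \<in> F (p + 1) k"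
      "\<delta> z = \<zero>\<^bsub>M\<^esub>" "x = \<delta> y \<oplus>\<^bsub>M\<^esub> z" unfolding Einf_B_iff by blast
    have "z \<in> B r p k" using yz r by (intro B_right) auto
    moreover have "\<delta> y \<in> B r p k"
    proof (cases "p - int r + 1 \<le> a")
      case True
      then show ?thesis using yz r by (intro B_left) (auto simp: F_low[OF True])
    next
      case False
      \<comment> \<open>Here \<open>p \<ge> a + r > b\<close>, so \<open>F p k\<close> is already
        zero.\<close>
      then have "\<delta> y = \<zero>\<^bsub>M\<^esub>" using yz(2) r F_high[of p k] by auto
      then show ?thesis using tgt.B_closed(2) by simp
    qed
    ultimately show "x \<in> B r p k" using yz by simp
  qed (auto simp: Z_iff)
  have "lin_iso K (subquot M ?Z ?B) (subquot M (Z r p k) (B r p k))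
      (induced_map M (B r p k) (\<lambda>x. x))"
  proof (rule induced_lin_iso)
    fix x assume x: "x \<in> ?Z" "x \<in> B r p k"
    then obtain y z where yz: "y \<in> F (p - int r + 1) (k - 1)" "\<delta> y \<in> F p k"
      "z \<in> F (p + 1) k" "\<delta> z \<in> F (p + int r) (k + 1)" "x = \<delta> y \<oplus>\<^bsub>M\<^esub> z"
      using r by (auto simp: B_iff)
    have "\<delta> x = \<delta> z" using yz by (simp add: \<delta>_add F_carrier \<delta>_\<delta>[OF yz(1)])
    then have "\<delta> z = \<zero>\<^bsub>M\<^esub>" using x by simp
    then show "x \<in> ?B" unfolding Einf_B_iff using yz F_subset_low by blast
  next
    fix y assume y: "y \<in> Z r p k"
    show "\<exists>x\<in>?Z. y \<ominus>\<^bsub>M\<^esub> x \<in> B r p k"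
    proof (cases "b \<le> p + int r")
      case True
      then have "y \<in> ?Z" using y F_high[of "p + int r" "k + 1"] by (auto simp: Z_iff)
      moreover have "y \<ominus>\<^bsub>M\<^esub> y \<in> B r p k"
        using y tgt.B_closed(2) by (simp add: a_minus_def M.r_neg Z_carrier)
      ultimately show ?thesis by blast
    next
      case False
      \<comment> \<open>From \<open>p + r < b\<close> and \<open>r > b - a\<close> one gets
        \<open>p < a\<close>. The filtration is constant there, so all of \<open>Z r p k\<close>
        lies in the denominator and 0 serves as preimage.\<close>
      then have "p \<le> a" "p + 1 \<le> a" using r by auto
      then have "F (p + 1) k = F p k" using F_low[of p k] F_low[of "p + 1" k] by argo
      then have "y \<in> B r p k" using y r by (intro B_right) (auto simp: Z_iff)
      moreover have "y \<ominus>\<^bsub>M\<^esub> \<zero>\<^bsub>M\<^esub> = y" using y by (simp add: minus_eq_iff Z_carrier)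
      ultimately show ?thesis by (intro bexI[of _ "\<zero>\<^bsub>M\<^esub>"]) auto
    qed
  qed
  then show ?thesis by (simp add: ss_Einf_def ss_E_def)
qed

text \<open>Both sides are the cocycles of \<open>F p k\<close> modulo coboundaries and cocycles of
  \<open>F (p + 1) k\<close>. That coboundaries may be intersected with \<open>F p k\<close> before
  adding the second part is the modular law, valid because \<open>F (p + 1) k\<close> is contained
  in \<open>F p k\<close>.\<close>

lemma Einf_lin_iso_gr:
  "lin_iso K (ss_Einf M F \<delta> p k) (gr_cohomology M F \<delta> p k)
     (induced_map (H k) (coh_filt M F \<delta> (p + 1) k) (\<lambda>x. \<delta> ` C (k - 1) +>\<^bsub>M\<^esub> x))"
proof -
  let ?Z = "{x \<in> F p k. \<delta> x = \<zero>\<^bsub>M\<^esub>}"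
  let ?B = "(\<delta> ` C (k - 1) \<inter> F p k) <+>\<^bsub>M\<^esub> {x \<in> F (p + 1) k. \<delta> x = \<zero>\<^bsub>M\<^esub>}"
  let ?f = "\<lambda>x. \<delta> ` C (k - 1) +>\<^bsub>M\<^esub> x"
  interpret src: subquotient K M ?Z ?B by (rule Einf_subquotient)
  interpret H: subquotient K M "{x \<in> C k. \<delta> x = \<zero>\<^bsub>M\<^esub>}" "\<delta> ` C (k - 1)"
    by (rule H_subquotient)
  have cocycle: "x \<in> {x \<in> C k. \<delta> x = \<zero>\<^bsub>M\<^esub>}" if "x \<in> F q k" "\<delta> x = \<zero>\<^bsub>M\<^esub>" for q x
    using that F_subset_low by (auto simp: cochains_eq)
  have filt: "submodule K (coh_filt M F \<delta> q k) (H k)" for q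
    unfolding coh_filt_def cohomology_def
    by (rule H.submodule_subquot[OF cocycles_submodule]) (use cocycle in auto)
  interpret tgt: subquotient K "H k" "coh_filt M F \<delta> p k" "coh_filt M F \<delta> (p + 1) k"
  proof (intro subquotient.intro subquotient_axioms.intro filt)
    show "vectorspace K (H k)" unfolding cohomology_def by (rule H.subquot_vectorspace)
    show "coh_filt M F \<delta> (p + 1) k \<subseteq> coh_filt M F \<delta> p k"
      using F_step by (auto simp: coh_filt_def)
  qed
  interpret subquotient_map K M ?Z ?B "H k" "coh_filt M F \<delta> p k" "coh_filt M F \<delta> (p + 1) k" ?f
  proof
    fix x y assume "x \<in> ?Z" "y \<in> ?Z"
    then show "?f (x \<oplus>\<^bsub>M\<^esub> y) = ?f x \<oplus>\<^bsub>H k\<^esub> ?f y"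
      using cocycle unfolding cohomology_def by (intro H.subquot_add[symmetric]) auto
  next
    fix c x assume "c \<in> carrier K" "x \<in> ?Z"
    then show "?f (c \<odot>\<^bsub>M\<^esub> x) = c \<odot>\<^bsub>H k\<^esub> ?f x"
      using cocycle unfolding cohomology_def by (intro H.subquot_smult[symmetric]) auto
  next
    fix x assume "x \<in> ?B"
    then obtain y z where yz: "y \<in> F a (k - 1)" "\<delta> y \<in> F p k" "z \<in> F (p + 1) k"
      "\<delta> z = \<zero>\<^bsub>M\<^esub>" "x = \<delta> y \<oplus>\<^bsub>M\<^esub> z" unfolding Einf_B_iff by blast
    then have "?f x = ?f z"
      using H.coset_add_left[of z "\<delta> y"] by (auto simp: F_carrier cochains_eq)
    then show "?f x \<in> coh_filt M F \<delta> (p + 1) k" using yz by (auto simp: coh_filt_def)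
  qed (auto simp: coh_filt_def)
  have "lin_iso K (subquot M ?Z ?B)
      (subquot (H k) (coh_filt M F \<delta> p k) (coh_filt M F \<delta> (p + 1) k))
      (induced_map (H k) (coh_filt M F \<delta> (p + 1) k) ?f)"
  proof (rule induced_lin_iso)
    fix x assume x: "x \<in> ?Z" and "?f x \<in> coh_filt M F \<delta> (p + 1) k"
    then obtain z where z: "z \<in> F (p + 1) k" "\<delta> z = \<zero>\<^bsub>M\<^esub>" "?f x = ?f z"
      by (auto simp: coh_filt_def)
    have z': "z \<in> F p k" using z F_antimono[of p "p + 1"] by simp
    have "x \<ominus>\<^bsub>M\<^esub> z \<in> \<delta> ` C (k - 1)"
      using z x z' H.coset_eq_iff[of x z] F_carrier[of x p k] F_carrier[of z p k] by simp
    then obtain y where y: "y \<in> F a (k - 1)" "x \<ominus>\<^bsub>M\<^esub> z = \<delta> y" by (auto simp: cochains_eq)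
    \<comment> \<open>The modular law: as the difference of two elements of \<open>F p k\<close>,
      the coboundary lies in \<open>F p k\<close>, wherever its primitive \<open>y\<close> may
      be.\<close>
    have "\<delta> y \<in> F p k" using x z' F_closed(4) unfolding y(2)[symmetric] by simp
    moreover have "x = \<delta> y \<oplus>\<^bsub>M\<^esub> z"
    proof -
      have c: "x \<in> carrier M" "z \<in> carrier M" "\<delta> y \<in> carrier M"
        using x z' \<open>\<delta> y \<in> F p k\<close> F_carrier by auto
      show ?thesis using minus_eq_iff[THEN iffD1, OF c y(2)] M.a_comm[OF c(2,3)] by simp
    qed
    ultimately show "x \<in> ?B" unfolding Einf_B_iff using y z by blast
  next
    fix Y assume "Y \<in> coh_filt M F \<delta> p k"
    then obtain x where x: "x \<in> ?Z" "Y = ?f x" by (auto simp: coh_filt_def)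
    have "Y \<in> carrier (H k)" using \<open>Y \<in> coh_filt M F \<delta> p k\<close> by (rule tgt.Z_carrier)
    then have "Y \<ominus>\<^bsub>H k\<^esub> ?f x \<in> coh_filt M F \<delta> (p + 1) k"
      using x tgt.B_closed(2) tgt.M.r_neg[of Y] by (simp add: a_minus_def)
    then show "\<exists>x\<in>?Z. Y \<ominus>\<^bsub>H k\<^esub> ?f x \<in> coh_filt M F \<delta> (p + 1) k" using x by blast
  qed
  then show ?thesis by (simp add: ss_Einf_def gr_cohomology_def)
qed

theorem bounded_filtered_complex_converges: "ss_converges K M F \<delta>"
proof -
  \<comment> \<open>The least page index that is at least 1 and exceeds \<open>b - a\<close>. It
    depends on neither \<open>p\<close> nor \<open>k\<close>, as \<open>ss_converges\<close>
    demands.\<close>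
  have "\<forall>r\<ge>max 1 (nat (b - a + 1)). \<forall>p k.
      lin_iso K (ss_Einf M F \<delta> p k) (E r p k) (induced_map M (B r p k) (\<lambda>x. x))"
    using Einf_lin_iso_E by auto
  then show ?thesis
    unfolding ss_converges_def using Einf_lin_iso_gr by (meson max.cobounded1)
qed

end

section \<open>Linear algebra over the two-element field\<close>

lemma poly_mapping_bit_double [simp]: "x + x = (0 :: 'b \<Rightarrow>\<^sub>0 bit)"
proof (rule poly_mapping_eqI)
  fix k show "Poly_Mapping.lookup (x + x) k = Poly_Mapping.lookup 0 k"
    by (cases "Poly_Mapping.lookup x k") (simp_all add: lookup_add)
qed

lemma poly_mapping_bit_cancel [simp]: "x + (x + y) = (y :: 'b \<Rightarrow>\<^sub>0 bit)"
  by (simp flip: add.assoc)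

lemma poly_mapping_bit_add_eq_0_iff: "x + y = 0 \<longleftrightarrow> x = (y :: 'b \<Rightarrow>\<^sub>0 bit)"
  by (metis add.right_neutral poly_mapping_bit_double poly_mapping_bit_cancel)

lemma scale_F2_simps [simp]: "scale_F2 0 x = 0" "scale_F2 1 x = x"
  unfolding scale_F2_def
  by (rule poly_mapping_eqI; simp add: Poly_Mapping.map.rep_eq when_def)+

lemma scale_F2_add: "scale_F2 a (x + y) = scale_F2 a x + scale_F2 a y"
  by (cases a) simp_all

lemma span_of_closed [simp]:
  "0 \<in> span_of S"
  "x \<in> span_of S \<Longrightarrow> y \<in> span_of S \<Longrightarrow> x + y \<in> span_of S"
  "x \<in> span_of S \<Longrightarrow> scale_F2 a x \<in> span_of S"
  "Poly_Mapping.single b 1 \<in> span_of S \<longleftrightarrow> b \<in> S"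
  using keys_add[of x y] by (auto simp: span_of_def) (cases a; auto)

lemma scale_F2_zero [simp]: "scale_F2 a 0 = 0"
  by (cases a) simp_all

lemma span_of_empty: "span_of {} = {0}"
  by (auto simp: span_of_def)

lemma span_of_sum: "(\<And>i. i \<in> I \<Longrightarrow> f i \<in> span_of S) \<Longrightarrow> sum f I \<in> span_of S"
  by (induction I rule: infinite_finite_induct) auto

lemma span_of_mono: "S \<subseteq> S' \<Longrightarrow> x \<in> span_of S \<Longrightarrow> x \<in> span_of S'"
  by (auto simp: span_of_def)

lemma poly_mapping_bit_expand: "x = (\<Sum>b\<in>Poly_Mapping.keys x. Poly_Mapping.single b (1::bit))"
proof (rule poly_mapping_eqI)
  fix k
  have "Poly_Mapping.lookup x k = (if k \<in> Poly_Mapping.keys x then 1 else 0)"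
    by (simp add: in_keys_iff)
  also have "\<dots> = (\<Sum>b\<in>Poly_Mapping.keys x. Poly_Mapping.lookup (Poly_Mapping.single b 1) k)"
    by (simp add: lookup_single when_def)
  finally show "Poly_Mapping.lookup x k = Poly_Mapping.lookup (\<Sum>b\<in>Poly_Mapping.keys x. Poly_Mapping.single b 1) k"
    by (simp add: lookup_sum)
qed

text \<open>Over the two-element field additivity is linearity, the only scalars being 0 and 1; see
  \<open>additive_map_scale\<close>.\<close>

definition additive_map :: "(('b \<Rightarrow>\<^sub>0 bit) \<Rightarrow> ('c \<Rightarrow>\<^sub>0 bit)) \<Rightarrow> bool" where
  "additive_map L \<longleftrightarrow> (\<forall>x y. L (x + y) = L x + L y)"

lemma additive_map_add: "additive_map L \<Longrightarrow> L (x + y) = L x + L y"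
  by (simp add: additive_map_def)

lemma additive_map_zero: "additive_map L \<Longrightarrow> L 0 = 0"
  by (metis additive_map_add poly_mapping_bit_double)

lemma additive_map_sum: "additive_map L \<Longrightarrow> L (sum f I) = (\<Sum>i\<in>I. L (f i))"
  by (induction I rule: infinite_finite_induct) (auto simp: additive_map_zero additive_map_add)

lemma additive_map_scale: "additive_map L \<Longrightarrow> L (scale_F2 a x) = scale_F2 a (L x)"
  by (cases a) (simp_all add: additive_map_zero)

lemma additive_map_expand:
  "additive_map L \<Longrightarrow> L x = (\<Sum>b\<in>Poly_Mapping.keys x. L (Poly_Mapping.single b 1))"
  by (subst poly_mapping_bit_expand) (rule additive_map_sum)

text \<open>Reduces identities of operators to basis elements. The set \<open>S\<close> keeps the
  check to configurations, where disjointness of marks and red edges is available.\<close>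

lemma additive_map_eqI:
  assumes "additive_map L" "additive_map L'" "x \<in> span_of S"
    and "\<And>b. b \<in> S \<Longrightarrow> L (Poly_Mapping.single b 1) = L' (Poly_Mapping.single b 1)"
  shows "L x = L' x"
  using assms by (simp add: additive_map_expand[of L x] additive_map_expand[of L' x] span_of_def subset_iff)

lemma additive_map_span:
  assumes "additive_map L" "x \<in> span_of S" "\<And>b. b \<in> S \<Longrightarrow> L (Poly_Mapping.single b 1) \<in> span_of S'"
  shows "L x \<in> span_of S'"
  using assms by (auto simp: additive_map_expand[of L x] span_of_def intro!: span_of_sum[unfolded span_of_def, simplified])

lemma additive_map_compose: "additive_map L \<Longrightarrow> additive_map L' \<Longrightarrow> additive_map (\<lambda>x. L (L' x))"
  by (simp add: additive_map_def)

lemma additive_map_plus: "additive_map L \<Longrightarrow> additive_map L' \<Longrightarrow> additive_map (\<lambda>x. L x + L' x)"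
  by (simp add: additive_map_def add_ac)

lemma additive_map_id: "additive_map (\<lambda>x. x)"
  by (simp add: additive_map_def)

lemma additive_map_const_0: "additive_map (\<lambda>x. 0)"
  by (simp add: additive_map_def)

lemma additive_map_sum_fun: "(\<And>i. i \<in> I \<Longrightarrow> additive_map (L i)) \<Longrightarrow> additive_map (\<lambda>x. \<Sum>i\<in>I. L i x)"
  by (simp add: additive_map_def sum.distrib)

text \<open>Supports can shrink by cancellation in \<open>x + y\<close>, so additivity is checked on
  a common finite set containing all three supports.\<close>

lemma lin_ext_superset:
  assumes "finite A" "Poly_Mapping.keys x \<subseteq> A"
  shows "lin_ext f x = (\<Sum>b\<in>A. scale_F2 (Poly_Mapping.lookup x b) (f b))"
  unfolding lin_ext_def using assms
  by (intro sum.mono_neutral_left) (auto simp: in_keys_iff)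

lemma lin_ext_additive: "additive_map (lin_ext f)"
  unfolding additive_map_def
proof (intro allI)
  fix x y :: "'a \<Rightarrow>\<^sub>0 bit"
  let ?A = "Poly_Mapping.keys x \<union> Poly_Mapping.keys y"
  have "scale_F2 (a + b) z = scale_F2 a z + scale_F2 b z" for a b and z :: "'b \<Rightarrow>\<^sub>0 bit"
    by (cases a; cases b) simp_all
  then show "lin_ext f (x + y) = lin_ext f x + lin_ext f y"
    using keys_add[of x y]
    by (simp add: lin_ext_superset[of ?A] lookup_add sum.distrib)
qed

lemma lin_ext_single [simp]: "lin_ext f (Poly_Mapping.single b 1) = f b"
  by (simp add: lin_ext_def)

text \<open>The terms at \<open>(i, j)\<close> and \<open>(j, i)\<close> are equal and cancel in
  characteristic 2. Squares of D and of d take this form: two elementary moves at different places,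
  made in either order.\<close>

lemma offdiagonal_sum_eq_0:
  fixes g :: "'i \<Rightarrow> 'i \<Rightarrow> 'b \<Rightarrow>\<^sub>0 bit"
  assumes "finite A" "\<And>i j. i \<in> A \<Longrightarrow> j \<in> A \<Longrightarrow> g i j = g j i"
  shows "(\<Sum>i\<in>A. \<Sum>j\<in>A - {i}. g i j) = 0"
  using assms
proof (induction A rule: finite_induct)
  case (insert a A)
  have "(\<Sum>j\<in>insert a A - {i}. g i j) = g i a + (\<Sum>j\<in>A - {i}. g i j)" if "i \<in> A" for i
  proof -
    have "insert a A - {i} = insert a (A - {i})" using that insert.hyps by auto
    then show ?thesis using insert.hyps by simp
  qed
  then have "(\<Sum>i\<in>insert a A. \<Sum>j\<in>insert a A - {i}. g i j) =
      (\<Sum>j\<in>A. g a j) + ((\<Sum>i\<in>A. g i a) + (\<Sum>i\<in>A. \<Sum>j\<in>A - {i}. g i j))"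
    using insert.hyps by (simp add: sum.distrib)
  also have "(\<Sum>i\<in>A. g i a) = (\<Sum>j\<in>A. g a j)" using insert.prems by (intro sum.cong) auto
  finally show ?case using insert by simp
qed simp

section \<open>The Seifert bicomplex of a finite graph\<close>

abbreviation basis_elt :: "'b \<Rightarrow> ('b \<Rightarrow>\<^sub>0 bit)" where
  "basis_elt b \<equiv> Poly_Mapping.single b 1"

definition split_red :: "'a config \<Rightarrow> 'a set \<Rightarrow> 'a \<Rightarrow> 'a config" where
  "split_red C e u =
    \<lparr>pluses = insert u (pluses C), minuses = minuses C \<union> (e - {u}), reds = reds C - {e}\<rparr>"

definition to_minus :: "'a config \<Rightarrow> 'a \<Rightarrow> 'a config" where
  "to_minus C v = \<lparr>pluses = pluses C - {v}, minuses = insert v (minuses C), reds = reds C\<rparr>"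

definition to_plus :: "'a config \<Rightarrow> 'a \<Rightarrow> 'a config" where
  "to_plus C v = \<lparr>pluses = insert v (pluses C), minuses = minuses C - {v}, reds = reds C\<rparr>"

text \<open>A partial inverse of the term of d at \<open>v\<close>. The value 0 at a plus or at an
  unmarked vertex makes it a contraction, like the annihilation operator paired with a creation
  operator.\<close>

definition plus_homotopy :: "'a \<Rightarrow> ('a config \<Rightarrow>\<^sub>0 bit) \<Rightarrow> ('a config \<Rightarrow>\<^sub>0 bit)" where
  "plus_homotopy v = lin_ext (\<lambda>C. if v \<in> minuses C then basis_elt (to_plus C v) else 0)"

abbreviation marks :: "'a config \<Rightarrow> 'a set" where
  "marks C \<equiv> pluses C \<union> minuses C"

lemma D_map_additive: "additive_map D_map"
  unfolding D_map_def by (rule lin_ext_additive)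

lemma d_map_additive: "additive_map d_map"
  unfolding d_map_def by (rule lin_ext_additive)

lemma total_diff_additive: "additive_map total_diff"
  unfolding total_diff_def using D_map_additive d_map_additive by (rule additive_map_plus)

lemma plus_homotopy_additive: "additive_map (plus_homotopy v)"
  unfolding plus_homotopy_def by (rule lin_ext_additive)

lemma D_map_basis: "D_map (basis_elt C) = (\<Sum>e\<in>reds C. \<Sum>u\<in>e. basis_elt (split_red C e u))"
  by (simp add: D_map_def split_red_def)

lemma d_map_basis: "d_map (basis_elt C) = (\<Sum>v\<in>pluses C. basis_elt (to_minus C v))"
  by (simp add: d_map_def to_minus_def)

lemma plus_homotopy_basis:
  "plus_homotopy v (basis_elt C) = (if v \<in> minuses C then basis_elt (to_plus C v) else 0)"
  by (simp add: plus_homotopy_def)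

text \<open>The bicomplex and its homotopies live on any finite simple graph; the absence of cycles
  enters through \<open>perfect_matching_unique\<close>.\<close>

locale finite_graph =
  fixes T :: "'a ugraph"
  assumes finite_verts: "finite (verts T)"
    and edge_subset: "e \<in> edges T \<Longrightarrow> e \<subseteq> verts T"
    and edge_card: "e \<in> edges T \<Longrightarrow> card e = 2"
begin

lemma finite_edges: "finite (edges T)"
  using edge_subset by (intro finite_subset[OF _ finite_Pow_iff[THEN iffD2, OF finite_verts]]) auto

text \<open>The definition speaks vertex by vertex. This global form with disjoint sets covering the
  vertices is the one that splitting an edge or changing a sign preserves by plain set
  algebra.\<close>

lemma configs_iff:
  "C \<in> configs T \<longleftrightarrow>
    pluses C \<inter> minuses C = {} \<and> reds C \<subseteq> edges T \<and>
    (\<forall>e\<in>reds C. e \<inter> marks C = {}) \<and> (\<forall>e\<in>reds C. \<forall>f\<in>reds C. e \<noteq> f \<longrightarrow> e \<inter> f = {}) \<and>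
    marks C \<union> \<Union>(reds C) = verts T"
  (is "_ \<longleftrightarrow> ?R")
proof
  assume C: "C \<in> configs T"
  then have vs: "v \<in> verts T \<Longrightarrow>
      (v \<in> pluses C \<longleftrightarrow> v \<notin> minuses C) \<and> (\<forall>e\<in>reds C. v \<notin> e) \<or>
      v \<notin> pluses C \<and> v \<notin> minuses C \<and> (\<exists>!e. e \<in> reds C \<and> v \<in> e)" for v
    unfolding configs_def by blast
  have sub: "pluses C \<subseteq> verts T" "minuses C \<subseteq> verts T" "reds C \<subseteq> edges T"
    using C by (simp_all add: configs_def)
  have red: "v \<in> verts T" if "e \<in> reds C" "v \<in> e" for e v
    using that sub(3) edge_subset by blast
  have "e \<inter> marks C = {}" if "e \<in> reds C" for e
  proof (rule equals0I)
    fix v assume v: "v \<in> e \<inter> marks C"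
    then show False using vs[OF red[OF that, of v]] that by blast
  qed
  moreover have "e \<inter> f = {}" if ef: "e \<in> reds C" "f \<in> reds C" "e \<noteq> f" for e f
  proof (rule equals0I)
    fix v assume v: "v \<in> e \<inter> f"
    then show False using vs[OF red[OF ef(1), of v]] ef by blast
  qed
  moreover have "pluses C \<inter> minuses C = {}"
  proof (rule equals0I)
    fix v assume v: "v \<in> pluses C \<inter> minuses C"
    then have "v \<in> verts T" using sub by blast
    then show False using vs[of v] v by blast
  qed
  moreover have "marks C \<union> \<Union>(reds C) = verts T"
  proof
    show "marks C \<union> \<Union>(reds C) \<subseteq> verts T" using sub red by blast
    show "verts T \<subseteq> marks C \<union> \<Union>(reds C)"
    proof
      fix v assume "v \<in> verts T"
      then show "v \<in> marks C \<union> \<Union>(reds C)" using vs[of v] by blast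
    qed
  qed
  ultimately show ?R using sub by simp
next
  assume R: ?R
  then have cover: "marks C \<union> \<Union>(reds C) = verts T"
    and dis: "pluses C \<inter> minuses C = {}"
    and red: "\<And>e. e \<in> reds C \<Longrightarrow> e \<inter> marks C = {}"
    and disj: "\<And>e f. e \<in> reds C \<Longrightarrow> f \<in> reds C \<Longrightarrow> e \<noteq> f \<Longrightarrow> e \<inter> f = {}"
    and edg: "reds C \<subseteq> edges T"
    by simp_all
  have sub: "pluses C \<subseteq> verts T" "minuses C \<subseteq> verts T"
    unfolding cover[symmetric] by blast+
  have "(v \<in> pluses C \<longleftrightarrow> v \<notin> minuses C) \<and> (\<forall>e\<in>reds C. v \<notin> e) \<or>
      v \<notin> pluses C \<and> v \<notin> minuses C \<and> (\<exists>!e. e \<in> reds C \<and> v \<in> e)" if "v \<in> verts T" for v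
  proof (cases "v \<in> marks C")
    case True
    have "v \<notin> e" if "e \<in> reds C" for e using True red[OF that] by blast
    then show ?thesis using True dis by blast
  next
    case False
    then obtain e where e: "e \<in> reds C" "v \<in> e" using \<open>v \<in> verts T\<close> unfolding cover[symmetric] by blast
    have "f = e" if "f \<in> reds C" "v \<in> f" for f using disj[OF that(1) e(1)] that(2) e(2) by blast
    then show ?thesis using False e by blast
  qed
  then show "C \<in> configs T" unfolding configs_def using edg sub by simp
qed

lemma configD:
  assumes "C \<in> configs T"
  shows "pluses C \<inter> minuses C = {}" "e \<in> reds C \<Longrightarrow> e \<inter> marks C = {}"
    "e \<in> reds C \<Longrightarrow> f \<in> reds C \<Longrightarrow> e \<noteq> f \<Longrightarrow> e \<inter> f = {}"
    "marks C \<union> \<Union>(reds C) = verts T" "reds C \<subseteq> edges T"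
    "finite (pluses C)" "finite (minuses C)" "finite (reds C)" "e \<in> reds C \<Longrightarrow> card e = 2"
proof -
  show *: "pluses C \<inter> minuses C = {}" "e \<in> reds C \<Longrightarrow> e \<inter> marks C = {}"
    "e \<in> reds C \<Longrightarrow> f \<in> reds C \<Longrightarrow> e \<noteq> f \<Longrightarrow> e \<inter> f = {}"
    "marks C \<union> \<Union>(reds C) = verts T" "reds C \<subseteq> edges T"
    using assms[unfolded configs_iff] by simp_all
  have "finite (marks C \<union> \<Union>(reds C))" unfolding *(4) by (rule finite_verts)
  then show "finite (pluses C)" "finite (minuses C)" by simp_all
  show "finite (reds C)" using *(5) finite_edges by (rule finite_subset)
  show "card e = 2" if "e \<in> reds C" using *(5) edge_card that by blast
qed

lemma configI:
  assumes "pluses C \<inter> minuses C = {}" "\<And>e. e \<in> reds C \<Longrightarrow> e \<inter> marks C = {}"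
    "\<And>e f. e \<in> reds C \<Longrightarrow> f \<in> reds C \<Longrightarrow> e \<noteq> f \<Longrightarrow> e \<inter> f = {}"
    "marks C \<union> \<Union>(reds C) = verts T" "reds C \<subseteq> edges T"
  shows "C \<in> configs T"
  unfolding configs_iff by (intro conjI ballI impI assms)

lemma split_red_config:
  assumes C: "C \<in> configs T" and e: "e \<in> reds C" "u \<in> e"
  shows "split_red C e u \<in> configs T"
    "Q_deg (split_red C e u) = Q_deg C + 1" "E_deg (split_red C e u) = E_deg C"
    "marks (split_red C e u) = marks C \<union> e"
proof -
  note C' = configD[OF C]
  have m: "marks (split_red C e u) = marks C \<union> e" using e by (auto simp: split_red_def)
  then show "marks (split_red C e u) = marks C \<union> e" .
  have r: "reds (split_red C e u) = reds C - {e}" by (simp add: split_red_def)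
  show "split_red C e u \<in> configs T"
  proof (rule configI, unfold m r)
    show "pluses (split_red C e u) \<inter> minuses (split_red C e u) = {}"
      using C'(1) C'(2)[OF e(1)] e unfolding split_red_def by auto
    show "reds C - {e} \<subseteq> edges T" using C'(5) by auto
    show "f \<inter> (marks C \<union> e) = {}" if "f \<in> reds C - {e}" for f
      using that C'(2)[of f] C'(3)[of f e] e by blast
    show "f \<inter> g = {}" if "f \<in> reds C - {e}" "g \<in> reds C - {e}" "f \<noteq> g" for f g
      using that C'(3)[of f g] by auto
    show "marks C \<union> e \<union> \<Union>(reds C - {e}) = verts T" using C'(4) e by blast
  qed
  \<comment> \<open>An edge has two ends, so splitting trades one red edge for one minus: Q goes up
    by 1 and E stays.\<close>
  have "card (e - {u}) = 1" using C'(9)[OF e(1)] e by simp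
  moreover have "minuses C \<inter> (e - {u}) = {}" using C'(2)[OF e(1)] by auto
  ultimately have "card (minuses (split_red C e u)) = card (minuses C) + 1"
    \<comment> \<open>Finiteness of \<open>e\<close> comes from \<open>card e = 2\<close>, since
      infinite sets have cardinality 0.\<close>
    using C'(7) C'(9)[OF e(1)] card.infinite[of e] by (cases "finite e") (simp_all add: split_red_def card_Un_disjoint)
  moreover have "card (reds C) = card (reds (split_red C e u)) + 1"
    unfolding r by (metis C'(8) e(1) Suc_eq_plus1 card_Suc_Diff1)
  ultimately show "Q_deg (split_red C e u) = Q_deg C + 1" "E_deg (split_red C e u) = E_deg C"
    by (simp_all add: Q_deg_def E_deg_def)
qed

lemma to_minus_config:
  assumes C: "C \<in> configs T" and v: "v \<in> pluses C"
  shows "to_minus C v \<in> configs T"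
    "Q_deg (to_minus C v) = Q_deg C + 1" "E_deg (to_minus C v) = E_deg C + 1"
    "marks (to_minus C v) = marks C"
proof -
  note C' = configD[OF C]
  have m: "marks (to_minus C v) = marks C" using v by (auto simp: to_minus_def)
  then show "marks (to_minus C v) = marks C" .
  have r: "reds (to_minus C v) = reds C" by (simp add: to_minus_def)
  show "to_minus C v \<in> configs T"
    by (rule configI, unfold m r)
      (use C' in \<open>simp_all add: to_minus_def\<close>, blast)
  have "v \<notin> minuses C" using C'(1) v by auto
  then show "Q_deg (to_minus C v) = Q_deg C + 1" "E_deg (to_minus C v) = E_deg C + 1"
    using C'(7) by (simp_all add: Q_deg_def E_deg_def to_minus_def)
qed

lemma to_plus_config:
  assumes C: "C \<in> configs T" and v: "v \<in> minuses C"
  shows "to_plus C v \<in> configs T" "Q_deg (to_plus C v) = Q_deg C - 1"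
    "marks (to_plus C v) = marks C"
proof -
  note C' = configD[OF C]
  have m: "marks (to_plus C v) = marks C" using v by (auto simp: to_plus_def)
  then show "marks (to_plus C v) = marks C" .
  have r: "reds (to_plus C v) = reds C" by (simp add: to_plus_def)
  show "to_plus C v \<in> configs T"
    by (rule configI, unfold m r)
      (use C' in \<open>simp_all add: to_plus_def\<close>, blast)
  have "card (minuses C) = card (minuses C - {v}) + 1"
    by (metis C'(7) v Suc_eq_plus1 card_Suc_Diff1)
  then show "Q_deg (to_plus C v) = Q_deg C - 1"
    by (simp add: Q_deg_def to_plus_def)
qed

section \<open>The bicomplex relations: D and d square to zero and commute\<close>

lemma D_D_basis:
  assumes C: "C \<in> configs T"
  shows "D_map (D_map (basis_elt C)) = 0"
proof -
  note C' = configD[OF C]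
  \<comment> \<open>After \<open>e\<close> is split, the red edges left are those of
    \<open>reds C - {e}\<close>; this produces the off-diagonal sum.\<close>
  have "D_map (D_map (basis_elt C)) =
      (\<Sum>e\<in>reds C. \<Sum>u\<in>e. \<Sum>f\<in>reds C - {e}. \<Sum>w\<in>f. basis_elt (split_red (split_red C e u) f w))"
    by (simp add: D_map_basis additive_map_sum[OF D_map_additive] split_red_def)
  also have "\<dots> =
      (\<Sum>e\<in>reds C. \<Sum>f\<in>reds C - {e}. \<Sum>u\<in>e. \<Sum>w\<in>f. basis_elt (split_red (split_red C e u) f w))"
    by (intro sum.cong refl sum.swap)
  also have "\<dots> = 0"
  proof (rule offdiagonal_sum_eq_0[OF C'(8)])
    fix e f
    have "split_red (split_red C e u) f w = split_red (split_red C f w) e u" for u w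
      by (auto simp: split_red_def)
    then show "(\<Sum>u\<in>e. \<Sum>w\<in>f. basis_elt (split_red (split_red C e u) f w)) =
        (\<Sum>u\<in>f. \<Sum>w\<in>e. basis_elt (split_red (split_red C f u) e w))"
      by (subst sum.swap) simp
  qed
  finally show ?thesis .
qed

lemma d_d_basis:
  assumes C: "C \<in> configs T"
  shows "d_map (d_map (basis_elt C)) = 0"
proof -
  note C' = configD[OF C]
  have "d_map (d_map (basis_elt C)) =
      (\<Sum>v\<in>pluses C. \<Sum>w\<in>pluses C - {v}. basis_elt (to_minus (to_minus C v) w))"
    by (simp add: d_map_basis additive_map_sum[OF d_map_additive] to_minus_def)
  also have "\<dots> = 0"
    by (rule offdiagonal_sum_eq_0[OF C'(6)]) (auto simp: to_minus_def intro: arg_cong[where f = basis_elt])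
  finally show ?thesis .
qed

text \<open>
  If \<open>d\<close> acts on the new plus, both ways of splitting the edge \<open>e\<close> give the configuration with
  two minuses on \<open>e\<close>, and these two terms cancel.
\<close>

lemma d_D_basis:
  assumes C: "C \<in> configs T"
  shows "d_map (D_map (basis_elt C)) = D_map (d_map (basis_elt C))"
proof -
  note C' = configD[OF C]
  have inner: "(\<Sum>u\<in>e. d_map (basis_elt (split_red C e u))) =
      (\<Sum>v\<in>pluses C. \<Sum>u\<in>e. basis_elt (split_red (to_minus C v) e u))"
    if e: "e \<in> reds C" for e
  proof -
    define X where "X = basis_elt \<lparr>pluses = pluses C, minuses = minuses C \<union> e, reds = reds C - {e}\<rparr>"
    have "d_map (basis_elt (split_red C e u)) =
        X + (\<Sum>v\<in>pluses C. basis_elt (split_red (to_minus C v) e u))" if u: "u \<in> e" for u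
    proof -
      have u': "u \<notin> pluses C" using C'(2)[OF e] u by auto
      have "d_map (basis_elt (split_red C e u)) =
          (\<Sum>v\<in>insert u (pluses C). basis_elt (to_minus (split_red C e u) v))"
        by (simp add: d_map_basis) (simp add: split_red_def)
      also have "\<dots> = basis_elt (to_minus (split_red C e u) u) +
          (\<Sum>v\<in>pluses C. basis_elt (to_minus (split_red C e u) v))"
        using u' C'(6) by simp
      also have "to_minus (split_red C e u) u =
          \<lparr>pluses = pluses C, minuses = minuses C \<union> e, reds = reds C - {e}\<rparr>"
        using u u' by (auto simp: split_red_def to_minus_def)
      also have "(\<Sum>v\<in>pluses C. basis_elt (to_minus (split_red C e u) v)) =
          (\<Sum>v\<in>pluses C. basis_elt (split_red (to_minus C v) e u))"
      proof (rule sum.cong[OF refl])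
        fix v assume "v \<in> pluses C"
        then have "v \<noteq> u" using u' by auto
        then have "to_minus (split_red C e u) v = split_red (to_minus C v) e u"
          by (auto simp: split_red_def to_minus_def)
        then show "basis_elt (to_minus (split_red C e u) v) = basis_elt (split_red (to_minus C v) e u)"
          by simp
      qed
      finally show ?thesis by (simp add: X_def)
    qed
    then have "(\<Sum>u\<in>e. d_map (basis_elt (split_red C e u))) =
        (\<Sum>u\<in>e. X) + (\<Sum>u\<in>e. \<Sum>v\<in>pluses C. basis_elt (split_red (to_minus C v) e u))"
      by (simp add: sum.distrib)
    also have "(\<Sum>u\<in>e. X) = 0"
    proof -
      obtain x y where "e = {x, y}" "x \<noteq> y" using C'(9)[OF e] by (meson card_2_iff)
      then show ?thesis by simp
    qed
    also have "(\<Sum>u\<in>e. \<Sum>v\<in>pluses C. basis_elt (split_red (to_minus C v) e u)) =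
        (\<Sum>v\<in>pluses C. \<Sum>u\<in>e. basis_elt (split_red (to_minus C v) e u))"
      by (rule sum.swap)
    finally show ?thesis by simp
  qed
  have "d_map (D_map (basis_elt C)) = (\<Sum>e\<in>reds C. \<Sum>u\<in>e. d_map (basis_elt (split_red C e u)))"
    by (simp add: D_map_basis additive_map_sum[OF d_map_additive])
  also have "\<dots> = (\<Sum>e\<in>reds C. \<Sum>v\<in>pluses C. \<Sum>u\<in>e. basis_elt (split_red (to_minus C v) e u))"
    by (intro sum.cong refl inner)
  also have "\<dots> = (\<Sum>v\<in>pluses C. \<Sum>e\<in>reds C. \<Sum>u\<in>e. basis_elt (split_red (to_minus C v) e u))"
    by (rule sum.swap)
  also have "\<dots> = D_map (d_map (basis_elt C))"
    by (simp add: d_map_basis D_map_basis additive_map_sum[OF D_map_additive])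
      (simp add: to_minus_def)
  finally show ?thesis .
qed

lemma D_D: "x \<in> span_of (configs T) \<Longrightarrow> D_map (D_map x) = 0"
  by (rule additive_map_eqI[OF additive_map_compose[OF D_map_additive D_map_additive]
        additive_map_const_0]) (auto simp: D_D_basis)

lemma d_d: "x \<in> span_of (configs T) \<Longrightarrow> d_map (d_map x) = 0"
  by (rule additive_map_eqI[OF additive_map_compose[OF d_map_additive d_map_additive]
        additive_map_const_0]) (auto simp: d_d_basis)

lemma d_D: "x \<in> span_of (configs T) \<Longrightarrow> d_map (D_map x) = D_map (d_map x)"
  by (rule additive_map_eqI[OF additive_map_compose[OF d_map_additive D_map_additive]
        additive_map_compose[OF D_map_additive d_map_additive]]) (auto simp: d_D_basis)

lemma total_diff_total_diff:
  assumes "x \<in> span_of (configs T)"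
  shows "total_diff (total_diff x) = 0"
proof -
  have "total_diff (total_diff x) = (D_map (D_map x) + D_map (d_map x)) + (d_map (D_map x) + d_map (d_map x))"
    by (simp add: total_diff_def additive_map_add[OF D_map_additive] additive_map_add[OF d_map_additive])
  then show ?thesis using assms by (simp add: D_D d_d d_D)
qed

lemma D_map_span:
  assumes "x \<in> span_of S" "S \<subseteq> configs T"
    "\<And>C e u. C \<in> S \<Longrightarrow> e \<in> reds C \<Longrightarrow> u \<in> e \<Longrightarrow> split_red C e u \<in> S'"
  shows "D_map x \<in> span_of S'"
  using assms(1)
  by (rule additive_map_span[OF D_map_additive]) (auto simp: D_map_basis assms intro!: span_of_sum)

lemma d_map_span:
  assumes "x \<in> span_of S" "S \<subseteq> configs T" "\<And>C v. C \<in> S \<Longrightarrow> v \<in> pluses C \<Longrightarrow> to_minus C v \<in> S'"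
  shows "d_map x \<in> span_of S'"
  using assms(1)
  by (rule additive_map_span[OF d_map_additive]) (auto simp: d_map_basis assms intro!: span_of_sum)

section \<open>The homotopies at single vertices and the vanishing of marked cohomology\<close>

lemma plus_homotopy_span:
  assumes "x \<in> span_of S" "S \<subseteq> configs T" "\<And>C. C \<in> S \<Longrightarrow> v \<in> minuses C \<Longrightarrow> to_plus C v \<in> S'"
  shows "plus_homotopy v x \<in> span_of S'"
  using assms(1)
  by (rule additive_map_span[OF plus_homotopy_additive]) (auto simp: plus_homotopy_basis assms)

text \<open>No red edge meets \<open>v\<close>, so the homotopy commutes with D, and it commutes
  with changing a sign elsewhere; these terms occur twice and cancel. What is left is the sign at
  \<open>v\<close>, going from minus to plus and back, or from plus to minus and back.\<close>

lemma homotopy_marked: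
  assumes C: "C \<in> configs T" and v: "v \<in> marks C"
  shows "total_diff (plus_homotopy v (basis_elt C)) + plus_homotopy v (total_diff (basis_elt C)) =
    basis_elt C"
proof -
  note C' = configD[OF C]
  note hsum = additive_map_sum[OF plus_homotopy_additive]
  have ve: "v \<notin> e" if "e \<in> reds C" for e using C'(2)[OF that] v by auto
  have hD: "plus_homotopy v (D_map (basis_elt C)) =
      (\<Sum>e\<in>reds C. \<Sum>u\<in>e. plus_homotopy v (basis_elt (split_red C e u)))"
    by (simp add: D_map_basis hsum)
  have hd: "plus_homotopy v (d_map (basis_elt C)) =
      (\<Sum>w\<in>pluses C. plus_homotopy v (basis_elt (to_minus C w)))"
    by (simp add: d_map_basis hsum)
  have hT: "plus_homotopy v (total_diff (basis_elt C)) =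
      plus_homotopy v (D_map (basis_elt C)) + plus_homotopy v (d_map (basis_elt C))"
    by (simp add: total_diff_def additive_map_add[OF plus_homotopy_additive])
  show ?thesis
  proof (cases "v \<in> minuses C")
    case True
    then have vp: "v \<notin> pluses C" using C'(1) by auto
    let ?P = "to_plus C v"
    have "D_map (basis_elt ?P) = plus_homotopy v (D_map (basis_elt C))"
    proof -
      have "plus_homotopy v (basis_elt (split_red C e u)) = basis_elt (split_red ?P e u)"
        if "e \<in> reds C" "u \<in> e" for e u
      proof -
        have "to_plus (split_red C e u) v = split_red ?P e u"
          using ve[OF that(1)] by (auto simp: to_plus_def split_red_def)
        moreover have "v \<in> minuses (split_red C e u)" using True by (simp add: split_red_def)
        ultimately show ?thesis by (simp add: plus_homotopy_basis)
      qed
      then show ?thesis unfolding hD by (simp add: D_map_basis) (simp add: to_plus_def)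
    qed
    \<comment> \<open>The surviving term \<open>basis_elt C\<close> arises when d turns the new plus
      at \<open>v\<close> back into a minus.\<close>
    moreover have "d_map (basis_elt ?P) = basis_elt C + plus_homotopy v (d_map (basis_elt C))"
    proof -
      have "plus_homotopy v (basis_elt (to_minus C w)) = basis_elt (to_minus ?P w)"
        if "w \<in> pluses C" for w
      proof -
        have "to_plus (to_minus C w) v = to_minus ?P w"
          using that vp by (auto simp: to_plus_def to_minus_def)
        moreover have "v \<in> minuses (to_minus C w)" using True by (simp add: to_minus_def)
        ultimately show ?thesis by (simp add: plus_homotopy_basis)
      qed
      moreover have "to_minus ?P v = C"
        using True vp by (cases C) (auto simp: to_minus_def to_plus_def)
      moreover have "pluses ?P = insert v (pluses C)" by (simp add: to_plus_def)
      ultimately show ?thesis unfolding hd using vp C'(6) by (simp add: d_map_basis)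
    qed
    moreover have "plus_homotopy v (basis_elt C) = basis_elt ?P"
      using True by (simp add: plus_homotopy_basis)
    ultimately show ?thesis unfolding hT by (simp add: total_diff_def add_ac)
  next
    case False
    then have vp: "v \<in> pluses C" using v by auto
    have "plus_homotopy v (D_map (basis_elt C)) = 0"
      unfolding hD using ve False by (auto simp: plus_homotopy_basis split_red_def intro!: sum.neutral)
    moreover have "plus_homotopy v (d_map (basis_elt C)) = basis_elt C"
    proof -
      \<comment> \<open>With a plus at \<open>v\<close>, the homotopy sees a minus there only after
        d has acted at \<open>v\<close> itself.\<close>
      have "plus_homotopy v (basis_elt (to_minus C w)) = (if w = v then basis_elt C else 0)" for w
      proof (cases "w = v")
        case True
        have "to_plus (to_minus C v) v = C"
          using False vp by (cases C) (auto simp: to_minus_def to_plus_def)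
        moreover have "v \<in> minuses (to_minus C v)" by (simp add: to_minus_def)
        ultimately show ?thesis using True by (simp add: plus_homotopy_basis)
      next
        case neq: False
        then have "v \<notin> minuses (to_minus C w)" using False by (simp add: to_minus_def)
        then show ?thesis using neq by (simp add: plus_homotopy_basis)
      qed
      then show ?thesis unfolding hd using vp C'(6) by simp
    qed
    moreover have "plus_homotopy v (basis_elt C) = 0"
      using False by (simp add: plus_homotopy_basis)
    ultimately show ?thesis by (simp add: hT additive_map_zero[OF total_diff_additive])
  qed
qed

lemma total_diff_span:
  assumes "x \<in> span_of S" "S \<subseteq> configs T"
    "\<And>C e u. C \<in> S \<Longrightarrow> e \<in> reds C \<Longrightarrow> u \<in> e \<Longrightarrow> split_red C e u \<in> S'"
    "\<And>C v. C \<in> S \<Longrightarrow> v \<in> pluses C \<Longrightarrow> to_minus C v \<in> S'"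
  shows "total_diff x \<in> span_of S'"
  unfolding total_diff_def
  by (intro span_of_closed D_map_span[OF assms(1,2,3)] d_map_span[OF assms(1,2,4)])

text \<open>Induction on the set \<open>A\<close> of vertices where marks are allowed to be looked
  for. Subtracting a null-homotopic map replaces the cocycle by a cohomologous one that no longer
  relies on the vertex \<open>v\<close>; once \<open>A\<close> is exhausted, the span is
  zero.\<close>

lemma marked_cocycle_is_coboundary:
  assumes "finite A"
    and "x \<in> span_of {C \<in> configs T. Q_deg C = k \<and> marks C \<inter> A \<noteq> {}}" "total_diff x = 0"
  shows "\<exists>y\<in>SC_deg T (k - 1). x = total_diff y"
  using assms
proof (induction A arbitrary: x rule: finite_induct)
  case empty
  then have "x = 0" by (simp add: span_of_def)
  then show ?case
    by (intro bexI[of _ 0]) (simp_all add: SC_deg_def additive_map_zero[OF total_diff_additive])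
next
  case (insert v A)
  let ?S = "\<lambda>B j. {C \<in> configs T. Q_deg C = j \<and> marks C \<inter> B \<noteq> {}}"
  let ?h = "plus_homotopy v"
  \<comment> \<open>The identity minus the null-homotopic map, signs being irrelevant in
    characteristic 2. On a cocycle it changes only the representative.\<close>
  define L where "L y = y + (total_diff (?h y) + ?h (total_diff y))" for y
  have h_span: "?h y \<in> span_of (?S B (j - 1))" if "y \<in> span_of (?S B j)" for y B j
    using that by (rule plus_homotopy_span) (auto simp: to_plus_config)
  have t_span: "total_diff y \<in> span_of (?S B (j + 1))" if "y \<in> span_of (?S B j)" for y B j
    using that by (rule total_diff_span) (auto simp: split_red_config to_minus_config)
  have L_additive: "additive_map L"
    unfolding L_def
    by (intro additive_map_plus additive_map_id additive_map_compose[OF total_diff_additive]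
        additive_map_compose[OF plus_homotopy_additive] plus_homotopy_additive total_diff_additive)
  have L_span: "L x \<in> span_of (?S A k)"
    using insert.prems(1)
  proof (rule additive_map_span[OF L_additive])
    fix C assume C: "C \<in> ?S (insert v A) k"
    show "L (basis_elt C) \<in> span_of (?S A k)"
    proof (cases "v \<in> marks C")
      case True
      then have "L (basis_elt C) = 0" using C homotopy_marked[of C v] by (simp add: L_def)
      then show ?thesis by simp
    next
      case False
      \<comment> \<open>\<open>C\<close> is marked in \<open>insert v A\<close> but not at
        \<open>v\<close>, so it is marked in \<open>A\<close>. \<open>L\<close> need not fix it, but
        all maps in \<open>L\<close> keep existing marks, so its image remains marked in
        \<open>A\<close>.\<close>
      then have "basis_elt C \<in> span_of (?S A k)" using C by auto
      then show ?thesis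
        using t_span[OF h_span] h_span[OF t_span] by (auto simp: L_def)
    qed
  qed
  have hx: "?h x \<in> span_of (?S (insert v A) (k - 1))" by (rule h_span[OF insert.prems(1)])
  have hx': "?h x \<in> SC_deg T (k - 1)" "?h x \<in> span_of (configs T)"
    using hx by (auto simp: SC_deg_def intro: span_of_mono[rotated])
  have Lx: "L x = x + total_diff (?h x)"
    using insert.prems(2) by (simp add: L_def additive_map_zero[OF plus_homotopy_additive])
  have "total_diff (L x) = 0"
    using insert.prems(2) hx'(2)
    by (simp add: Lx additive_map_add[OF total_diff_additive] total_diff_total_diff)
  then obtain y where y: "y \<in> SC_deg T (k - 1)" "L x = total_diff y"
    using insert.IH[OF L_span] by blast
  have "x = total_diff y + total_diff (?h x)"
    using y(2) by (metis Lx add.assoc add.right_neutral poly_mapping_bit_double)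
  then show ?case
    using y(1) hx'(1)
    by (intro bexI[of _ "y + ?h x"]) (auto simp: additive_map_add[OF total_diff_additive] SC_deg_def)
qed

end

section \<open>The bicomplex as a vector space over the two-element field\<close>

lemma SC_simps [simp]:
  "carrier (SC T) = span_of (configs T)" "\<zero>\<^bsub>SC T\<^esub> = 0" "add (SC T) = (+)"
  "x \<oplus>\<^bsub>SC T\<^esub> y = x + y" "a \<odot>\<^bsub>SC T\<^esub> x = scale_F2 a x"
  by (simp_all add: SC_def)

lemma SC_vectorspace: "vectorspace F2 (SC T)"
proof (rule vs_criteria)
  show "field F2" by (rule class_field)
  show "\<forall>v\<in>carrier (SC T). \<exists>w\<in>carrier (SC T). v \<oplus>\<^bsub>SC T\<^esub> w = \<zero>\<^bsub>SC T\<^esub>"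
  proof
    fix v assume "v \<in> carrier (SC T)"
    then show "\<exists>w\<in>carrier (SC T). v \<oplus>\<^bsub>SC T\<^esub> w = \<zero>\<^bsub>SC T\<^esub>"
      by (intro bexI[of _ v]) simp_all
  qed
  have "scale_F2 (a * b) v = scale_F2 a (scale_F2 b v)"
    and "scale_F2 (a + b) v = scale_F2 a v + scale_F2 b v" for a b and v :: "'a config \<Rightarrow>\<^sub>0 bit"
    by (cases a; cases b; simp)+
  then show "\<forall>a b v. a \<in> carrier F2 \<and> b \<in> carrier F2 \<and> v \<in> carrier (SC T) \<longrightarrow>
      (a \<otimes>\<^bsub>F2\<^esub> b) \<odot>\<^bsub>SC T\<^esub> v = a \<odot>\<^bsub>SC T\<^esub> (b \<odot>\<^bsub>SC T\<^esub> v)"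
    and "\<forall>a b v. a \<in> carrier F2 \<and> b \<in> carrier F2 \<and> v \<in> carrier (SC T) \<longrightarrow>
      (a \<oplus>\<^bsub>F2\<^esub> b) \<odot>\<^bsub>SC T\<^esub> v = a \<odot>\<^bsub>SC T\<^esub> v \<oplus>\<^bsub>SC T\<^esub> b \<odot>\<^bsub>SC T\<^esub> v"
    by simp_all
qed (auto simp: add_ac scale_F2_add)

lemma SC_minus: "y \<in> span_of (configs T) \<Longrightarrow> x \<ominus>\<^bsub>SC T\<^esub> y = x + y"
proof -
  assume y: "y \<in> span_of (configs T)"
  interpret vectorspace F2 "SC T" by (rule SC_vectorspace)
  have "\<ominus>\<^bsub>SC T\<^esub> y = y" using y by (intro M.minus_equality) simp_all
  then show ?thesis by (simp add: a_minus_def)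
qed

lemma span_of_submodule:
  assumes "S \<subseteq> configs T"
  shows "submodule F2 (span_of S) (SC T)"
proof (rule submodule.intro)
  show "Module.module F2 (SC T)"
    using SC_vectorspace unfolding vectorspace_def by (rule conjunct1)
qed (use assms in \<open>auto intro: span_of_mono\<close>)

section \<open>Homogeneous components for the E-grading and the filtration by it\<close>

context finite_graph
begin

text \<open>The projection to one E-degree. It commutes with D and shifts d, so applied in the
  lowest degree of a filtered element it separates D from the total differential.\<close>

definition E_part :: "int \<Rightarrow> ('a config \<Rightarrow>\<^sub>0 bit) \<Rightarrow> ('a config \<Rightarrow>\<^sub>0 bit)" where
  "E_part n = lin_ext (\<lambda>C. if E_deg C = n then basis_elt C else 0)"

lemma E_part_additive: "additive_map (E_part n)"
  unfolding E_part_def by (rule lin_ext_additive)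

lemma E_part_basis: "E_part n (basis_elt C) = (if E_deg C = n then basis_elt C else 0)"
  by (simp add: E_part_def)

lemma E_part_span: "x \<in> span_of S \<Longrightarrow> E_part n x \<in> span_of {C \<in> S. E_deg C = n}"
  by (rule additive_map_span[OF E_part_additive]) (auto simp: E_part_basis)

lemma E_part_eq:
  assumes "x \<in> span_of S" "\<And>C. C \<in> S \<Longrightarrow> E_deg C = m"
  shows "E_part n x = (if n = m then x else 0)"
proof (cases "n = m")
  case True
  then show ?thesis
    using additive_map_eqI[OF E_part_additive additive_map_id assms(1)] assms(2)
    by (simp add: E_part_basis)
next
  case False
  then show ?thesis
    using additive_map_eqI[OF E_part_additive additive_map_const_0 assms(1)] assms(2)
    by (simp add: E_part_basis)
qed

lemma E_part_low:
  assumes "x \<in> span_of S" "\<And>C. C \<in> S \<Longrightarrow> n < E_deg C"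
  shows "E_part n x = 0"
  using additive_map_eqI[OF E_part_additive additive_map_const_0 assms(1)] assms(2)
  by (force simp: E_part_basis)

lemma E_part_D:
  assumes "x \<in> span_of (configs T)"
  shows "E_part n (D_map x) = D_map (E_part n x)"
proof (rule additive_map_eqI[OF additive_map_compose[OF E_part_additive D_map_additive]
      additive_map_compose[OF D_map_additive E_part_additive] assms])
  fix C assume C: "C \<in> configs T"
  have "D_map (basis_elt C) \<in> span_of {C' \<in> configs T. E_deg C' = E_deg C}"
    by (rule D_map_span[of _ "{C}"]) (use C in \<open>auto simp: split_red_config\<close>)
  then show "E_part n (D_map (basis_elt C)) = D_map (E_part n (basis_elt C))"
    by (subst E_part_eq[where m = "E_deg C"])
      (auto simp: E_part_basis additive_map_zero[OF D_map_additive])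
qed

lemma E_part_d:
  assumes "x \<in> span_of (configs T)"
  shows "E_part n (d_map x) = d_map (E_part (n - 1) x)"
proof (rule additive_map_eqI[OF additive_map_compose[OF E_part_additive d_map_additive]
      additive_map_compose[OF d_map_additive E_part_additive] assms])
  fix C assume C: "C \<in> configs T"
  have "d_map (basis_elt C) \<in> span_of {C' \<in> configs T. E_deg C' = E_deg C + 1}"
    by (rule d_map_span[of _ "{C}"]) (use C in \<open>auto simp: to_minus_config\<close>)
  then show "E_part n (d_map (basis_elt C)) = d_map (E_part (n - 1) (basis_elt C))"
    by (subst E_part_eq[where m = "E_deg C + 1"])
      (auto simp: E_part_basis additive_map_zero[OF d_map_additive])
qed

lemma SC_deg_carrier: "x \<in> SC_deg T k \<Longrightarrow> x \<in> span_of (configs T)"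
  unfolding SC_deg_def by (rule span_of_mono[rotated]) auto

lemma SC_bideg_deg: "x \<in> SC_bideg T n k \<Longrightarrow> x \<in> SC_deg T k"
  unfolding SC_bideg_def SC_deg_def by (rule span_of_mono[rotated]) auto

lemma SC_bideg_filt: "x \<in> SC_bideg T n k \<Longrightarrow> x \<in> SC_filt T n k"
  unfolding SC_bideg_def SC_filt_def by (rule span_of_mono[rotated]) auto

lemma SC_filt_deg: "x \<in> SC_filt T p k \<Longrightarrow> x \<in> SC_deg T k"
  unfolding SC_filt_def SC_deg_def by (rule span_of_mono[rotated]) auto

lemma D_deg: "x \<in> SC_deg T k \<Longrightarrow> D_map x \<in> SC_deg T (k + 1)"
  unfolding SC_deg_def by (rule D_map_span) (auto simp: split_red_config)

lemma D_bideg: "x \<in> SC_bideg T n k \<Longrightarrow> D_map x \<in> SC_bideg T n (k + 1)"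
  unfolding SC_bideg_def by (rule D_map_span) (auto simp: split_red_config)

lemma d_bideg: "x \<in> SC_bideg T n k \<Longrightarrow> d_map x \<in> SC_bideg T (n + 1) (k + 1)"
  unfolding SC_bideg_def by (rule d_map_span) (auto simp: to_minus_config)

lemma d_filt: "x \<in> SC_filt T p k \<Longrightarrow> d_map x \<in> SC_filt T (p + 1) (k + 1)"
  unfolding SC_filt_def by (rule d_map_span) (auto simp: to_minus_config)

lemma total_diff_filt: "x \<in> SC_filt T p k \<Longrightarrow> total_diff x \<in> SC_filt T p (k + 1)"
  unfolding SC_filt_def by (rule total_diff_span) (auto simp: split_red_config to_minus_config)

lemma E_part_bideg: "x \<in> SC_deg T k \<Longrightarrow> E_part n x \<in> SC_bideg T n k"
  using E_part_span[of x "{C \<in> configs T. Q_deg C = k}" n]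
  by (simp add: SC_deg_def SC_bideg_def conj_assoc)

lemma E_part_bideg_eq: "x \<in> SC_bideg T m k \<Longrightarrow> E_part n x = (if n = m then x else 0)"
  unfolding SC_bideg_def by (rule E_part_eq) auto

lemma E_part_filt: "x \<in> SC_filt T p k \<Longrightarrow> n < p \<Longrightarrow> E_part n x = 0"
  unfolding SC_filt_def by (rule E_part_low) auto

text \<open>In characteristic 2 the sum is a difference, so the component of lowest degree is
  removed.\<close>

lemma filt_minus_E_part: "x \<in> SC_filt T p k \<Longrightarrow> x + E_part p x \<in> SC_filt T (p + 1) k"
  unfolding SC_filt_def
  by (rule additive_map_span[OF additive_map_plus[OF additive_map_id E_part_additive]])
    (auto simp: E_part_basis)

text \<open>A crude bound: minuses are vertices and red edges are edges.\<close>

definition E_bound :: int where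
  "E_bound = int (card (verts T) + card (edges T))"

lemma E_deg_bounds:
  assumes "C \<in> configs T"
  shows "0 \<le> E_deg C" "E_deg C \<le> E_bound"
proof -
  have "minuses C \<subseteq> verts T" unfolding configD(4)[OF assms, symmetric] by auto
  then have "card (minuses C) \<le> card (verts T)" "card (reds C) \<le> card (edges T)"
    using configD(5)[OF assms] finite_verts finite_edges by (auto intro: card_mono)
  then show "0 \<le> E_deg C" "E_deg C \<le> E_bound" by (auto simp: E_deg_def E_bound_def)
qed

lemma sum_E_part:
  assumes "x \<in> span_of (configs T)"
  shows "(\<Sum>n\<in>{0..E_bound}. E_part n x) = x"
proof (rule additive_map_eqI[OF additive_map_sum_fun additive_map_id assms])
  fix C assume "C \<in> configs T"
  then show "(\<Sum>n\<in>{0..E_bound}. E_part n (basis_elt C)) = basis_elt C"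
    using E_deg_bounds by (simp add: E_part_basis)
qed (rule E_part_additive)

lemma SC_bideg_out_of_range: "n \<notin> {0..E_bound} \<Longrightarrow> SC_bideg T n k = {0}"
proof -
  assume "n \<notin> {0..E_bound}"
  then have "{C \<in> configs T. Q_deg C = k \<and> E_deg C = n} = {}" using E_deg_bounds by auto
  then show ?thesis unfolding SC_bideg_def by (simp only: span_of_empty)
qed

text \<open>E takes values from 0 to \<open>E_bound\<close>, so the filtration is everything up to
  step 0 and vanishes from step \<open>E_bound + 1\<close> on.\<close>

sublocale bounded_filtered_complex F2 "SC T" "SC_filt T" total_diff 0 "E_bound + 1"
proof (intro bounded_filtered_complex.intro filtered_complex.intro filtered_complex_axioms.intro
    bounded_filtered_complex_axioms.intro SC_vectorspace)
  show "submodule F2 (SC_filt T p k) (SC T)" for p k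
    unfolding SC_filt_def by (rule span_of_submodule) auto
  show "SC_filt T (p + 1) k \<subseteq> SC_filt T p k" for p k
    unfolding SC_filt_def by (auto intro: span_of_mono[rotated])
  show "x \<in> SC_filt T p k \<Longrightarrow> total_diff x \<in> SC_filt T p (k + 1)" for x p k
    by (rule total_diff_filt)
  show "total_diff (x \<oplus>\<^bsub>SC T\<^esub> y) = total_diff x \<oplus>\<^bsub>SC T\<^esub> total_diff y" for x y
    by (simp add: additive_map_add[OF total_diff_additive])
  show "total_diff (a \<odot>\<^bsub>SC T\<^esub> x) = a \<odot>\<^bsub>SC T\<^esub> total_diff x" for a x
    by (simp add: additive_map_scale[OF total_diff_additive])
  show "x \<in> SC_filt T p k \<Longrightarrow> total_diff (total_diff x) = \<zero>\<^bsub>SC T\<^esub>" for x p k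
    by (simp add: total_diff_total_diff[OF SC_deg_carrier[OF SC_filt_deg]])
  show "p \<le> 0 \<Longrightarrow> SC_filt T p k = SC_filt T 0 k" for p k
  proof -
    assume "p \<le> 0"
    then have "{C \<in> configs T. Q_deg C = k \<and> p \<le> E_deg C} = {C \<in> configs T. Q_deg C = k \<and> 0 \<le> E_deg C}"
      using E_deg_bounds by fastforce
    then show ?thesis by (simp add: SC_filt_def)
  qed
  show "E_bound + 1 \<le> p \<Longrightarrow> SC_filt T p k = {\<zero>\<^bsub>SC T\<^esub>}" for p k
  proof -
    assume p: "E_bound + 1 \<le> p"
    have "\<not> p \<le> E_deg C" if "C \<in> configs T" for C using E_deg_bounds(2)[OF that] p by simp
    then have "{C \<in> configs T. Q_deg C = k \<and> p \<le> E_deg C} = {}" by auto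
    then show ?thesis unfolding SC_filt_def by (simp only: span_of_empty SC_simps)
  qed
qed

lemma cochains_SC: "cochains (SC_filt T) k = SC_deg T k"
proof -
  have "{C \<in> configs T. Q_deg C = k \<and> 0 \<le> E_deg C} = {C \<in> configs T. Q_deg C = k}"
    using E_deg_bounds by auto
  then show ?thesis by (simp add: cochains_eq SC_filt_def SC_deg_def)
qed

section \<open>Seifert cohomology and the first page\<close>

lemma cocycles_D_submodule:
  assumes "S \<subseteq> configs T"
  shows "submodule F2 {x \<in> span_of S. D_map x = \<zero>\<^bsub>SC T\<^esub>} (SC T)"
proof -
  interpret S: submodule F2 "span_of S" "SC T" by (rule span_of_submodule[OF assms])
  show ?thesis
    by (rule submodule.intro[OF S.module])
      (use S.subset in \<open>auto simp: additive_map_add[OF D_map_additive]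
        additive_map_scale[OF D_map_additive] additive_map_zero[OF D_map_additive]\<close>)
qed

lemma coboundaries_D_submodule:
  assumes "S \<subseteq> configs T"
  shows "submodule F2 (D_map ` span_of S) (SC T)"
proof -
  interpret S: submodule F2 "span_of S" "SC T" by (rule span_of_submodule[OF assms])
  show ?thesis
  proof (rule submodule.intro[OF S.module])
    have "D_map x \<in> span_of (configs T)" if "x \<in> span_of S" for x
      using that assms by (rule D_map_span) (use assms in \<open>auto simp: split_red_config\<close>)
    then show "D_map ` span_of S \<subseteq> carrier (SC T)" by auto
    show "\<zero>\<^bsub>SC T\<^esub> \<in> D_map ` span_of S"
      by (auto simp: image_iff additive_map_zero[OF D_map_additive] intro!: bexI[of _ 0])
    fix v w assume "v \<in> D_map ` span_of S" "w \<in> D_map ` span_of S"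
    then show "v \<oplus>\<^bsub>SC T\<^esub> w \<in> D_map ` span_of S"
      by (auto simp: additive_map_add[OF D_map_additive, symmetric])
  next
    fix c v assume "v \<in> D_map ` span_of S"
    then show "c \<odot>\<^bsub>SC T\<^esub> v \<in> D_map ` span_of S"
      by (auto simp: additive_map_scale[OF D_map_additive, symmetric])
  qed
qed

lemma SH_subquotient:
  "subquotient F2 (SC T) {x \<in> SC_deg T k. D_map x = \<zero>\<^bsub>SC T\<^esub>} (D_map ` SC_deg T (k - 1))"
proof (intro subquotient.intro subquotient_axioms.intro SC_vectorspace)
  show "D_map ` SC_deg T (k - 1) \<subseteq> {x \<in> SC_deg T k. D_map x = \<zero>\<^bsub>SC T\<^esub>}"
    using D_deg[of _ "k - 1"] D_D[OF SC_deg_carrier] by auto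
qed (unfold SC_deg_def, intro cocycles_D_submodule coboundaries_D_submodule; blast)+

lemma SH_bideg_subquotient:
  "subquotient F2 (SC T) {x \<in> SC_bideg T n k. D_map x = \<zero>\<^bsub>SC T\<^esub>} (D_map ` SC_bideg T n (k - 1))"
proof (intro subquotient.intro subquotient_axioms.intro SC_vectorspace)
  show "D_map ` SC_bideg T n (k - 1) \<subseteq> {x \<in> SC_bideg T n k. D_map x = \<zero>\<^bsub>SC T\<^esub>}"
    using D_bideg[of _ n "k - 1"] D_D[OF SC_deg_carrier[OF SC_bideg_deg]] by auto
qed (unfold SC_bideg_def, intro cocycles_D_submodule coboundaries_D_submodule; blast)+

text \<open>The total differential agrees with D up to d, which raises the filtration by one. Hence
  a homogeneous D-cocycle is in \<open>Z 1 n k\<close>, and \<open>D_map y\<close> equals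
  \<open>total_diff y\<close> plus a correction \<open>d_map y\<close> that the denominator of the
  first page absorbs.\<close>

lemma SH_to_E1_subquotient_map:
  "subquotient_map F2 (SC T) {x \<in> SC_bideg T n k. D_map x = \<zero>\<^bsub>SC T\<^esub>} (D_map ` SC_bideg T n (k - 1))
    (SC T) (Z 1 n k) (B 1 n k) (\<lambda>x. x)"
proof -
  interpret src: subquotient F2 "SC T" "{x \<in> SC_bideg T n k. D_map x = \<zero>\<^bsub>SC T\<^esub>}"
    "D_map ` SC_bideg T n (k - 1)" by (rule SH_bideg_subquotient)
  interpret tgt: subquotient F2 "SC T" "Z 1 n k" "B 1 n k" by (rule E_subquotient) simp
  show ?thesis
  proof
    fix x assume x: "x \<in> {x \<in> SC_bideg T n k. D_map x = \<zero>\<^bsub>SC T\<^esub>}"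
    then have "total_diff x = d_map x" by (simp add: total_diff_def)
    then show "x \<in> Z 1 n k" using x SC_bideg_filt d_filt by (simp add: Z_iff)
  next
    fix x assume "x \<in> D_map ` SC_bideg T n (k - 1)"
    then obtain y where y: "y \<in> SC_bideg T n (k - 1)" "x = D_map y" by auto
    have yf: "y \<in> SC_filt T n (k - 1)" using y SC_bideg_filt by simp
    have dy: "d_map y \<in> SC_filt T (n + 1) k" using d_filt[OF yf] by simp
    have "x = total_diff y \<oplus>\<^bsub>SC T\<^esub> d_map y"
      using y(2) by (simp add: total_diff_def add.assoc)
    moreover have "total_diff y \<in> SC_filt T n k" using total_diff_filt[OF yf] by simp
    ultimately show "x \<in> B 1 n k"
      using yf dy total_diff_filt[OF dy] by (auto simp: B_iff)
  qed auto
qed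

text \<open>The inverse takes the component of E-degree \<open>n\<close>. On elements of filtration
  \<open>n\<close> this projection turns the total differential into D, because d would need a
  component in degree \<open>n - 1\<close>.\<close>

lemma SH_to_E1_lin_iso: "lin_iso F2 (SH_bideg T n k) (Seifert_E T 1 n k) (SH_to_E1 T n k)"
proof -
  interpret subquotient_map F2 "SC T" "{x \<in> SC_bideg T n k. D_map x = \<zero>\<^bsub>SC T\<^esub>}"
    "D_map ` SC_bideg T n (k - 1)" "SC T" "Z 1 n k" "B 1 n k" "\<lambda>x. x"
    by (rule SH_to_E1_subquotient_map)
  have "lin_iso F2 (subquot (SC T) {x \<in> SC_bideg T n k. D_map x = \<zero>\<^bsub>SC T\<^esub>} (D_map ` SC_bideg T n (k - 1)))
      (subquot (SC T) (Z 1 n k) (B 1 n k)) (induced_map (SC T) (B 1 n k) (\<lambda>x. x))"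
  proof (rule induced_lin_iso)
    fix x assume x: "x \<in> {x \<in> SC_bideg T n k. D_map x = \<zero>\<^bsub>SC T\<^esub>}" "x \<in> B 1 n k"
    then obtain y z where yz: "y \<in> SC_filt T n (k - 1)" "z \<in> SC_filt T (n + 1) k"
      "x = total_diff y + z" by (auto simp: B_iff)
    have yc: "y \<in> span_of (configs T)" using yz(1) SC_filt_deg SC_deg_carrier by blast
    have "x = E_part n x" using x E_part_bideg_eq[of x n k n] by simp
    also have "\<dots> = D_map (E_part n y) + d_map (E_part (n - 1) y) + E_part n z"
      using yc by (simp add: yz(3) additive_map_add[OF E_part_additive] total_diff_def E_part_D E_part_d)
    also have "\<dots> = D_map (E_part n y)"
      using E_part_filt[OF yz(1), of "n - 1"] E_part_filt[OF yz(2), of n]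
      by (simp add: additive_map_zero[OF d_map_additive])
    finally have "x = D_map (E_part n y)" .
    then show "x \<in> D_map ` SC_bideg T n (k - 1)"
      using E_part_bideg[OF SC_filt_deg[OF yz(1)]] by blast
  next
    fix y assume "y \<in> Z 1 n k"
    then have y: "y \<in> SC_filt T n k" "total_diff y \<in> SC_filt T (n + 1) (k + 1)"
      by (auto simp: Z_iff)
    have yc: "y \<in> span_of (configs T)" using y(1) SC_filt_deg SC_deg_carrier by blast
    have yb: "E_part n y \<in> SC_bideg T n k" using E_part_bideg[OF SC_filt_deg[OF y(1)]] .
    \<comment> \<open>Being in \<open>Z 1 n k\<close> pushes \<open>total_diff y\<close> to
      filtration \<open>n + 1\<close>; its vanishing component in degree \<open>n\<close> is D of
      the leading component of \<open>y\<close>.\<close>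
    have "0 = E_part n (total_diff y)" using E_part_filt[OF y(2)] by simp
    also have "\<dots> = D_map (E_part n y) + d_map (E_part (n - 1) y)"
      using yc by (simp add: total_diff_def additive_map_add[OF E_part_additive] E_part_D E_part_d)
    also have "\<dots> = D_map (E_part n y)"
      using E_part_filt[OF y(1), of "n - 1"] by (simp add: additive_map_zero[OF d_map_additive])
    finally have D0: "D_map (E_part n y) = 0" by simp
    have rest: "y + E_part n y \<in> SC_filt T (n + 1) k" by (rule filt_minus_E_part[OF y(1)])
    have "y + E_part n y \<in> B 1 n k"
      using rest total_diff_filt[OF rest] by (intro B_right) auto
    then show "\<exists>x\<in>{x \<in> SC_bideg T n k. D_map x = \<zero>\<^bsub>SC T\<^esub>}. y \<ominus>\<^bsub>SC T\<^esub> x \<in> B 1 n k"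
      using yb D0 by (intro bexI[of _ "E_part n y"]) (auto simp: SC_minus[OF SC_deg_carrier[OF SC_bideg_deg[OF yb]]])
  qed
  then show ?thesis
    by (simp add: SH_bideg_def cohomology_def Seifert_E_def ss_E_def SH_to_E1_def)
qed

lemma SH_d_subquotient_map:
  "subquotient_map F2 (SC T) {x \<in> SC_bideg T n k. D_map x = \<zero>\<^bsub>SC T\<^esub>} (D_map ` SC_bideg T n (k - 1))
    (SC T) {x \<in> SC_bideg T (n + 1) (k + 1). D_map x = \<zero>\<^bsub>SC T\<^esub>} (D_map ` SC_bideg T (n + 1) k) d_map"
proof -
  interpret src: subquotient F2 "SC T" "{x \<in> SC_bideg T n k. D_map x = \<zero>\<^bsub>SC T\<^esub>}"
    "D_map ` SC_bideg T n (k - 1)" by (rule SH_bideg_subquotient)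
  interpret tgt: subquotient F2 "SC T" "{x \<in> SC_bideg T (n + 1) (k + 1). D_map x = \<zero>\<^bsub>SC T\<^esub>}"
    "D_map ` SC_bideg T (n + 1) k" using SH_bideg_subquotient[of "n + 1" "k + 1"] by simp
  have dD: "d_map (D_map x) = D_map (d_map x)" if "x \<in> SC_bideg T m j" for x m j
    using that d_D SC_deg_carrier SC_bideg_deg by blast
  show ?thesis
  proof
    fix x assume "x \<in> {x \<in> SC_bideg T n k. D_map x = \<zero>\<^bsub>SC T\<^esub>}"
    then show "d_map x \<in> {x \<in> SC_bideg T (n + 1) (k + 1). D_map x = \<zero>\<^bsub>SC T\<^esub>}"
      using d_bideg dD[of x] by (auto simp: additive_map_zero[OF d_map_additive])
  next
    fix x assume "x \<in> D_map ` SC_bideg T n (k - 1)"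
    then show "d_map x \<in> D_map ` SC_bideg T (n + 1) k"
      using d_bideg[of _ n "k - 1"] by (auto simp: dD)
  qed (auto simp: additive_map_add[OF d_map_additive] additive_map_scale[OF d_map_additive])
qed

lemma SH_d_linear_map:
  "linear_map F2 (SH_bideg T n k) (SH_bideg T (n + 1) (k + 1)) (SH_d T n k)"
  using subquotient_map.induced_linear_map[OF SH_d_subquotient_map[of n k]]
  by (simp add: SH_bideg_def cohomology_def SH_d_def)

text \<open>On a D-cocycle the total differential is d, so both composites give the class of
  \<open>d_map x\<close>.\<close>

lemma SH_to_E1_d:
  assumes "X \<in> carrier (SH_bideg T n k)"
  shows "Seifert_d T 1 n k (SH_to_E1 T n k X) = SH_to_E1 T (n + 1) (k + 1) (SH_d T n k X)"
proof -
  interpret H: subquotient F2 "SC T" "{x \<in> SC_bideg T n k. D_map x = \<zero>\<^bsub>SC T\<^esub>}"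
    "D_map ` SC_bideg T n (k - 1)" by (rule SH_bideg_subquotient)
  interpret e: subquotient_map F2 "SC T" "{x \<in> SC_bideg T n k. D_map x = \<zero>\<^bsub>SC T\<^esub>}"
    "D_map ` SC_bideg T n (k - 1)" "SC T" "Z 1 n k" "B 1 n k" "\<lambda>x. x"
    by (rule SH_to_E1_subquotient_map)
  interpret e': subquotient_map F2 "SC T" "{x \<in> SC_bideg T (n + 1) (k + 1). D_map x = \<zero>\<^bsub>SC T\<^esub>}"
    "D_map ` SC_bideg T (n + 1) k" "SC T" "Z 1 (n + 1) (k + 1)" "B 1 (n + 1) (k + 1)" "\<lambda>x. x"
    using SH_to_E1_subquotient_map[of "n + 1" "k + 1"] by simp
  interpret d: subquotient_map F2 "SC T" "{x \<in> SC_bideg T n k. D_map x = \<zero>\<^bsub>SC T\<^esub>}"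
    "D_map ` SC_bideg T n (k - 1)" "SC T" "{x \<in> SC_bideg T (n + 1) (k + 1). D_map x = \<zero>\<^bsub>SC T\<^esub>}"
    "D_map ` SC_bideg T (n + 1) k" d_map
    by (rule SH_d_subquotient_map)
  obtain x where x: "x \<in> {x \<in> SC_bideg T n k. D_map x = \<zero>\<^bsub>SC T\<^esub>}"
    "X = D_map ` SC_bideg T n (k - 1) +>\<^bsub>SC T\<^esub> x"
    using assms unfolding SH_bideg_def cohomology_def H.subquot_carrier by blast
  have "Seifert_d T 1 n k (SH_to_E1 T n k X) = B 1 (n + 1) (k + 1) +>\<^bsub>SC T\<^esub> total_diff x"
    using d_coset[OF _ e.f_Z[OF x(1)]] e.induced_map_coset[OF x(1)]
    by (simp add: Seifert_d_def SH_to_E1_def x(2))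
  moreover have "total_diff x = d_map x" using x(1) by (simp add: total_diff_def)
  moreover have "SH_to_E1 T (n + 1) (k + 1) (SH_d T n k X) = B 1 (n + 1) (k + 1) +>\<^bsub>SC T\<^esub> d_map x"
    unfolding SH_to_E1_def SH_d_def x(2) d.induced_map_coset[OF x(1)]
    by (rule e'.induced_map_coset[OF d.f_Z[OF x(1)]])
  ultimately show ?thesis by simp
qed

end

section \<open>Direct sums, spaces of dimension at most one, and finite sums of cosets\<close>

lemma dsum_vectorspace:
  assumes V: "\<And>i. vectorspace K (M i)"
  shows "vectorspace K (dsum M)"
proof -
  note grp = V[unfolded vectorspace_def, THEN conjunct1, THEN module.axioms(2)]
  interpret field K using V unfolding vectorspace_def by blast
  have c: "f i \<in> carrier (M i)" if "f \<in> carrier (dsum M)" for f i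
    using that by (simp add: dsum_def)
  have fin: "finite {i. f i \<noteq> \<zero>\<^bsub>M i\<^esub>}" if "f \<in> carrier (dsum M)" for f
    using that by (simp add: dsum_def)
  \<comment> \<open>Finite support of \<open>g\<close> follows from that of \<open>f\<close> and
    \<open>f'\<close>; unary operations use it with both equal.\<close>
  have carrierI: "g \<in> carrier (dsum M)"
    if "\<And>i. g i \<in> carrier (M i)" "\<And>i. f i = \<zero>\<^bsub>M i\<^esub> \<Longrightarrow> f' i = \<zero>\<^bsub>M i\<^esub> \<Longrightarrow> g i = \<zero>\<^bsub>M i\<^esub>"
      "f \<in> carrier (dsum M)" "f' \<in> carrier (dsum M)" for f f' g
    using that(1) finite_subset[OF _ finite_UnI[OF fin[OF that(3)] fin[OF that(4)]],
        of "{i. g i \<noteq> \<zero>\<^bsub>M i\<^esub>}"] that(2)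
    unfolding dsum_def by auto
  have s: "\<zero>\<^bsub>dsum M\<^esub> = (\<lambda>i. \<zero>\<^bsub>M i\<^esub>)" "f \<oplus>\<^bsub>dsum M\<^esub> g = (\<lambda>i. f i \<oplus>\<^bsub>M i\<^esub> g i)"
    "a \<odot>\<^bsub>dsum M\<^esub> f = (\<lambda>i. a \<odot>\<^bsub>M i\<^esub> f i)" for f g a
    by (simp_all add: dsum_def)
  note ag = abelian_group.axioms(1)[OF grp]
  note md = V[unfolded vectorspace_def, THEN conjunct1]
  show ?thesis
  proof (rule vs_criteria)
    show "field K" by (rule field_axioms)
    show z: "\<zero>\<^bsub>dsum M\<^esub> \<in> carrier (dsum M)"
      by (simp add: dsum_def abelian_monoid.zero_closed[OF ag])
    show "\<forall>v w. v \<in> carrier (dsum M) \<and> w \<in> carrier (dsum M) \<longrightarrow> v \<oplus>\<^bsub>dsum M\<^esub> w \<in> carrier (dsum M)"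
    proof (intro allI impI, elim conjE)
      fix v w assume v: "v \<in> carrier (dsum M)" and w: "w \<in> carrier (dsum M)"
      show "v \<oplus>\<^bsub>dsum M\<^esub> w \<in> carrier (dsum M)"
        unfolding s
      proof (rule carrierI[OF _ _ v w])
        show "v i \<oplus>\<^bsub>M i\<^esub> w i \<in> carrier (M i)" for i
          by (rule abelian_monoid.a_closed[OF ag c[OF v] c[OF w]])
        show "v i \<oplus>\<^bsub>M i\<^esub> w i = \<zero>\<^bsub>M i\<^esub>" if "v i = \<zero>\<^bsub>M i\<^esub>" "w i = \<zero>\<^bsub>M i\<^esub>" for i
          unfolding that by (rule abelian_monoid.l_zero[OF ag abelian_monoid.zero_closed[OF ag]])
      qed
    qed
    show "\<forall>v\<in>carrier (dsum M). \<exists>w\<in>carrier (dsum M). v \<oplus>\<^bsub>dsum M\<^esub> w = \<zero>\<^bsub>dsum M\<^esub>"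
    proof
      fix v assume v: "v \<in> carrier (dsum M)"
      have zero: "\<ominus>\<^bsub>M i\<^esub> \<zero>\<^bsub>M i\<^esub> = \<zero>\<^bsub>M i\<^esub>" for i
        by (rule abelian_group.minus_equality[OF grp
              abelian_monoid.l_zero[OF ag abelian_monoid.zero_closed[OF ag]]
              abelian_monoid.zero_closed[OF ag] abelian_monoid.zero_closed[OF ag]])
      have "(\<lambda>i. \<ominus>\<^bsub>M i\<^esub> v i) \<in> carrier (dsum M)"
      proof (rule carrierI[OF _ _ v v])
        show "\<ominus>\<^bsub>M i\<^esub> v i \<in> carrier (M i)" for i
          by (rule abelian_group.a_inv_closed[OF grp c[OF v]])
        show "\<ominus>\<^bsub>M i\<^esub> v i = \<zero>\<^bsub>M i\<^esub>" if "v i = \<zero>\<^bsub>M i\<^esub>" for i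
          unfolding that by (rule zero)
      qed
      moreover have "v \<oplus>\<^bsub>dsum M\<^esub> (\<lambda>i. \<ominus>\<^bsub>M i\<^esub> v i) = \<zero>\<^bsub>dsum M\<^esub>"
        unfolding s by (rule ext) (rule abelian_group.r_neg[OF grp c[OF v]])
      ultimately show "\<exists>w\<in>carrier (dsum M). v \<oplus>\<^bsub>dsum M\<^esub> w = \<zero>\<^bsub>dsum M\<^esub>" by blast
    qed
    show "\<forall>a v. a \<in> carrier K \<and> v \<in> carrier (dsum M) \<longrightarrow> a \<odot>\<^bsub>dsum M\<^esub> v \<in> carrier (dsum M)"
    proof (intro allI impI, elim conjE)
      fix a v assume a: "a \<in> carrier K" and v: "v \<in> carrier (dsum M)"
      show "a \<odot>\<^bsub>dsum M\<^esub> v \<in> carrier (dsum M)"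
        unfolding s
      proof (rule carrierI[OF _ _ v v])
        show "a \<odot>\<^bsub>M i\<^esub> v i \<in> carrier (M i)" for i
          by (rule module.smult_closed[OF md a c[OF v]])
        show "a \<odot>\<^bsub>M i\<^esub> v i = \<zero>\<^bsub>M i\<^esub>" if "v i = \<zero>\<^bsub>M i\<^esub>" for i
          unfolding that by (rule module.smult_r_null[OF md a])
      qed
    qed
    show "\<forall>v w. v \<in> carrier (dsum M) \<and> w \<in> carrier (dsum M) \<longrightarrow> v \<oplus>\<^bsub>dsum M\<^esub> w = w \<oplus>\<^bsub>dsum M\<^esub> v"
      unfolding s by (intro allI impI ext, elim conjE) (rule abelian_monoid.a_comm[OF ag c c])
    show "\<forall>u v w. u \<in> carrier (dsum M) \<and> v \<in> carrier (dsum M) \<and> w \<in> carrier (dsum M) \<longrightarrow>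
        (u \<oplus>\<^bsub>dsum M\<^esub> v) \<oplus>\<^bsub>dsum M\<^esub> w = u \<oplus>\<^bsub>dsum M\<^esub> (v \<oplus>\<^bsub>dsum M\<^esub> w)"
      unfolding s by (intro allI impI ext, elim conjE) (rule abelian_monoid.a_assoc[OF ag c c c])
    show "\<forall>v\<in>carrier (dsum M). v \<oplus>\<^bsub>dsum M\<^esub> \<zero>\<^bsub>dsum M\<^esub> = v"
      unfolding s by (intro ballI ext) (rule abelian_monoid.r_zero[OF ag c])
    show "\<forall>a b v. a \<in> carrier K \<and> b \<in> carrier K \<and> v \<in> carrier (dsum M) \<longrightarrow>
        (a \<otimes>\<^bsub>K\<^esub> b) \<odot>\<^bsub>dsum M\<^esub> v = a \<odot>\<^bsub>dsum M\<^esub> (b \<odot>\<^bsub>dsum M\<^esub> v)"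
      unfolding s by (intro allI impI ext, elim conjE) (rule module.smult_assoc1[OF md _ _ c])
    show "\<forall>v\<in>carrier (dsum M). \<one>\<^bsub>K\<^esub> \<odot>\<^bsub>dsum M\<^esub> v = v"
      unfolding s by (intro ballI ext) (rule module.smult_one[OF md c])
    show "\<forall>a b v. a \<in> carrier K \<and> b \<in> carrier K \<and> v \<in> carrier (dsum M) \<longrightarrow>
        (a \<oplus>\<^bsub>K\<^esub> b) \<odot>\<^bsub>dsum M\<^esub> v = a \<odot>\<^bsub>dsum M\<^esub> v \<oplus>\<^bsub>dsum M\<^esub> b \<odot>\<^bsub>dsum M\<^esub> v"
      unfolding s by (intro allI impI ext, elim conjE) (rule module.smult_l_distr[OF md _ _ c])
    show "\<forall>a v w. a \<in> carrier K \<and> v \<in> carrier (dsum M) \<and> w \<in> carrier (dsum M) \<longrightarrow>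
        a \<odot>\<^bsub>dsum M\<^esub> (v \<oplus>\<^bsub>dsum M\<^esub> w) = a \<odot>\<^bsub>dsum M\<^esub> v \<oplus>\<^bsub>dsum M\<^esub> a \<odot>\<^bsub>dsum M\<^esub> w"
      unfolding s by (intro allI impI ext, elim conjE) (rule module.smult_r_distr[OF md _ c c])
  qed
qed

text \<open>The nonzero vectors, of which there is at most one, form a generating set, and the
  dimension is the least size of a finite generating set.\<close>

lemma (in vectorspace) dim_le_1:
  assumes "\<And>v w. v \<in> carrier V \<Longrightarrow> w \<in> carrier V \<Longrightarrow> v \<noteq> \<zero>\<^bsub>V\<^esub> \<Longrightarrow> w \<noteq> \<zero>\<^bsub>V\<^esub> \<Longrightarrow> v = w"
  shows "fin_dim" "dim \<in> {0, 1}"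
proof -
  define A where "A = carrier V - {\<zero>\<^bsub>V\<^esub>}"
  have eq: "v = w" if "v \<in> A" "w \<in> A" for v w
    using assms[of v w] that by (simp add: A_def)
  have fin: "finite A"
  proof (cases "A = {}")
    case False
    then obtain a where "a \<in> A" by blast
    then have "A \<subseteq> {a}" using eq by blast
    then show ?thesis by (rule finite_subset) simp
  qed simp
  moreover have "card A \<le> 1"
    using eq card_le_Suc0_iff_eq[OF fin] unfolding One_nat_def by blast
  ultimately have A: "finite A" "card A \<le> 1" "A \<subseteq> carrier V" by (simp_all add: A_def)
  have "carrier V \<subseteq> span A"
    using in_own_span[OF A(3)] submodule.zero_closed[OF span_is_submodule[OF A(3)]]
    by (auto simp: A_def)
  then have gen: "gen_set A" using span_is_subset2[OF A(3)] by auto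
  show "fin_dim" unfolding fin_dim_def using A gen by blast
  have "dim \<le> card A" unfolding dim_def using A gen by (intro Least_le) blast
  then show "dim \<in> {0, 1}" using A(2) by auto
qed

text \<open>Membership of the sum in \<open>Z\<close> is carried through the induction because
  \<open>subquot_add\<close> requires it.\<close>

lemma (in subquotient) finsum_coset:
  assumes "finite I" "\<And>i. i \<in> I \<Longrightarrow> g i \<in> Z"
  shows "finsum (subquot M Z B) (\<lambda>i. B +>\<^bsub>M\<^esub> g i) I = B +>\<^bsub>M\<^esub> finsum M g I \<and> finsum M g I \<in> Z"
proof -
  interpret Q: vectorspace K "subquot M Z B" by (rule subquot_vectorspace)
  show ?thesis
    using assms
  proof (induction I rule: finite_induct)
    case empty
    then show ?case by (simp add: subquot_zero_coset)
  next
    case (insert i I)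
    have "(\<lambda>i. B +>\<^bsub>M\<^esub> g i) \<in> I \<rightarrow> carrier (subquot M Z B)" "g \<in> I \<rightarrow> carrier M"
      using insert.prems by (auto simp: subquot_carrier Z_carrier)
    then show ?case
      using insert by (simp add: subquot_add subquot_carrier Z_carrier Q.M.finsum_insert M.finsum_insert)
  qed
qed

section \<open>Seifert cohomology as the direct sum of its E-graded pieces\<close>

context finite_graph
begin

lemma finsum_SC:
  assumes "finite I" "\<And>i. i \<in> I \<Longrightarrow> g i \<in> span_of (configs T)"
  shows "finsum (SC T) g I = sum g I"
  using assms
proof (induction I rule: finite_induct)
  case (insert i I)
  have "g \<in> I \<rightarrow> carrier (SC T)" using insert.prems by simp
  then show ?case using insert by (simp add: M.finsum_insert)
qed simp

lemma SH_incl_subquotient_map: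
  "subquotient_map F2 (SC T) {x \<in> SC_bideg T n k. D_map x = \<zero>\<^bsub>SC T\<^esub>} (D_map ` SC_bideg T n (k - 1))
    (SC T) {x \<in> SC_deg T k. D_map x = \<zero>\<^bsub>SC T\<^esub>} (D_map ` SC_deg T (k - 1)) (\<lambda>x. x)"
proof -
  interpret src: subquotient F2 "SC T" "{x \<in> SC_bideg T n k. D_map x = \<zero>\<^bsub>SC T\<^esub>}"
    "D_map ` SC_bideg T n (k - 1)" by (rule SH_bideg_subquotient)
  interpret tgt: subquotient F2 "SC T" "{x \<in> SC_deg T k. D_map x = \<zero>\<^bsub>SC T\<^esub>}"
    "D_map ` SC_deg T (k - 1)" by (rule SH_subquotient)
  show ?thesis by unfold_locales (use SC_bideg_deg in auto)
qed

text \<open>D preserves E, so the complex is the direct sum of its homogeneous subcomplexes. The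
  projections \<open>E_part\<close> commute with D and hence split cocycles and primitives alike;
  only finitely many degrees are nonzero.\<close>

lemma SH_dsum_lin_iso:
  "lin_iso F2 (dsum (\<lambda>n. SH_bideg T n k)) (SH T k)
    (\<lambda>f. finsum (SH T k) (\<lambda>n. SH_incl T k (f n)) {n. f n \<noteq> \<zero>\<^bsub>SH_bideg T n k\<^esub>})"
proof -
  let ?Zn = "\<lambda>n. {x \<in> SC_bideg T n k. D_map x = \<zero>\<^bsub>SC T\<^esub>}"
  let ?Bn = "\<lambda>n. D_map ` SC_bideg T n (k - 1)"
  let ?Z = "{x \<in> SC_deg T k. D_map x = \<zero>\<^bsub>SC T\<^esub>}"
  let ?B = "D_map ` SC_deg T (k - 1)"
  let ?I = "{0..E_bound}"
  let ?S = "dsum (\<lambda>n. SH_bideg T n k)"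
  define \<Phi> where "\<Phi> f = finsum (SH T k) (\<lambda>n. SH_incl T k (f n)) {n. f n \<noteq> \<zero>\<^bsub>SH_bideg T n k\<^esub>}"
    for f
  interpret H: subquotient F2 "SC T" ?Z ?B by (rule SH_subquotient)
  interpret Hn: subquotient F2 "SC T" "?Zn n" "?Bn n" for n by (rule SH_bideg_subquotient)
  interpret inc: subquotient_map F2 "SC T" "?Zn n" "?Bn n" "SC T" ?Z ?B "\<lambda>x. x" for n
    by (rule SH_incl_subquotient_map)
  have SH: "SH T k = subquot (SC T) ?Z ?B" by (simp add: SH_def cohomology_def)
  have SHn: "SH_bideg T n k = subquot (SC T) (?Zn n) (?Bn n)" for n
    by (simp add: SH_bideg_def cohomology_def)
  interpret V: vectorspace F2 "SH T k" unfolding SH by (rule H.subquot_vectorspace)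
  interpret S: vectorspace F2 ?S
    by (rule dsum_vectorspace) (unfold SHn, rule Hn.subquot_vectorspace)
  \<comment> \<open>Representatives are chosen for all \<open>n\<close> at once; \<open>eval\<close>
    then computes \<Phi> from any such choice.\<close>
  have repr: "\<exists>g. \<forall>n. g n \<in> ?Zn n \<and> f n = ?Bn n +>\<^bsub>SC T\<^esub> g n" if "f \<in> carrier ?S" for f
  proof -
    have "f n \<in> carrier (SH_bideg T n k)" for n
      using that unfolding dsum_def by simp
    then have "f n \<in> (\<lambda>z. ?Bn n +>\<^bsub>SC T\<^esub> z) ` ?Zn n" for n
      unfolding SHn Hn.subquot_carrier .
    then have "\<forall>n. \<exists>x. x \<in> ?Zn n \<and> f n = ?Bn n +>\<^bsub>SC T\<^esub> x" by blast
    then show ?thesis by (rule choice)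
  qed
  have zeroH: "\<zero>\<^bsub>SH_bideg T n k\<^esub> = ?Bn n" for n
    unfolding SHn by (rule Hn.subquot_zero)
  have out: "?Bn n +>\<^bsub>SC T\<^esub> x = \<zero>\<^bsub>SH_bideg T n k\<^esub>" if "n \<notin> ?I" "x \<in> ?Zn n" for n x
  proof -
    have "x = \<zero>\<^bsub>SC T\<^esub>" using that SC_bideg_out_of_range by auto
    then show ?thesis unfolding SHn Hn.subquot_zero_coset by simp
  qed
  \<comment> \<open>The support of \<open>f\<close> varies with \<open>f\<close>. Summing over the
    fixed range \<open>?I\<close> adds only zero classes and makes linearity an identity of sums
    over one index set.\<close>
  have eval: "\<Phi> f = ?B +>\<^bsub>SC T\<^esub> (\<Sum>n\<in>?I. g n)" and sum_Z: "(\<Sum>n\<in>?I. g n) \<in> ?Z"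
    if g: "\<forall>n. g n \<in> ?Zn n \<and> f n = ?Bn n +>\<^bsub>SC T\<^esub> g n" for f g
  proof -
    have gc: "g n \<in> span_of (configs T)" for n using g Hn.Z_carrier by fastforce
    have gZ: "g n \<in> ?Z" for n using g inc.f_Z by blast
    have incl: "SH_incl T k (f n) = ?B +>\<^bsub>SC T\<^esub> g n" for n
      using g inc.induced_map_coset[of "g n" n] by (simp add: SH_incl_def)
    have "\<Phi> f = finsum (SH T k) (\<lambda>n. SH_incl T k (f n)) ?I"
      unfolding \<Phi>_def
    proof (rule V.M.add.finprod_mono_neutral_cong_left)
      show "{n. f n \<noteq> \<zero>\<^bsub>SH_bideg T n k\<^esub>} \<subseteq> ?I" using g out by fastforce
      show "(\<lambda>n. SH_incl T k (f n)) \<in> ?I \<rightarrow> carrier (SH T k)"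
        using gZ unfolding incl SH H.subquot_carrier by blast
      fix n assume "n \<in> ?I - {n. f n \<noteq> \<zero>\<^bsub>SH_bideg T n k\<^esub>}"
      then have "?Bn n +>\<^bsub>SC T\<^esub> g n = ?Bn n" using g by (auto simp: zeroH)
      then have "g n \<in> ?Bn n" using Hn.coset_eq_B_iff gc[of n] by simp
      then have "?B +>\<^bsub>SC T\<^esub> g n = ?B"
        using inc.f_B H.coset_eq_B_iff gc[of n] by simp
      then show "SH_incl T k (f n) = \<zero>\<^bsub>SH T k\<^esub>"
        unfolding incl SH H.subquot_zero .
    qed auto
    also have "\<dots> = ?B +>\<^bsub>SC T\<^esub> finsum (SC T) g ?I"
      unfolding incl SH using H.finsum_coset[of ?I g] gZ by blast
    also have fs: "finsum (SC T) g ?I = (\<Sum>n\<in>?I. g n)"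
      using gc by (intro finsum_SC) auto
    finally show "\<Phi> f = ?B +>\<^bsub>SC T\<^esub> (\<Sum>n\<in>?I. g n)" .
    show "(\<Sum>n\<in>?I. g n) \<in> ?Z" using H.finsum_coset[of ?I g] gZ fs by fastforce
  qed
  have "\<Phi> \<in> LinearCombinations.module_hom F2 ?S (SH T k)"
    unfolding LinearCombinations.module_hom_def
  proof (intro CollectI conjI ballI allI impI funcsetI)
    fix f assume f: "f \<in> carrier ?S"
    obtain g where g: "\<forall>n. g n \<in> ?Zn n \<and> f n = ?Bn n +>\<^bsub>SC T\<^esub> g n" using repr[OF f] by blast
    show "\<Phi> f \<in> carrier (SH T k)"
      unfolding eval[OF g] SH H.subquot_carrier using sum_Z[OF g] by (rule imageI)
  next
    fix f f' assume f: "f \<in> carrier ?S \<and> f' \<in> carrier ?S"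
    obtain g where g: "\<forall>n. g n \<in> ?Zn n \<and> f n = ?Bn n +>\<^bsub>SC T\<^esub> g n" using repr f by blast
    obtain g' where g': "\<forall>n. g' n \<in> ?Zn n \<and> f' n = ?Bn n +>\<^bsub>SC T\<^esub> g' n" using repr f by blast
    have "(f \<oplus>\<^bsub>?S\<^esub> f') n = ?Bn n +>\<^bsub>SC T\<^esub> (g n \<oplus>\<^bsub>SC T\<^esub> g' n)" for n
      using Hn.subquot_add[of "g n" n "g' n"] g g' unfolding SHn dsum_def by simp
    moreover have "g n \<oplus>\<^bsub>SC T\<^esub> g' n \<in> ?Zn n" for n
      using Hn.Z_closed(1)[of "g n" n "g' n"] g g' by blast
    ultimately have "\<Phi> (f \<oplus>\<^bsub>?S\<^esub> f') = ?B +>\<^bsub>SC T\<^esub> (\<Sum>n\<in>?I. g n \<oplus>\<^bsub>SC T\<^esub> g' n)"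
      by (intro eval) blast
    also have "\<dots> = \<Phi> f \<oplus>\<^bsub>SH T k\<^esub> \<Phi> f'"
      unfolding eval[OF g] eval[OF g'] SH H.subquot_add[OF sum_Z[OF g] sum_Z[OF g']]
      by (simp add: sum.distrib)
    finally show "\<Phi> (f \<oplus>\<^bsub>?S\<^esub> f') = \<Phi> f \<oplus>\<^bsub>SH T k\<^esub> \<Phi> f'" .
  next
    fix a f assume f: "a \<in> carrier F2 \<and> f \<in> carrier ?S"
    obtain g where g: "\<forall>n. g n \<in> ?Zn n \<and> f n = ?Bn n +>\<^bsub>SC T\<^esub> g n" using repr f by blast
    have a: "a \<in> carrier F2" using f by blast
    have "(a \<odot>\<^bsub>?S\<^esub> f) n = ?Bn n +>\<^bsub>SC T\<^esub> (a \<odot>\<^bsub>SC T\<^esub> g n)" for n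
      using Hn.subquot_smult[OF a, of "g n" n] g unfolding SHn dsum_def by simp
    moreover have "a \<odot>\<^bsub>SC T\<^esub> g n \<in> ?Zn n" for n
      using Hn.Z_closed(3)[OF a, of "g n" n] g by blast
    ultimately have "\<Phi> (a \<odot>\<^bsub>?S\<^esub> f) = ?B +>\<^bsub>SC T\<^esub> (\<Sum>n\<in>?I. a \<odot>\<^bsub>SC T\<^esub> g n)"
      by (intro eval) blast
    also have "(\<Sum>n\<in>?I. a \<odot>\<^bsub>SC T\<^esub> g n) = a \<odot>\<^bsub>SC T\<^esub> (\<Sum>n\<in>?I. g n)"
      by (cases a) simp_all
    also have "?B +>\<^bsub>SC T\<^esub> \<dots> = a \<odot>\<^bsub>SH T k\<^esub> \<Phi> f"
      unfolding eval[OF g] SH H.subquot_smult[OF a sum_Z[OF g]] ..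
    finally show "\<Phi> (a \<odot>\<^bsub>?S\<^esub> f) = a \<odot>\<^bsub>SH T k\<^esub> \<Phi> f" .
  qed
  then have lin: "linear_map F2 ?S (SH T k) \<Phi>" by unfold_locales
  have part_sum: "E_part m (\<Sum>n\<in>?I. g n) = g m" if "\<forall>n. g n \<in> ?Zn n" "m \<in> ?I" for g m
  proof -
    have "E_part m (g n) = (if n = m then g n else 0)" for n
      using E_part_bideg_eq[of "g n" n k m] that(1) by auto
    then show ?thesis using that(2) by (simp add: additive_map_sum[OF E_part_additive])
  qed
  have "inj_on \<Phi> (carrier ?S)"
  proof (rule inj_onI)
    fix f f' assume f: "f \<in> carrier ?S" "f' \<in> carrier ?S" and eq: "\<Phi> f = \<Phi> f'"
    obtain g where g: "\<forall>n. g n \<in> ?Zn n \<and> f n = ?Bn n +>\<^bsub>SC T\<^esub> g n" using repr f by blast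
    obtain g' where g': "\<forall>n. g' n \<in> ?Zn n \<and> f' n = ?Bn n +>\<^bsub>SC T\<^esub> g' n" using repr f by blast
    have gc: "g n \<in> span_of (configs T)" "g' n \<in> span_of (configs T)" for n
      using g g' Hn.Z_carrier by fastforce+
    have sc: "(\<Sum>n\<in>?I. g n) \<in> span_of (configs T)" "(\<Sum>n\<in>?I. g' n) \<in> span_of (configs T)"
      using gc by (auto intro: span_of_sum)
    have "(\<Sum>n\<in>?I. g n) \<ominus>\<^bsub>SC T\<^esub> (\<Sum>n\<in>?I. g' n) \<in> ?B"
      using eq sc H.coset_eq_iff unfolding eval[OF g] eval[OF g'] by simp
    then obtain y where y: "y \<in> SC_deg T (k - 1)" "(\<Sum>n\<in>?I. g n) + (\<Sum>n\<in>?I. g' n) = D_map y"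
      unfolding SC_minus[OF sc(2)] by blast
    show "f = f'"
    proof
      fix m
      show "f m = f' m"
      proof (cases "m \<in> ?I")
        case True
        \<comment> \<open>The degree-\<open>m\<close> component of the common primitive
          \<open>y\<close> is a primitive for the difference of the degree-\<open>m\<close>
          representatives.\<close>
        have "g m + g' m = E_part m (D_map y)"
          unfolding y(2)[symmetric] using part_sum[OF _ True] g g'
          by (simp add: additive_map_add[OF E_part_additive])
        also have "\<dots> = D_map (E_part m y)" using SC_deg_carrier[OF y(1)] by (rule E_part_D)
        also have "\<dots> \<in> ?Bn m" using E_part_bideg[OF y(1)] by blast
        finally have "g m \<ominus>\<^bsub>SC T\<^esub> g' m \<in> ?Bn m" by (simp add: SC_minus gc)
        then show ?thesis using g g' Hn.coset_eq_iff[of "g m" "g' m" m] gc by simp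
      next
        case False
        have m: "g m \<in> ?Zn m" "f m = ?Bn m +>\<^bsub>SC T\<^esub> g m"
          and m': "g' m \<in> ?Zn m" "f' m = ?Bn m +>\<^bsub>SC T\<^esub> g' m"
          using g g' by blast+
        show ?thesis
          unfolding m(2) m'(2) out[OF False m(1)] out[OF False m'(1)] ..
      qed
    qed
  qed
  moreover have "\<Phi> ` carrier ?S = carrier (SH T k)"
  proof
    show "\<Phi> ` carrier ?S \<subseteq> carrier (SH T k)"
      using linear_map.axioms(3)[OF lin] by (auto simp: mod_hom_def mod_hom_axioms_def LinearCombinations.module_hom_def)
    show "carrier (SH T k) \<subseteq> \<Phi> ` carrier ?S"
    proof
      fix X assume "X \<in> carrier (SH T k)"
      then obtain x where x: "x \<in> ?Z" "X = ?B +>\<^bsub>SC T\<^esub> x" unfolding SH H.subquot_carrier by blast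
      have xc: "x \<in> span_of (configs T)" using x(1) SC_deg_carrier by blast
      \<comment> \<open>The preimage is the family of classes of the homogeneous components; each is
        a cocycle since D commutes with \<open>E_part\<close>.\<close>
      define f where "f n = ?Bn n +>\<^bsub>SC T\<^esub> E_part n x" for n
      have "E_part n x \<in> ?Zn n" for n
        using x(1) E_part_bideg[of x k n] E_part_D[OF xc, of n]
        by (simp add: additive_map_zero[OF E_part_additive])
      then have g: "\<forall>n. E_part n x \<in> ?Zn n \<and> f n = ?Bn n +>\<^bsub>SC T\<^esub> E_part n x"
        by (simp add: f_def)
      have "{n. f n \<noteq> \<zero>\<^bsub>SH_bideg T n k\<^esub>} \<subseteq> ?I" using g out by fastforce
      then have "finite {n. f n \<noteq> \<zero>\<^bsub>SH_bideg T n k\<^esub>}" by (rule finite_subset) simp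
      moreover have "f n \<in> carrier (SH_bideg T n k)" for n
        using g unfolding SHn Hn.subquot_carrier by blast
      ultimately have "f \<in> carrier ?S" by (simp add: dsum_def)
      moreover have "\<Phi> f = X" unfolding eval[OF g] sum_E_part[OF xc] x(2) ..
      ultimately show "X \<in> \<Phi> ` carrier ?S" by blast
    qed
  qed
  ultimately have "lin_iso F2 ?S (SH T k) \<Phi>"
    using lin by (simp add: lin_iso_def bij_betw_def)
  then show ?thesis unfolding \<Phi>_def .
qed

end

section \<open>Perfect matchings of a tree\<close>

text \<open>The cycle is found at the end of a path of maximal length.\<close>

lemma exists_cycle_if_no_dead_ends:
  assumes fin: "finite V" and ne: "H \<noteq> {}"
    and H: "\<And>e. e \<in> H \<Longrightarrow> e \<subseteq> V \<and> card e = 2"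
    and ext: "\<And>u v. {u, v} \<in> H \<Longrightarrow> \<exists>w. w \<noteq> u \<and> {v, w} \<in> H"
  shows "\<exists>vs. 3 \<le> length vs \<and> distinct vs \<and>
    successively (\<lambda>u v. {u, v} \<in> H) vs \<and> {last vs, hd vs} \<in> H"
proof -
  define P where "P vs \<longleftrightarrow> distinct vs \<and> set vs \<subseteq> V \<and> 2 \<le> length vs \<and>
    successively (\<lambda>u v. {u, v} \<in> H) vs" for vs
  have edge_neq: "u \<noteq> v" if "{u, v} \<in> H" for u v
    using H[OF that] by auto
  obtain e where e: "e \<in> H" using ne by blast
  then obtain u v where uv: "e = {u, v}" using H[OF e] by (meson card_2_iff)
  have P0: "P [u, v]" using e H[OF e] edge_neq[of u v] by (simp add: P_def uv)
  have "length vs \<le> card V" if "P vs" for vs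
    using that card_mono[OF fin, of "set vs"] by (simp add: P_def distinct_card)
  then have bound: "\<forall>vs. P vs \<longrightarrow> length vs < card V + 1"
    by (simp add: less_Suc_eq_le)
  obtain vs where vs: "P vs" "\<And>ws. P ws \<Longrightarrow> length ws \<le> length vs"
    using ex_has_greatest_nat[OF P0 bound] by (elim exE conjE) simp
  obtain x y zs where xy: "vs = x # y # zs"
    using vs(1) by (cases vs rule: remdups_adj.cases) (auto simp: P_def)
  have "{y, x} \<in> H" using vs(1) by (simp add: P_def xy insert_commute)
  then obtain w where w: "w \<noteq> y" "{x, w} \<in> H" using ext by blast
  have "w \<in> set vs"
  proof (rule ccontr)
    assume "w \<notin> set vs"
    then have "P (w # vs)"
      using vs(1) w(2) H[OF w(2)] by (simp add: P_def xy insert_commute)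
    then show False using vs(2)[of "w # vs"] by simp
  qed
  \<comment> \<open>The path is extended at its head \<open>x\<close>. By maximality
    \<open>w\<close> is on it, and it is neither \<open>x\<close> nor \<open>y\<close>, so the
    closed part \<open>x, y, ..., w\<close> has at least three vertices.\<close>
  then have "w \<in> set zs" using w edge_neq[OF w(2)] by (auto simp: xy)
  then obtain as bs where zs: "zs = as @ w # bs" by (meson split_list)
  define cs where "cs = x # y # as @ [w]"
  have "vs = cs @ bs" by (simp add: xy zs cs_def)
  then have "distinct cs" "successively (\<lambda>u v. {u, v} \<in> H) cs"
    using vs(1) by (auto simp: P_def successively_append_iff)
  moreover have "3 \<le> length cs" "{last cs, hd cs} \<in> H"
    using w(2) by (simp_all add: cs_def insert_commute)
  ultimately show ?thesis by blast
qed

lemma finite_tree_finite_graph: "finite_tree T \<Longrightarrow> finite_graph T"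
  by (simp add: finite_tree_def finite_graph_def)

text \<open>In the symmetric difference of two perfect matchings an edge of one can always be
  continued by an edge of the other, so a nonempty difference contains a cycle, which a tree
  excludes.\<close>

lemma perfect_matching_unique:
  assumes T: "finite_tree T"
    and C: "C \<in> configs T" "marks C = {}" and C': "C' \<in> configs T" "marks C' = {}"
  shows "C = C'"
proof -
  interpret finite_graph T by (rule finite_tree_finite_graph[OF T])
  let ?H = "(reds C - reds C') \<union> (reds C' - reds C)"
  \<comment> \<open>Stated for a pair \<open>C1\<close>, \<open>C2\<close> so that it applies with
    the two matchings in either order.\<close>
  have ext: "\<exists>w. w \<noteq> u \<and> {v, w} \<in> reds C2 - reds C1"
    if C1: "C1 \<in> configs T" and C2: "C2 \<in> configs T" "marks C2 = {}"
      and uv: "{u, v} \<in> reds C1 - reds C2" for C1 C2 u v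
  proof -
    have "v \<in> verts T" using uv configD(5)[OF C1] edge_subset by blast
    then have "v \<in> marks C2 \<union> \<Union>(reds C2)" unfolding configD(4)[OF C2(1)] .
    then obtain f where f: "f \<in> reds C2" "v \<in> f" unfolding C2(2) by blast
    obtain a b where ab: "f = {a, b}" using configD(9)[OF C2(1) f(1)] by (meson card_2_iff)
    obtain w where w: "f = {v, w}" using f(2) unfolding ab by blast
    have "f \<noteq> {u, v}" using uv f(1) by blast
    \<comment> \<open>Otherwise \<open>f\<close> and \<open>{u, v}\<close> would be two different
      red edges of \<open>C1\<close> sharing the vertex \<open>v\<close>.\<close>
    moreover have "f \<notin> reds C1"
      using configD(3)[OF C1, of f "{u, v}"] uv \<open>f \<noteq> {u, v}\<close> f(2) by blast
    ultimately show ?thesis using f(1) unfolding w by (intro exI[of _ w]) (auto simp: insert_commute)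
  qed
  have "?H = {}"
  proof (rule ccontr)
    assume "?H \<noteq> {}"
    have sub: "?H \<subseteq> edges T" using configD(5)[OF C(1)] configD(5)[OF C'(1)] by blast
    have "\<exists>vs. 3 \<le> length vs \<and> distinct vs \<and>
        successively (\<lambda>u v. {u, v} \<in> ?H) vs \<and> {last vs, hd vs} \<in> ?H"
    proof (rule exists_cycle_if_no_dead_ends[OF finite_verts \<open>?H \<noteq> {}\<close>])
      show "e \<subseteq> verts T \<and> card e = 2" if "e \<in> ?H" for e
        using that sub edge_subset edge_card by blast
      show "\<exists>w. w \<noteq> u \<and> {v, w} \<in> ?H" if "{u, v} \<in> ?H" for u v
        using that
      proof
        assume "{u, v} \<in> reds C - reds C'"
        from ext[OF C(1) C' this] show ?thesis by blast
      next
        assume "{u, v} \<in> reds C' - reds C"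
        from ext[OF C'(1) C this] show ?thesis by blast
      qed
    qed
    then obtain vs where vs: "3 \<le> length vs" "distinct vs"
      "successively (\<lambda>u v. {u, v} \<in> ?H) vs" "{last vs, hd vs} \<in> ?H" by blast
    have "successively (\<lambda>u v. {u, v} \<in> edges T) vs"
      by (rule successively_mono[OF vs(3)]) (use sub in blast)
    moreover have "{last vs, hd vs} \<in> edges T" using vs(4) sub by blast
    ultimately show False using T vs(1,2) unfolding finite_tree_def by blast
  qed
  then have "reds C = reds C'" by blast
  then show ?thesis using C(2) C'(2) by (cases C; cases C') auto
qed

section \<open>The limit term\<close>

text \<open>A configuration of nonzero Q-degree has a minus, hence a mark, so the homotopies reach
  all of it.\<close>

lemma (in finite_graph) cocycle_nonzero_degree:
  assumes "x \<in> SC_deg T k" "k \<noteq> 0" "total_diff x = 0"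
  shows "\<exists>y\<in>SC_deg T (k - 1). x = total_diff y"
proof (rule marked_cocycle_is_coboundary[OF finite_verts _ assms(3)])
  have "marks C \<inter> verts T \<noteq> {}" if "C \<in> configs T" "Q_deg C = k" for C
  proof -
    have "minuses C \<noteq> {}" using that(2) assms(2) by (auto simp: Q_deg_def)
    then show ?thesis using configD(4)[OF that(1)] by blast
  qed
  then have "{C \<in> configs T. Q_deg C = k} \<subseteq> {C \<in> configs T. Q_deg C = k \<and> marks C \<inter> verts T \<noteq> {}}"
    by blast
  then show "x \<in> span_of {C \<in> configs T. Q_deg C = k \<and> marks C \<inter> verts T \<noteq> {}}"
    using assms(1) unfolding SC_deg_def by (rule span_of_mono)
qed

text \<open>A cocycle of degree 0 is determined by its coefficients at the perfect matchings: if
  they vanish, every configuration in it is marked, and it is a coboundary from degree -1.\<close>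

lemma (in finite_graph) cocycle_degree_0:
  assumes x: "x \<in> SC_deg T 0" "total_diff x = 0"
    and unmarked: "\<And>C. C \<in> configs T \<Longrightarrow> marks C = {} \<Longrightarrow> Poly_Mapping.lookup x C = 0"
  shows "x = 0"
proof -
  have "x \<in> span_of {C \<in> configs T. Q_deg C = 0 \<and> marks C \<inter> verts T \<noteq> {}}"
    unfolding span_of_def
  proof (rule CollectI, rule subsetI, rule CollectI)
    fix C assume C: "C \<in> Poly_Mapping.keys x"
    then have C': "C \<in> configs T" "Q_deg C = 0" using x(1) by (auto simp: SC_deg_def span_of_def)
    have "marks C \<noteq> {}" using unmarked[OF C'(1)] C unfolding in_keys_iff by blast
    moreover have "marks C \<subseteq> verts T" using configD(4)[OF C'(1)] by blast
    ultimately show "C \<in> configs T \<and> Q_deg C = 0 \<and> marks C \<inter> verts T \<noteq> {}" using C' by blast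
  qed
  then obtain y where y: "y \<in> SC_deg T (0 - 1)" "x = total_diff y"
    using marked_cocycle_is_coboundary[OF finite_verts _ x(2)] by blast
  \<comment> \<open>A number of minuses is never negative, so the primitive is zero.\<close>
  have "{C \<in> configs T. Q_deg C = 0 - 1} = {}" by (auto simp: Q_deg_def)
  then have "y = 0" using y(1) unfolding SC_deg_def by (simp only: span_of_empty singleton_iff)
  then show ?thesis using y(2) by (simp add: additive_map_zero[OF total_diff_additive])
qed

text \<open>Both cocycles have coefficient 1 at the single perfect matching, so their sum has
  coefficient 0 there and vanishes.\<close>

lemma tree_cocycle_degree_0_unique:
  assumes T: "finite_tree T"
    and x: "x \<in> SC_deg T 0" "total_diff x = 0" "x \<noteq> 0"
    and y: "y \<in> SC_deg T 0" "total_diff y = 0" "y \<noteq> 0"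
  shows "x = y"
proof -
  interpret finite_graph T by (rule finite_tree_finite_graph[OF T])
  obtain C where C: "C \<in> configs T" "marks C = {}" "Poly_Mapping.lookup x C \<noteq> 0"
    using cocycle_degree_0[OF x(1,2)] x(3) by blast
  obtain C' where C': "C' \<in> configs T" "marks C' = {}" "Poly_Mapping.lookup y C' \<noteq> 0"
    using cocycle_degree_0[OF y(1,2)] y(3) by blast
  have "x + y = 0"
  proof (rule cocycle_degree_0)
    show "x + y \<in> SC_deg T 0" using x(1) y(1) by (simp add: SC_deg_def)
    show "total_diff (x + y) = 0" using x(2) y(2) by (simp add: additive_map_add[OF total_diff_additive])
    fix C'' assume "C'' \<in> configs T" "marks C'' = {}"
    then have "C'' = C" "C'' = C'" using perfect_matching_unique[OF T] C(1,2) C'(1,2) by blast+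
    then have "Poly_Mapping.lookup x C'' = 1" "Poly_Mapping.lookup y C'' = 1"
      using C(3) C'(3) by simp_all
    then show "Poly_Mapping.lookup (x + y) C'' = 0" by (simp add: lookup_add)
  qed
  then show ?thesis by (simp add: poly_mapping_bit_add_eq_0_iff)
qed

text \<open>A nonzero component lies in degree \<open>k = 0\<close> and is the class of the only
  nonzero cocycle there; its index \<open>p\<close> is the exact filtration degree of that cocycle.
  Any two nonzero components, of one family or of two, therefore have the same index and the same
  value.\<close>

lemma Seifert_Einf_total_unique:
  assumes T: "finite_tree T"
    and f: "f \<in> carrier (Seifert_Einf_total T)" "f \<noteq> \<zero>\<^bsub>Seifert_Einf_total T\<^esub>"
    and g: "g \<in> carrier (Seifert_Einf_total T)" "g \<noteq> \<zero>\<^bsub>Seifert_Einf_total T\<^esub>"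
  shows "f = g"
proof -
  interpret finite_graph T by (rule finite_tree_finite_graph[OF T])
  let ?E = "\<lambda>(p, k). ss_Einf (SC T) (SC_filt T) total_diff p k"
  have repr: "k = 0 \<and> (\<exists>x. x \<in> SC_filt T p 0 \<and> x \<notin> SC_filt T (p + 1) 0 \<and> total_diff x = 0 \<and> x \<noteq> 0 \<and>
      h (p, k) = ((total_diff ` cochains (SC_filt T) (0 - 1) \<inter> SC_filt T p 0)
        <+>\<^bsub>SC T\<^esub> {x \<in> SC_filt T (p + 1) 0. total_diff x = \<zero>\<^bsub>SC T\<^esub>}) +>\<^bsub>SC T\<^esub> x)"
    if h: "h \<in> carrier (Seifert_Einf_total T)" "h (p, k) \<noteq> \<zero>\<^bsub>?E (p, k)\<^esub>" for h p k
  proof -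
    let ?Z = "{x \<in> SC_filt T p k. total_diff x = \<zero>\<^bsub>SC T\<^esub>}"
    let ?B = "(total_diff ` cochains (SC_filt T) (k - 1) \<inter> SC_filt T p k)
      <+>\<^bsub>SC T\<^esub> {x \<in> SC_filt T (p + 1) k. total_diff x = \<zero>\<^bsub>SC T\<^esub>}"
    interpret Q: subquotient F2 "SC T" ?Z ?B by (rule Einf_subquotient)
    have E: "?E (p, k) = subquot (SC T) ?Z ?B" by (simp add: ss_Einf_def)
    have "h (p, k) \<in> carrier (?E (p, k))"
      using h(1) unfolding Seifert_Einf_total_def dsum_def by simp
    then obtain x where x: "x \<in> ?Z" "h (p, k) = ?B +>\<^bsub>SC T\<^esub> x"
      unfolding E Q.subquot_carrier by blast
    have xB: "x \<notin> ?B"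
    proof
      assume "x \<in> ?B"
      then have "?B +>\<^bsub>SC T\<^esub> x = ?B" using Q.coset_eq_B_iff[OF Q.Z_carrier[OF x(1)]] by blast
      then show False using h(2) unfolding x(2) E Q.subquot_zero by simp
    qed
    have x': "x \<in> SC_filt T p k" "total_diff x = 0" using x(1) by auto
    \<comment> \<open>In other degrees \<open>x\<close> is a coboundary lying in
      \<open>SC_filt T p k\<close>, hence in the denominator of the limit term.\<close>
    have k: "k = 0"
    proof (rule ccontr)
      assume "k \<noteq> 0"
      then obtain y where y: "y \<in> SC_deg T (k - 1)" "x = total_diff y"
        using cocycle_nonzero_degree[OF SC_filt_deg[OF x'(1)] _ x'(2)] by blast
      have "x = total_diff y \<oplus>\<^bsub>SC T\<^esub> 0" using y(2) by simp
      moreover have "y \<in> SC_filt T 0 (k - 1)" using y(1) cochains_SC cochains_eq by blast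
      ultimately have "x \<in> ?B"
        unfolding Einf_B_iff using x'(1) y(2) F_closed(2)[of "p + 1" k]
          additive_map_zero[OF total_diff_additive] by force
      then show False using xB by blast
    qed
    have "x \<notin> SC_filt T (p + 1) k"
    proof
      assume x1: "x \<in> SC_filt T (p + 1) k"
      have "0 \<in> SC_filt T 0 (k - 1)" "total_diff 0 \<in> SC_filt T p k" "x = total_diff 0 \<oplus>\<^bsub>SC T\<^esub> x"
        using F_closed(2)[of 0 "k - 1"] F_closed(2)[of p k]
        by (simp_all add: additive_map_zero[OF total_diff_additive])
      then have "x \<in> ?B" unfolding Einf_B_iff using x1 x(1) by blast
      then show False using xB by blast
    qed
    moreover have "x \<noteq> 0" using Q.B_closed(2) xB by auto
    ultimately show ?thesis using k x' x(2) by blast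
  qed
  have zero: "\<zero>\<^bsub>Seifert_Einf_total T\<^esub> = (\<lambda>i. \<zero>\<^bsub>?E i\<^esub>)"
    by (simp add: Seifert_Einf_total_def dsum_def)
  have same: "(p, k) = (q, l) \<and> h (p, k) = h' (q, l)"
    if h: "h \<in> carrier (Seifert_Einf_total T)" "h (p, k) \<noteq> \<zero>\<^bsub>?E (p, k)\<^esub>"
      and h': "h' \<in> carrier (Seifert_Einf_total T)" "h' (q, l) \<noteq> \<zero>\<^bsub>?E (q, l)\<^esub>" for h h' p k q l
  proof -
    obtain x where x: "k = 0" "x \<in> SC_filt T p 0" "x \<notin> SC_filt T (p + 1) 0" "total_diff x = 0" "x \<noteq> 0"
      "h (p, k) = ((total_diff ` cochains (SC_filt T) (0 - 1) \<inter> SC_filt T p 0)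
        <+>\<^bsub>SC T\<^esub> {x \<in> SC_filt T (p + 1) 0. total_diff x = \<zero>\<^bsub>SC T\<^esub>}) +>\<^bsub>SC T\<^esub> x"
      using repr[OF h] by blast
    obtain y where y: "l = 0" "y \<in> SC_filt T q 0" "y \<notin> SC_filt T (q + 1) 0" "total_diff y = 0" "y \<noteq> 0"
      "h' (q, l) = ((total_diff ` cochains (SC_filt T) (0 - 1) \<inter> SC_filt T q 0)
        <+>\<^bsub>SC T\<^esub> {x \<in> SC_filt T (q + 1) 0. total_diff x = \<zero>\<^bsub>SC T\<^esub>}) +>\<^bsub>SC T\<^esub> y"
      using repr[OF h'] by blast
    have xy: "x = y"
      using tree_cocycle_degree_0_unique[OF T SC_filt_deg[OF x(2)] x(4,5) SC_filt_deg[OF y(2)] y(4,5)] .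
    \<comment> \<open>The same cocycle cannot leave the filtration after step \<open>p\<close> and
      still belong to a later step \<open>q\<close>.\<close>
    have "\<not> p + 1 \<le> q" using F_antimono[of "p + 1" q y 0] x(3) y(2) xy by blast
    moreover have "\<not> q + 1 \<le> p" using F_antimono[of "q + 1" p x 0] y(3) x(2) xy by blast
    ultimately have "p = q" by simp
    then show ?thesis using x(1,6) y(1,6) xy by simp
  qed
  obtain i where i: "f i \<noteq> \<zero>\<^bsub>?E i\<^esub>" using f(2) unfolding zero by blast
  obtain j where j: "g j \<noteq> \<zero>\<^bsub>?E j\<^esub>" using g(2) unfolding zero by blast
  have same': "i' = j' \<and> h i' = h' j'"
    if "h \<in> carrier (Seifert_Einf_total T)" "h i' \<noteq> \<zero>\<^bsub>?E i'\<^esub>"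
      "h' \<in> carrier (Seifert_Einf_total T)" "h' j' \<noteq> \<zero>\<^bsub>?E j'\<^esub>" for h h' i' j'
    using same[of h "fst i'" "snd i'" h' "fst j'" "snd j'", unfolded prod.collapse, OF that] .
  show ?thesis
  proof
    fix m
    show "f m = g m"
    proof (cases "m = i")
      case True
      then show ?thesis using same'[OF f(1) i g(1) j] by (elim conjE) (simp only:)
    next
      case False
      \<comment> \<open>Comparing \<open>f\<close> with itself shows that it has no second nonzero
        component; comparing \<open>g\<close> with \<open>f\<close> does the same for
        \<open>g\<close>.\<close>
      then have "f m = \<zero>\<^bsub>?E m\<^esub>" using same'[OF f(1) _ f(1) i, of m] by blast
      moreover have "g m = \<zero>\<^bsub>?E m\<^esub>" using same'[OF g(1) _ f(1) i, of m] False by blast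
      ultimately show ?thesis by simp
    qed
  qed
qed

lemma (in finite_graph) Seifert_Einf_total_vectorspace: "vectorspace F2 (Seifert_Einf_total T)"
  unfolding Seifert_Einf_total_def
proof (rule dsum_vectorspace)
  fix i :: "int \<times> int"
  have "vectorspace F2 (ss_Einf (SC T) (SC_filt T) total_diff p k)" for p k
    unfolding ss_Einf_def by (rule subquotient.subquot_vectorspace[OF Einf_subquotient])
  then show "vectorspace F2 (case i of (p, k) \<Rightarrow> ss_Einf (SC T) (SC_filt T) total_diff p k)"
    by (cases i) (simp only: prod.case)
qed

theorem theorem1:
  fixes T :: "'a ugraph"
  assumes "finite_tree T"
  shows
    "spectral_sequence F2 (Seifert_E T) (Seifert_d T) (ss_next (SC T) (SC_filt T) total_diff) \<and>
     (\<forall>k. lin_iso F2 (dsum (\<lambda>n. SH_bideg T n k)) (SH T k)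
            (\<lambda>f. finsum (SH T k) (\<lambda>n. SH_incl T k (f n)) {n. f n \<noteq> \<zero>\<^bsub>SH_bideg T n k\<^esub>})) \<and>
     (\<forall>n k. lin_iso F2 (SH_bideg T n k) (Seifert_E T 1 n k) (SH_to_E1 T n k)) \<and>
     (\<forall>n k. linear_map F2 (SH_bideg T n k) (SH_bideg T (n + 1) (k + 1)) (SH_d T n k) \<and>
            (\<forall>X\<in>carrier (SH_bideg T n k).
               Seifert_d T 1 n k (SH_to_E1 T n k X) =
               SH_to_E1 T (n + 1) (k + 1) (SH_d T n k X))) \<and>
     (\<forall>n\<ge>2. \<forall>p k. linear_map F2 (Seifert_E T n p k) (Seifert_E T n (p + int n) (k + 1))
                     (Seifert_d T n p k)) \<and>
     ss_converges F2 (SC T) (SC_filt T) total_diff \<and>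
     vectorspace F2 (Seifert_Einf_total T) \<and>
     vectorspace.fin_dim F2 (Seifert_Einf_total T) \<and>
     vectorspace.dim F2 (Seifert_Einf_total T) \<in> {0, 1}"
proof -
  interpret finite_graph T by (rule finite_tree_finite_graph[OF assms])
  have tot: "vectorspace F2 (Seifert_Einf_total T)" by (rule Seifert_Einf_total_vectorspace)
  show ?thesis
  proof (intro conjI allI ballI impI)
    show "spectral_sequence F2 (Seifert_E T) (Seifert_d T) (ss_next (SC T) (SC_filt T) total_diff)"
      unfolding Seifert_E_def Seifert_d_def by (rule filtered_complex_spectral_sequence)
    show "linear_map F2 (Seifert_E T n p k) (Seifert_E T n (p + int n) (k + 1)) (Seifert_d T n p k)"
      if "n \<ge> 2" for n p k
      unfolding Seifert_E_def Seifert_d_def by (rule d_linear_map) (use that in simp)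
    show "vectorspace.fin_dim F2 (Seifert_Einf_total T)"
      "vectorspace.dim F2 (Seifert_Einf_total T) \<in> {0, 1}"
      using vectorspace.dim_le_1[OF tot Seifert_Einf_total_unique[OF assms]] by blast+
  qed (rule SH_dsum_lin_iso SH_to_E1_lin_iso SH_d_linear_map SH_to_E1_d tot
      bounded_filtered_complex_converges; assumption)+
qed

end
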